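(* Let $d, K, n \geq 1$ be integers, $L \ge 0$, $\sigma \geq 0$ and $\lambda_n > 0$. Let $X$ be a $[0,1]^d$-valued random variable and $Y = f(X) + \varepsilon$, where $f : [0,1]^d \to \mathbb R$ is $L$-Lipschitz (with respect to the Euclidean norm) and $\varepsilon$ is a real-valued random variable with $\mathbb E(\varepsilon \mid X) = 0$ and $\mathrm{Var}(\varepsilon \mid X) \leq \sigma^2 < \infty$ almost surely. Let $\widehat f_n$ be the Mondrian forest regression estimate with $K$ trees and lifetime $\lambda_n$ based on $n$ i.i.d. copies $(X_1,Y_1),\dots,(X_n,Y_n)$ of $(X,Y)$. Then its quadratic risk $R(\widehat f_n) = \mathbb E\big[(\widehat f_n(X) - f(X))^2\big]$ satisfies $$R(\widehat f_n) \leq \frac{4 d L^2}{\lambda_n^2} + \frac{1 + e^d(1+\lambda_n)^d}{n}\left(2\sigma^2 + 9 \|f\|_\infty^2\right).$$ In particular, the choice $\lambda_n = n^{1/(d+2)}$ yields $R(\widehat f_n) = O(n^{-2/(d+2)})$ as $n \to \infty$.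
   Context: Mondrian process. For a box $C = \prod_{j=1}^d [a_j,b_j]$, write $|C| = \sum_{j=1}^d (b_j-a_j)$. For $\lambda > 0$, $\mathrm{MP}(\lambda, C)$ is the distribution of the random tree partition of $C$ produced by calling $\mathrm{SplitCell}(C,0,\lambda)$, where $\mathrm{SplitCell}(A,\tau,\lambda)$, for a cell $A$ with sides $[a_j,b_j]$, is defined recursively: draw an exponential variable $E_A$ with rate $|A|$ (independent of everything else). If $\tau + E_A \leq \lambda$, draw a split dimension $J \in \{1,\dots,d\}$ with $\mathbb P(J=j) = (b_j-a_j)/|A|$ and a threshold $\nu$ uniform on $[a_J,b_J]$, split $A$ into $\{x \in A : x_J \leq \nu\}$ and $\{x \in A : x_J > \nu\}$, and call $\mathrm{SplitCell}(\cdot, \tau + E_A, \lambda)$ on both children (with fresh independent randomness). Otherwise do nothing, so $A$ is a leaf cell. The leaf cells form the partition. Mondrian forest regression estimate. Let $M^{(1)}_{\lambda_n},\dots,M^{(K)}_{\lambda_n}$ be i.i.d. with distribution $\mathrm{MP}(\lambda_n,[0,1]^d)$, independent of the data $(X_1,Y_1),\dots,(X_n,Y_n)$ and of $(X,Y)$, the latter being independent of the data. For $x \in [0,1]^d$, $\widehat f_n^{(k)}(x)$ is the average of the $Y_i$, $1\le i\le n$, such that $X_i$ belongs to the leaf cell of $M^{(k)}_{\lambda_n}$ containing $x$ (and $0$ if there is no such $X_i$), and $\widehat f_n = \frac1K\sum_{k=1}^K \widehat f_n^{(k)}$. The risk is an expectation over $X$, the training data and the random partitions. $\|f\|_\infty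 = \sup_{x\in[0,1]^d}|f(x)|$. *)

theory Defs
  imports "HOL-Probability.Probability"
begin

section \<open>The Mondrian process\<close>

text \<open>
  A box is given by its pair of corners \<open>(a, b)\<close>. A tree partition is stored as a finite binary
  tree whose inner nodes carry the split dimension and the threshold of the split.
\<close>

type_synonym 'd box = "(real^'d) \<times> (real^'d)"
type_synonym 'd split_tree = "('d \<times> real) tree"

definition box_length :: "'d::finite box \<Rightarrow> real" where
  "box_length A = (\<Sum>j\<in>UNIV. snd A $ j - fst A $ j)"

definition lower_box :: "'d::finite \<Rightarrow> real \<Rightarrow> 'd box \<Rightarrow> 'd box" where
  "lower_box j \<nu> A = (fst A, \<chi> i. if i = j then \<nu> else snd A $ i)"

definition upper_box :: "'d::finite \<Rightarrow> real \<Rightarrow> 'd box \<Rightarrow> 'd box" where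
  "upper_box j \<nu> A = ((\<chi> i. if i = j then \<nu> else fst A $ i), snd A)"

abbreviation split_tree_space :: "'d::finite split_tree measure" where
  "split_tree_space \<equiv> tree_sigma (count_space UNIV \<Otimes>\<^sub>M borel)"

definition split_time :: "'d::finite box \<Rightarrow> real measure" where
  "split_time A = density lborel (exponential_density (box_length A))"

definition split_dim :: "'d::finite box \<Rightarrow> 'd measure" where
  "split_dim A = point_measure UNIV (\<lambda>j. ennreal ((snd A $ j - fst A $ j) / box_length A))"

definition split_threshold :: "'d::finite box \<Rightarrow> 'd \<Rightarrow> real measure" where
  "split_threshold A j = uniform_measure lborel {fst A $ j..snd A $ j}"

text \<open>
  The recursive sampling procedure, as a program in the Giry monad. The first argument bounds the
  recursion depth: runs that would need more than \<open>n\<close> nested calls are discarded, so that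
  \<open>split_cell n\<close> is the sub-probability distribution of the trees of height less than \<open>n\<close>.
  On vectors, \<open>a < b\<close> means that \<open>a \<le> b\<close> holds in every component and \<open>a \<noteq> b\<close>. Its negation
  covers boxes consisting of a single point, whose exponential clock has rate \<open>0\<close> and never
  rings, and arguments that are not boxes, which are reached with probability \<open>0\<close> only.
\<close>

fun split_cell :: "nat \<Rightarrow> 'd::finite box \<Rightarrow> real \<Rightarrow> real \<Rightarrow> 'd split_tree measure" where
  "split_cell 0 A \<tau> \<Lambda> = null_measure split_tree_space"
| "split_cell (Suc n) A \<tau> \<Lambda> =
    (if fst A < snd A then do {
       E \<leftarrow> split_time A;
       if \<tau> + E \<le> \<Lambda> then do {
         j \<leftarrow> split_dim A;
         \<nu> \<leftarrow> split_threshold A j;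
         l \<leftarrow> split_cell n (lower_box j \<nu> A) (\<tau> + E) \<Lambda>;
         r \<leftarrow> split_cell n (upper_box j \<nu> A) (\<tau> + E) \<Lambda>;
         return split_tree_space (Node l (j, \<nu>) r)
       } else return split_tree_space Leaf
     } else return split_tree_space Leaf)"

text \<open>
  Since the recursion terminates almost surely, no mass is lost in the increasing limit.
\<close>

definition mondrian_process :: "real \<Rightarrow> 'd::finite box \<Rightarrow> 'd split_tree measure" where
  "mondrian_process \<Lambda> A = (SUP n. split_cell n A 0 \<Lambda>)"

fun leaf_cells :: "'d::finite split_tree \<Rightarrow> (real^'d) set \<Rightarrow> (real^'d) set set" where
  "leaf_cells Leaf A = {A}"
| "leaf_cells (Node l (j, \<nu>) r) A =
     leaf_cells l {x \<in> A. x $ j \<le> \<nu>} \<union> leaf_cells r {x \<in> A. x $ j > \<nu>}"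


section \<open>Mondrian forest regression\<close>

text \<open>
  A sample of size \<open>n\<close> is a sequence \<open>D\<close> of which only the pairs \<open>D i = (X\<^sub>i, Y\<^sub>i)\<close> with \<open>i < n\<close>
  are used; similarly, a forest of \<open>K\<close> trees uses only the trees \<open>M k\<close> with \<open>k < K\<close>.
\<close>

definition tree_estimate ::
  "nat \<Rightarrow> (nat \<Rightarrow> (real^'d::finite) \<times> real) \<Rightarrow> 'd split_tree \<Rightarrow> real^'d \<Rightarrow> real" where
  "tree_estimate n D t x =
     (let I = {i. i < n \<and> (\<exists>A\<in>leaf_cells t (cbox 0 1). x \<in> A \<and> fst (D i) \<in> A)}
      in if I = {} then 0 else (\<Sum>i\<in>I. snd (D i)) / card I)"

definition forest_estimate ::
  "nat \<Rightarrow> nat \<Rightarrow> (nat \<Rightarrow> (real^'d::finite) \<times> real) \<Rightarrow> (nat \<Rightarrow> 'd split_tree) \<Rightarrow> real^'d \<Rightarrow> real"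
  where
  "forest_estimate n K D M x = (\<Sum>k<K. tree_estimate n D (M k) x) / K"

text \<open>
  \<open>Z, D 0, \<dots>, D (n - 1)\<close> are i.i.d., \<open>M 0, \<dots>, M (K - 1)\<close> are i.i.d. Mondrian partitions
  of the unit cube with lifetime \<open>\<Lambda>\<close>, and the two families are independent of each other.
\<close>

definition mondrian_forest_sample ::
  "'w measure \<Rightarrow> ('w \<Rightarrow> (real^'d::finite) \<times> real) \<Rightarrow> nat \<Rightarrow> nat \<Rightarrow> real \<Rightarrow>
     (nat \<Rightarrow> 'w \<Rightarrow> (real^'d) \<times> real) \<Rightarrow> (nat \<Rightarrow> 'w \<Rightarrow> 'd split_tree) \<Rightarrow> bool" where
  "mondrian_forest_sample \<Omega> Z n K \<Lambda> D M \<longleftrightarrow>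
     prob_space.indep_vars \<Omega> (\<lambda>_. borel \<Otimes>\<^sub>M borel) (case_nat Z D) {..n} \<and>
     (\<forall>i<n. distr \<Omega> (borel \<Otimes>\<^sub>M borel) (D i) = distr \<Omega> (borel \<Otimes>\<^sub>M borel) Z) \<and>
     prob_space.indep_vars \<Omega> (\<lambda>_. split_tree_space) M {..<K} \<and>
     (\<forall>k<K. distr \<Omega> split_tree_space (M k) = mondrian_process \<Lambda> (0, 1)) \<and>
     prob_space.indep_set \<Omega>
       (sets (vimage_algebra (space \<Omega>) (\<lambda>\<omega>. \<lambda>i\<in>{..n}. case_nat Z D i \<omega>)
          (\<Pi>\<^sub>M i\<in>{..n}. borel \<Otimes>\<^sub>M borel)))
       (sets (vimage_algebra (space \<Omega>) (\<lambda>\<omega>. \<lambda>k\<in>{..<K}. M k \<omega>)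
          (\<Pi>\<^sub>M k\<in>{..<K}. split_tree_space)))"

definition squared_error ::
  "nat \<Rightarrow> nat \<Rightarrow> (nat \<Rightarrow> 'w \<Rightarrow> (real^'d::finite) \<times> real) \<Rightarrow> (nat \<Rightarrow> 'w \<Rightarrow> 'd split_tree) \<Rightarrow>
     ('w \<Rightarrow> real^'d) \<Rightarrow> (real^'d \<Rightarrow> real) \<Rightarrow> 'w \<Rightarrow> real" where
  "squared_error n K D M X f \<omega> =
     (forest_estimate n K (\<lambda>i. D i \<omega>) (\<lambda>k. M k \<omega>) (X \<omega>) - f (X \<omega>))\<^sup>2"

definition quadratic_risk ::
  "'w measure \<Rightarrow> nat \<Rightarrow> nat \<Rightarrow> (nat \<Rightarrow> 'w \<Rightarrow> (real^'d::finite) \<times> real) \<Rightarrow>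
     (nat \<Rightarrow> 'w \<Rightarrow> 'd split_tree) \<Rightarrow> ('w \<Rightarrow> real^'d) \<Rightarrow> (real^'d \<Rightarrow> real) \<Rightarrow> real" where
  "quadratic_risk \<Omega> n K D M X f = (\<integral>\<omega>. squared_error n K D M X f \<omega> \<partial>\<Omega>)"

text \<open>Taken in \<^typ>\<open>ennreal\<close>, so that a finite bound on it entails finite variance.\<close>

definition cond_variance :: "'w measure \<Rightarrow> 'w measure \<Rightarrow> ('w \<Rightarrow> real) \<Rightarrow> 'w \<Rightarrow> ennreal" where
  "cond_variance \<Omega> F Z =
     nn_cond_exp \<Omega> F (\<lambda>\<omega>. ennreal ((Z \<omega> - real_cond_exp \<Omega> F Z \<omega>)\<^sup>2))"

definition generated_algebra :: "'w measure \<Rightarrow> ('w \<Rightarrow> 'a::topological_space) \<Rightarrow> 'w measure" where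
  "generated_algebra \<Omega> X = vimage_algebra (space \<Omega>) X borel"


section \<open>The Mondrian process is a probability measure\<close>

lemma box_length_pos: "fst A < snd A \<Longrightarrow> 0 < box_length (A :: 'd::finite box)"
proof -
  assume *: "fst A < snd A"
  then have le: "\<And>j. fst A $ j \<le> snd A $ j" by (auto simp: less_vec_def less_eq_vec_def)
  from * obtain j where "\<not> snd A $ j \<le> fst A $ j" by (auto simp: less_vec_def less_eq_vec_def)
  then have "snd A $ j - fst A $ j > 0" by simp
  then show ?thesis unfolding box_length_def
    by (intro sum_pos2[of _ j]) (auto simp: le)
qed

lemma box_side_le: "fst A < snd A \<Longrightarrow> fst A $ j \<le> snd (A :: 'd::finite box) $ j"
  by (auto simp: less_vec_def less_eq_vec_def)

lemma borel_measurable_vec_component[measurable (raw)]: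
  "f \<in> borel_measurable M \<Longrightarrow> (\<lambda>x. f x $ j) \<in> borel_measurable (M :: 'a measure)"
  for f :: "'a \<Rightarrow> real^'d::finite"
  by (intro borel_measurable_continuous_on[of "\<lambda>x. x $ j"] continuous_intros) auto

lemma borel_measurable_vec_lambda[measurable (raw)]:
  fixes f :: "'a \<Rightarrow> 'd::finite \<Rightarrow> real"
  assumes "\<And>i. (\<lambda>x. f x i) \<in> borel_measurable M"
  shows "(\<lambda>x. \<chi> i. f x i) \<in> borel_measurable (M :: 'a measure)"
proof (subst borel_measurable_euclidean_space, safe)
  fix b :: "real^'d" assume "b \<in> Basis"
  then obtain i where "b = axis i 1" by (auto simp: Basis_vec_def)
  then show "(\<lambda>x. (\<chi> i. f x i) \<bullet> b) \<in> borel_measurable M"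
    using assms[of i] by (simp add: inner_axis)
qed

lemma pred_less_vec[measurable (raw)]:
  assumes [measurable]: "f \<in> borel_measurable M" "g \<in> borel_measurable M"
  shows "Measurable.pred M (\<lambda>x. f x < (g x :: real^'d::finite))"
  unfolding less_vec_def less_eq_vec_def by measurable

lemma box_length_measurable[measurable]: "box_length \<in> borel_measurable (borel \<Otimes>\<^sub>M borel)"
  unfolding box_length_def[abs_def] by measurable

abbreviation box_space :: "'d::finite box measure" where
  "box_space \<equiv> borel \<Otimes>\<^sub>M borel"

abbreviation proper_box_space :: "'d::finite box measure" where
  "proper_box_space \<equiv> restrict_space box_space {A. fst A < snd A}"

lemma split_time_measurable:
  "split_time \<in> (proper_box_space :: 'd::finite box measure) \<rightarrow>\<^sub>M subprob_algebra borel"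
proof (rule measurable_subprob_algebra)
  fix A :: "'d box" assume "A \<in> space proper_box_space"
  then have "0 < box_length A" by (auto simp: space_restrict_space box_length_pos)
  then show "subprob_space (split_time A)" unfolding split_time_def
    by (intro prob_space_imp_subprob_space prob_space_exponential_density)
  show "sets (split_time A) = sets borel" by (simp add: split_time_def)
next
  fix S :: "real set" assume [measurable]: "S \<in> sets borel"
  have "(\<lambda>A. emeasure (split_time A) S) = (\<lambda>A. \<integral>\<^sup>+x. ennreal (exponential_density (box_length A) x) * indicator S x \<partial>lborel)"
    by (simp add: split_time_def emeasure_density)
  also have "\<dots> \<in> borel_measurable box_space"
    unfolding exponential_density_def by measurable
  finally show "(\<lambda>A. emeasure (split_time (A :: 'd box)) S) \<in> borel_measurable proper_box_space"
    by (rule measurable_restrict_space1)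
qed

lemma split_dim_measurable:
  "split_dim \<in> (proper_box_space :: 'd::finite box measure) \<rightarrow>\<^sub>M subprob_algebra (count_space UNIV)"
proof (rule measurable_subprob_algebra)
  fix A :: "'d box" assume "A \<in> space proper_box_space"
  then have *: "fst A < snd A" by (auto simp: space_restrict_space)
  have "(\<Sum>j\<in>UNIV. (snd A $ j - fst A $ j) / box_length A) = 1"
    using box_length_pos[OF *] by (simp flip: sum_divide_distrib add: box_length_def)
  then show "subprob_space (split_dim A)" unfolding split_dim_def
    using box_length_pos[OF *] box_side_le[OF *]
    by (intro subprob_spaceI) (auto simp: emeasure_point_measure_finite space_point_measure sum_ennreal)
  show "sets (split_dim A) = sets (count_space UNIV)" by (simp add: split_dim_def sets_point_measure)
next
  fix S :: "'d set"
  have "(\<lambda>A. emeasure (split_dim A) S) = (\<lambda>A. \<Sum>j\<in>S. ennreal ((snd A $ j - fst A $ j) / box_length A))"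
    by (simp add: split_dim_def emeasure_point_measure_finite)
  also have "\<dots> \<in> borel_measurable box_space" by measurable
  finally show "(\<lambda>A. emeasure (split_dim (A :: 'd box)) S) \<in> borel_measurable proper_box_space"
    by (rule measurable_restrict_space1)
qed

lemma split_threshold_measurable:
  "(\<lambda>(A, j). split_threshold A j) \<in> (box_space :: 'd::finite box measure) \<Otimes>\<^sub>M count_space UNIV \<rightarrow>\<^sub>M subprob_algebra borel"
proof (rule measurable_subprob_algebra)
  fix p :: "'d box \<times> 'd" assume "p \<in> space (box_space \<Otimes>\<^sub>M count_space UNIV)"
  obtain A j where p: "p = (A, j)" by (cases p)
  show "subprob_space (case p of (A, j) \<Rightarrow> split_threshold A j)"
  proof (cases "fst A $ j < snd A $ j")
    case True
    then show ?thesis unfolding split_threshold_def p prod.case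
      by (intro prob_space_imp_subprob_space prob_space_uniform_measure) auto
  next
    case False
    then have "{fst A $ j..snd A $ j} \<subseteq> {fst A $ j}" by auto
    then have n: "{fst A $ j..snd A $ j} \<in> null_sets lborel"
      by (metis atLeastAtMost_borel finite.emptyI finite.insertI finite_subset finite_imp_null_set_lborel)
    have "AE x in lborel. indicator {fst A $ j..snd A $ j} x / emeasure lborel {fst A $ j..snd A $ j} = 0"
      using AE_not_in[OF n] by eventually_elim (auto split: split_indicator)
    then have "emeasure (split_threshold A j) UNIV = 0"
      unfolding split_threshold_def uniform_measure_def
      by (subst emeasure_density) (auto simp: nn_integral_0_iff_AE)
    then show ?thesis unfolding p by (intro subprob_spaceI) (auto simp: split_threshold_def)
  qed
  show "sets (case p of (A, j) \<Rightarrow> split_threshold A j) = sets borel" by (simp add: split_threshold_def p)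
next
  fix S :: "real set" assume [measurable]: "S \<in> sets borel"
  have "(\<lambda>p. emeasure (case p of (A, j) \<Rightarrow> split_threshold (A::'d box) j) S) =
    (\<lambda>(A, j). \<integral>\<^sup>+x. (indicator {fst A $ j..snd A $ j} x / (\<integral>\<^sup>+x. indicator {fst A $ j..snd A $ j} x \<partial>lborel)) * indicator S x \<partial>lborel)"
    by (simp add: split_threshold_def uniform_measure_def emeasure_density fun_eq_iff)
  also have "\<dots> \<in> borel_measurable (box_space \<Otimes>\<^sub>M count_space UNIV)"
    unfolding indicator_def atLeastAtMost_iff
    by measurable
  finally show "(\<lambda>p. emeasure (case p of (A, j) \<Rightarrow> split_threshold (A::'d box) j) S) \<in> borel_measurable (box_space \<Otimes>\<^sub>M count_space UNIV)" .
qed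

lemma lower_box_measurable[measurable (raw)]:
  assumes [measurable]: "j \<in> M \<rightarrow>\<^sub>M count_space UNIV" "\<nu> \<in> borel_measurable M" "A \<in> M \<rightarrow>\<^sub>M box_space"
  shows "(\<lambda>x. lower_box (j x) (\<nu> x) (A x) :: 'd::finite box) \<in> M \<rightarrow>\<^sub>M box_space"
  unfolding lower_box_def by measurable

lemma upper_box_measurable[measurable (raw)]:
  assumes [measurable]: "j \<in> M \<rightarrow>\<^sub>M count_space UNIV" "\<nu> \<in> borel_measurable M" "A \<in> M \<rightarrow>\<^sub>M box_space"
  shows "(\<lambda>x. upper_box (j x) (\<nu> x) (A x) :: 'd::finite box) \<in> M \<rightarrow>\<^sub>M box_space"
  unfolding upper_box_def by measurable


definition split_cell_step :: "nat \<Rightarrow> real \<Rightarrow> 'd::finite box \<times> real \<Rightarrow> 'd split_tree measure" where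
  "split_cell_step n \<Lambda> = (\<lambda>(A::'d::finite box, \<tau>). do {
       E \<leftarrow> split_time A;
       if \<tau> + E \<le> \<Lambda> then do {
         j \<leftarrow> split_dim A;
         \<nu> \<leftarrow> split_threshold A j;
         l \<leftarrow> split_cell n (lower_box j \<nu> A) (\<tau> + E) \<Lambda>;
         r \<leftarrow> split_cell n (upper_box j \<nu> A) (\<tau> + E) \<Lambda>;
         return split_tree_space (Node l (j, \<nu>) r)
       } else return split_tree_space Leaf
     })"

abbreviation timed_box_space :: "('d::finite box \<times> real) measure" where
  "timed_box_space \<equiv> restrict_space (box_space \<Otimes>\<^sub>M borel) {p. fst (fst p) < snd (fst p)}"

lemma split_cell_kernel:
  "(\<lambda>(A, \<tau>). split_cell n A \<tau> \<Lambda>) \<in> (box_space :: 'd::finite box measure) \<Otimes>\<^sub>M borel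
     \<rightarrow>\<^sub>M subprob_algebra split_tree_space"
proof (induction n)
  case 0
  show ?case
    by (auto simp: space_subprob_algebra space_tree_sigma subprob_space_null_measure_iff
        intro!: measurable_const trees.intros)
next
  case (Suc n)
  note [measurable] = Suc.IH
  have IH: "(\<lambda>x. split_cell n (A x) (t x) \<Lambda>) \<in> M \<rightarrow>\<^sub>M subprob_algebra split_tree_space"
    if "A \<in> M \<rightarrow>\<^sub>M box_space" "t \<in> borel_measurable M" for M :: "'x measure" and A :: "'x \<Rightarrow> 'd box" and t
    using measurable_compose[OF _ Suc.IH, of "\<lambda>x. (A x, t x)" M] that by simp
  have rb[measurable]: "fst \<in> (timed_box_space :: ('d box \<times> real) measure) \<rightarrow>\<^sub>M proper_box_space"
    by (rule measurable_restrict_space3) (auto intro: measurable_restrict_space1)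
  have [measurable]: "fst \<in> (timed_box_space :: ('d box \<times> real) measure) \<rightarrow>\<^sub>M box_space" "snd \<in> borel_measurable (timed_box_space :: ('d box \<times> real) measure)"
    by (auto intro: measurable_restrict_space1)
  have [measurable]: "(\<lambda>x. split_time (f x)) \<in> M \<rightarrow>\<^sub>M subprob_algebra borel" if "f \<in> M \<rightarrow>\<^sub>M proper_box_space" for M :: "'x measure" and f :: "'x \<Rightarrow> 'd box"
    using measurable_compose[OF that split_time_measurable] .
  have [measurable]: "(\<lambda>x. split_dim (f x)) \<in> M \<rightarrow>\<^sub>M subprob_algebra (count_space UNIV)" if "f \<in> M \<rightarrow>\<^sub>M proper_box_space" for M :: "'x measure" and f :: "'x \<Rightarrow> 'd box"
    using measurable_compose[OF that split_dim_measurable] .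
  have thr: "(\<lambda>x. split_threshold (f x) (j x)) \<in> M \<rightarrow>\<^sub>M subprob_algebra borel" if "f \<in> M \<rightarrow>\<^sub>M box_space" "j \<in> M \<rightarrow>\<^sub>M count_space UNIV" for M :: "'x measure" and f :: "'x \<Rightarrow> 'd box" and j
    using measurable_compose[OF _ split_threshold_measurable, of "\<lambda>x. (f x, j x)" M] that by simp
  have B: "(\<lambda>x. split_cell_step n \<Lambda> (A x, t x)) \<in> M \<rightarrow>\<^sub>M subprob_algebra split_tree_space"
    if A: "A \<in> M \<rightarrow>\<^sub>M proper_box_space" and t[measurable]: "t \<in> borel_measurable M" for M :: "('d box \<times> real) measure" and A :: "_ \<Rightarrow> 'd box" and t
  proof -
    have [measurable]: "A \<in> M \<rightarrow>\<^sub>M box_space" using A by (auto simp: measurable_restrict_space2_iff)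
    show ?thesis
    unfolding case_prod_beta split_cell_step_def fst_conv snd_conv
    apply (rule measurable_bind[where N=borel])
     apply (rule measurable_compose[OF A split_time_measurable])
    apply (rule measurable_If)
      apply (rule measurable_bind[where N="count_space UNIV"])
       apply (rule measurable_compose[OF measurable_compose[OF measurable_fst A] split_dim_measurable])
      apply (rule measurable_bind[where N=borel])
       apply (rule thr; measurable)
      apply (rule measurable_bind[where N=split_tree_space])
       apply (rule IH; measurable)
      apply (rule measurable_bind[where N=split_tree_space])
       apply (rule IH; measurable)
      apply (rule measurable_compose[OF _ return_measurable])
      apply measurable
      apply (auto simp: space_subprob_algebra intro!: subprob_space_return)
     done
  qed
  have C: "(\<lambda>x. split_cell_step n \<Lambda> x) \<in> (timed_box_space :: ('d box \<times> real) measure) \<rightarrow>\<^sub>M subprob_algebra split_tree_space"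
    using B[of fst timed_box_space snd] rb by simp
  have D: "(\<lambda>(A, \<tau>). split_cell (Suc n) A \<tau> \<Lambda>) = (\<lambda>p :: 'd box \<times> real. if fst (fst p) < snd (fst p) then split_cell_step n \<Lambda> p else return split_tree_space Leaf)"
    by (simp add: fun_eq_iff split_cell_step_def case_prod_beta cong: if_cong)
  show ?case
    unfolding D
    apply (subst measurable_If_restrict_space_iff)
    apply measurable
    using C
    apply (auto simp: space_subprob_algebra intro!: subprob_space_return)
    done
qed

lemma split_cell_measurable:
  assumes "A \<in> M \<rightarrow>\<^sub>M (box_space :: 'd::finite box measure)" "t \<in> borel_measurable M"
  shows "(\<lambda>x. split_cell n (A x) (t x) \<Lambda>) \<in> M \<rightarrow>\<^sub>M subprob_algebra split_tree_space"
    using measurable_compose[OF _ split_cell_kernel, of "\<lambda>x. (A x, t x)" M] assms by simp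

lemma split_cell_subprob: "subprob_space (split_cell n A \<tau> \<Lambda>)"
  and sets_split_cell[simp]: "sets (split_cell n A \<tau> \<Lambda>) = sets split_tree_space"
  for A :: "'d::finite box"
  using measurable_space[OF split_cell_measurable[of "\<lambda>_. A" "count_space UNIV" "\<lambda>_. \<tau>" n \<Lambda>], of undefined]
  by (auto simp: space_subprob_algebra space_pair_measure)

lemma space_split_cell[simp]: "space (split_cell n A \<tau> \<Lambda>) = UNIV"
  by (subst sets_eq_imp_space_eq[OF sets_split_cell]) (simp add: space_tree_sigma space_pair_measure)

lemma emeasure_split_cell_Suc:
  fixes A :: "'d::finite box"
  assumes A: "fst A < snd A" and [measurable]: "X \<in> sets split_tree_space"
  shows "emeasure (split_cell (Suc n) A \<tau> \<Lambda>) X =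
   (\<integral>\<^sup>+E. (if \<tau> + E \<le> \<Lambda> then \<integral>\<^sup>+j. \<integral>\<^sup>+\<nu>. \<integral>\<^sup>+l. \<integral>\<^sup>+r. indicator X (Node l (j, \<nu>) r)
        \<partial>split_cell n (upper_box j \<nu> A) (\<tau> + E) \<Lambda> \<partial>split_cell n (lower_box j \<nu> A) (\<tau> + E) \<Lambda>
        \<partial>split_threshold A j \<partial>split_dim A else indicator X Leaf) \<partial>split_time A)" (is ?th1)
  and "(\<lambda>E. (if \<tau> + E \<le> \<Lambda> then \<integral>\<^sup>+j. \<integral>\<^sup>+\<nu>. \<integral>\<^sup>+l. \<integral>\<^sup>+r. indicator X (Node l (j, \<nu>) r)
        \<partial>split_cell n (upper_box j \<nu> A) (\<tau> + E) \<Lambda> \<partial>split_cell n (lower_box j \<nu> A) (\<tau> + E) \<Lambda>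
        \<partial>split_threshold A j \<partial>split_dim A else indicator X Leaf)) \<in> borel_measurable (split_time A)" (is "?H \<in> _")
proof -
  let ?T = "split_tree_space :: 'd split_tree measure"
  have AR: "A \<in> space proper_box_space" using A by (auto simp: space_restrict_space space_pair_measure)
  have st[measurable_cong]: "sets (split_time A) = sets borel" "sets (split_dim A) = sets (count_space UNIV)" "\<And>j. sets (split_threshold A j) = sets borel"
    by (auto simp: split_time_def split_dim_def split_threshold_def sets_point_measure)
  have sp: "space (split_time A) = UNIV" "space (split_dim A) = UNIV" "\<And>j. space (split_threshold A j) = UNIV"
    by (auto simp: split_time_def split_dim_def split_threshold_def space_point_measure)
  have thr: "(\<lambda>x. split_threshold A (j x)) \<in> M \<rightarrow>\<^sub>M subprob_algebra borel" if "j \<in> M \<rightarrow>\<^sub>M count_space UNIV" for M :: "'x measure" and j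
  proof -
    have "(\<lambda>x. (A, j x)) \<in> M \<rightarrow>\<^sub>M box_space \<Otimes>\<^sub>M count_space UNIV"
      using that by (intro measurable_Pair measurable_const) (auto simp: space_pair_measure)
    from measurable_compose[OF this split_threshold_measurable] show ?thesis by simp
  qed
  have dim: "(\<lambda>x. split_dim A) \<in> M \<rightarrow>\<^sub>M subprob_algebra (count_space UNIV)" for M :: "'x measure"
    using measurable_space[OF split_dim_measurable AR] by simp
  have k5: "(\<lambda>r. return ?T (Node l (j, \<nu>) r)) \<in> M \<rightarrow>\<^sub>M subprob_algebra ?T"
      if [measurable_cong]: "sets M = sets ?T" for M l j \<nu>
    by (rule measurable_compose[OF _ return_measurable]) (use that in \<open>auto intro!: measurable_Node' simp: space_pair_measure space_tree_sigma cong: measurable_cong_sets\<close>)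
  have k4: "(\<lambda>l. split_cell n B t \<Lambda> \<bind> (\<lambda>r. return ?T (Node l (j, \<nu>) r))) \<in> M \<rightarrow>\<^sub>M subprob_algebra ?T"
      if [measurable_cong]: "sets M = sets ?T" for M B t j \<nu>
    apply (rule measurable_bind[where N="?T"])
     apply (rule split_cell_measurable; measurable?; simp add: space_pair_measure)
    apply (rule measurable_compose[OF _ return_measurable])
    apply (rule measurable_Node')
    apply measurable
    apply (simp_all add: space_pair_measure)?
    done
  have k3: "(\<lambda>\<nu>. split_cell n (lower_box j \<nu> A) t \<Lambda> \<bind> (\<lambda>l. split_cell n (upper_box j \<nu> A) t \<Lambda> \<bind> (\<lambda>r. return ?T (Node l (j, \<nu>) r)))) \<in> split_threshold A j \<rightarrow>\<^sub>M subprob_algebra ?T"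
     for t j
    apply (rule measurable_bind[where N="?T"])
     apply (rule split_cell_measurable; measurable?; simp add: space_pair_measure)
    apply (rule measurable_bind[where N="?T"])
     apply (rule split_cell_measurable; measurable?; simp add: space_pair_measure)
    apply (rule measurable_compose[OF _ return_measurable])
    apply (rule measurable_Node')
    apply measurable
    apply (simp_all add: space_pair_measure)?
    done
  have k2: "(\<lambda>j. split_threshold A j \<bind> (\<lambda>\<nu>. split_cell n (lower_box j \<nu> A) t \<Lambda> \<bind> (\<lambda>l. split_cell n (upper_box j \<nu> A) t \<Lambda> \<bind> (\<lambda>r. return ?T (Node l (j, \<nu>) r))))) \<in> split_dim A \<rightarrow>\<^sub>M subprob_algebra ?T"
     for t
    apply (rule measurable_bind[where N="borel"])
     apply (rule thr; measurable)
    apply (rule measurable_bind[where N="?T"])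
     apply (rule split_cell_measurable; measurable?; simp add: space_pair_measure)
    apply (rule measurable_bind[where N="?T"])
     apply (rule split_cell_measurable; measurable?; simp add: space_pair_measure)
    apply (rule measurable_compose[OF _ return_measurable])
    apply (rule measurable_Node')
    apply measurable
    apply (simp_all add: space_pair_measure)?
    done
  have k1: "(\<lambda>E. if \<tau> + E \<le> \<Lambda> then split_dim A \<bind> (\<lambda>j. split_threshold A j \<bind> (\<lambda>\<nu>. split_cell n (lower_box j \<nu> A) (\<tau> + E) \<Lambda> \<bind> (\<lambda>l. split_cell n (upper_box j \<nu> A) (\<tau> + E) \<Lambda> \<bind> (\<lambda>r. return ?T (Node l (j, \<nu>) r))))) else return ?T Leaf) \<in> split_time A \<rightarrow>\<^sub>M subprob_algebra ?T"
    apply (rule measurable_If)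
      apply (rule measurable_bind[where N="count_space UNIV"])
     apply (rule dim)
    apply (rule measurable_bind[where N="borel"])
     apply (rule thr; measurable)
    apply (rule measurable_bind[where N="?T"])
     apply (rule split_cell_measurable; measurable?; simp add: space_pair_measure)
    apply (rule measurable_bind[where N="?T"])
     apply (rule split_cell_measurable; measurable?; simp add: space_pair_measure)
    apply (rule measurable_compose[OF _ return_measurable])
    apply (rule measurable_Node')
    apply measurable
    apply (simp_all add: space_pair_measure)?
      apply (auto simp: space_subprob_algebra intro!: subprob_space_return)
    done
  have k6: "Node l (j, \<nu>) r \<in> space ?T" for l r j \<nu> by (simp add: space_tree_sigma space_pair_measure)
  have H: "?H E = emeasure (if \<tau> + E \<le> \<Lambda> then split_dim A \<bind> (\<lambda>j. split_threshold A j \<bind> (\<lambda>\<nu>. split_cell n (lower_box j \<nu> A) (\<tau> + E) \<Lambda> \<bind> (\<lambda>l. split_cell n (upper_box j \<nu> A) (\<tau> + E) \<Lambda> \<bind> (\<lambda>r. return ?T (Node l (j, \<nu>) r))))) else return ?T Leaf) X" for E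
    apply (rule sym)
    apply (auto simp: space_tree_sigma)
    apply (subst emeasure_bind[OF _ k2])
      apply (simp_all add: sp)
    apply (rule nn_integral_cong)
    apply (subst emeasure_bind[OF _ k3])
      apply (simp_all add: sp)
    apply (rule nn_integral_cong)
    apply (subst emeasure_bind[OF _ k4])
      apply (simp_all add: sp)
    apply (rule nn_integral_cong)
    apply (subst emeasure_bind[OF _ k5])
      apply (simp_all add: sp)
    done
  show "?H \<in> borel_measurable (split_time A)"
    unfolding H by (rule measurable_compose[OF k1 measurable_emeasure_subprob_algebra]) fact
  show ?th1 using A unfolding H
    apply (simp only: split_cell.simps if_True)
    apply (subst emeasure_bind[OF _ k1])
      apply (simp_all add: sp)
    done
qed

lemma split_cell_mono: "split_cell n A \<tau> \<Lambda> \<le> split_cell (Suc n) A \<tau> \<Lambda>" for A :: "'d::finite box"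
proof (induction n arbitrary: A \<tau>)
  case 0
  show ?case by (subst le_measure) (auto simp: sets_split_cell[of 0, simplified] simp del: split_cell.simps(2))
next
  case (Suc n)
  show ?case
  proof (cases "fst A < snd A")
    case False
    then show ?thesis by simp
  next
    case True
    show ?thesis
    proof (subst le_measure, simp only: sets_split_cell, safe)
      fix X assume "X \<in> sets (split_cell (Suc n) A \<tau> \<Lambda>)"
      then have X: "X \<in> sets (split_tree_space :: 'd split_tree measure)" by (simp only: sets_split_cell)
      show "emeasure (split_cell (Suc n) A \<tau> \<Lambda>) X \<le> emeasure (split_cell (Suc (Suc n)) A \<tau> \<Lambda>) X"
        unfolding emeasure_split_cell_Suc(1)[OF True X]
        apply (rule nn_integral_mono)
        subgoal for E
        apply (cases "\<tau> + E \<le> \<Lambda>")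
        apply (simp_all only: if_True if_False order_refl)
         apply (intro nn_integral_mono)
        apply (rule order_trans[OF nn_integral_mono_measure nn_integral_mono])
          apply (simp only: sets_split_cell)
         apply (rule Suc.IH)
        apply (rule nn_integral_mono_measure)
          apply (simp only: sets_split_cell)
         apply (rule Suc.IH)
        done
        done
    qed
  qed
qed

lemma split_cell_mass:
  fixes A :: "'d::finite box"
  assumes "fst A \<le> snd A" "box_length A \<le> D" "D > 0" "\<tau> \<le> \<Lambda>"
  shows "1 \<le> emeasure (split_cell n A \<tau> \<Lambda>) UNIV + ennreal ((1/2)^n * exp (4 * D * (\<Lambda> - \<tau>)))"
  using assms
proof (induction n arbitrary: A \<tau>)
  case 0
  then have "1 \<le> exp (4 * D * (\<Lambda> - \<tau>))" by simp
  then show ?case by simp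
next
  case (Suc n)
  show ?case
  proof (cases "fst A < snd A")
    case False
    then have "emeasure (split_cell (Suc n) A \<tau> \<Lambda>) UNIV = 1"
      by (simp, subst emeasure_return) (auto simp: space_tree_sigma space_pair_measure intro: sets.top[of split_tree_space, simplified space_tree_sigma, simplified])
    then show ?thesis by simp
  next
    case True
    define c where "c = box_length A"
    have c: "0 < c" "c \<le> D" using box_length_pos[OF True] Suc.prems by (auto simp: c_def)
    define g where "g E = (1/2)^n * exp (4 * D * (\<Lambda> - (\<tau> + E)))" for E :: real
    have g0: "g E \<ge> 0" for E by (simp add: g_def)
    have UN: "UNIV \<in> sets (split_tree_space :: 'd split_tree measure)"
      using sets.top[of "split_tree_space :: 'd split_tree measure"] by (simp add: space_tree_sigma space_pair_measure)
    define m where "m A t = emeasure (split_cell n A t \<Lambda>) UNIV" for A :: "'d box" and t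
    have m1: "m A t \<le> 1" for A t unfolding m_def by (rule subprob_space.subprob_emeasure_le_1[OF split_cell_subprob])
    define h where "h E = (if \<tau> + E \<le> \<Lambda> then \<integral>\<^sup>+j. \<integral>\<^sup>+\<nu>. m (lower_box j \<nu> A) (\<tau> + E) * m (upper_box j \<nu> A) (\<tau> + E) \<partial>split_threshold A j \<partial>split_dim A else 1)" for E
    have eq: "emeasure (split_cell (Suc n) A \<tau> \<Lambda>) UNIV = (\<integral>\<^sup>+E. h E \<partial>split_time A)"
      unfolding emeasure_split_cell_Suc(1)[OF True UN] h_def m_def by (simp add: mult.commute cong: if_cong)
    have mm[measurable]: "(\<lambda>x. m (A x) t) \<in> borel_measurable M" if "A \<in> M \<rightarrow>\<^sub>M box_space" for A t and M :: "real measure"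
      unfolding m_def using split_cell_measurable[OF that, of "\<lambda>_. t" n \<Lambda>]
      by (intro measurable_compose[OF _ measurable_emeasure_subprob_algebra[OF UN]]) auto
    have key: "1 \<le> h E + 2 * ennreal (g E)" if E: "E \<ge> 0" for E
    proof (cases "\<tau> + E \<le> \<Lambda>")
      case False then show ?thesis by (simp add: h_def)
    next
      case le: True
      define F where "F j = (\<integral>\<^sup>+\<nu>. m (lower_box j \<nu> A) (\<tau> + E) * m (upper_box j \<nu> A) (\<tau> + E) \<partial>split_threshold A j)" for j
      have F: "1 \<le> F j + 2 * ennreal (g E)" if j: "fst A $ j < snd A $ j" for j
      proof -
        interpret P: prob_space "split_threshold A j" unfolding split_threshold_def using j
          by (intro prob_space_uniform_measure) auto
        have pt: "1 \<le> m (lower_box j \<nu> A) (\<tau> + E) * m (upper_box j \<nu> A) (\<tau> + E) + 2 * ennreal (g E)"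
          if nu: "\<nu> \<in> {fst A $ j..snd A $ j}" for \<nu>
        proof -
          have l: "fst (lower_box j \<nu> A) \<le> snd (lower_box j \<nu> A)" "fst (upper_box j \<nu> A) \<le> snd (upper_box j \<nu> A)"
            using nu Suc.prems by (auto simp: lower_box_def upper_box_def less_eq_vec_def)
          have "box_length (lower_box j \<nu> A) \<le> D" "box_length (upper_box j \<nu> A) \<le> D"
            using nu c unfolding c_def box_length_def lower_box_def upper_box_def
            by (auto intro!: order_trans[OF sum_mono c(2)[unfolded c_def box_length_def]])
          then have 1: "1 \<le> m (lower_box j \<nu> A) (\<tau> + E) + ennreal (g E)" "1 \<le> m (upper_box j \<nu> A) (\<tau> + E) + ennreal (g E)"
            using Suc.IH[OF l(1) _ _ le] Suc.IH[OF l(2) _ _ le] Suc.prems(3) by (auto simp: m_def g_def)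
          obtain x where x: "m (lower_box j \<nu> A) (\<tau> + E) = ennreal x" "0 \<le> x" "x \<le> 1"
            using m1[of "lower_box j \<nu> A" "\<tau> + E"] by (cases "m (lower_box j \<nu> A) (\<tau> + E)") (auto simp: top_unique)
          obtain y where y: "m (upper_box j \<nu> A) (\<tau> + E) = ennreal y" "0 \<le> y" "y \<le> 1"
            using m1[of "upper_box j \<nu> A" "\<tau> + E"] by (cases "m (upper_box j \<nu> A) (\<tau> + E)") (auto simp: top_unique)
          have "1 \<le> x + g E" "1 \<le> y + g E" using 1 x y g0[of E] by (auto simp flip: ennreal_plus)
          moreover have "(1 - x) * (1 - y) \<ge> 0" using x y by simp
          ultimately have "1 \<le> x * y + 2 * g E" by (simp add: algebra_simps)
          then have "ennreal 1 \<le> ennreal (x * y + 2 * g E)" by (intro ennreal_leI)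
          also have "\<dots> = ennreal x * ennreal y + 2 * ennreal (g E)" using x y g0[of E] by (simp add: ennreal_mult)
          finally show ?thesis using x y by simp
        qed
        have "1 = (\<integral>\<^sup>+\<nu>. 1 \<partial>split_threshold A j)" by (simp add: P.emeasure_space_1)
        also have "\<dots> \<le> (\<integral>\<^sup>+\<nu>. m (lower_box j \<nu> A) (\<tau> + E) * m (upper_box j \<nu> A) (\<tau> + E) + 2 * ennreal (g E) \<partial>split_threshold A j)"
        proof (rule nn_integral_mono_AE)
          have "AE \<nu> in split_threshold A j. \<nu> \<in> {fst A $ j..snd A $ j}"
            unfolding split_threshold_def using j by (intro AE_uniform_measureI) auto
          then show "AE \<nu> in split_threshold A j. 1 \<le> m (lower_box j \<nu> A) (\<tau> + E) * m (upper_box j \<nu> A) (\<tau> + E) + 2 * ennreal (g E)"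
            by eventually_elim (rule pt)
        qed
        also have "\<dots> = F j + 2 * ennreal (g E)"
        proof (subst nn_integral_add)
          have [measurable_cong]: "sets (split_threshold A j) = sets borel" by (simp add: split_threshold_def)
          have [measurable]: "(\<lambda>_. A) \<in> split_threshold A j \<rightarrow>\<^sub>M box_space" by (simp add: space_pair_measure)
          show "(\<lambda>\<nu>. m (lower_box j \<nu> A) (\<tau> + E) * m (upper_box j \<nu> A) (\<tau> + E)) \<in> borel_measurable (split_threshold A j)"
            by (intro borel_measurable_times_ennreal mm lower_box_measurable upper_box_measurable) measurable
        qed (auto simp: F_def P.emeasure_space_1)
        finally show ?thesis .
      qed
      have pd: "prob_space (split_dim A)"
      proof
        have "(\<Sum>j\<in>UNIV. (snd A $ j - fst A $ j) / box_length A) = 1"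
          using box_length_pos[OF True] by (simp flip: sum_divide_distrib add: box_length_def)
        then show "emeasure (split_dim A) (space (split_dim A)) = 1" unfolding split_dim_def
          using box_length_pos[OF True] box_side_le[OF True]
          by (auto simp: emeasure_point_measure_finite space_point_measure sum_ennreal)
      qed
      have pd1: "space (split_dim A) = UNIV" "sets (split_dim A) = UNIV" by (auto simp: split_dim_def space_point_measure sets_point_measure)
      have pd2: "emeasure (split_dim A) UNIV = 1" using prob_space.emeasure_space_1[OF pd] by (simp add: pd1)
      have "1 = (\<integral>\<^sup>+j. 1 \<partial>split_dim A)" by (simp add: prob_space.emeasure_space_1[OF pd])
      also have "\<dots> \<le> (\<integral>\<^sup>+j. F j + 2 * ennreal (g E) \<partial>split_dim A)"
      proof (rule nn_integral_mono_AE)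
        show "AE j in split_dim A. 1 \<le> F j + 2 * ennreal (g E)"
          unfolding split_dim_def using F box_length_pos[OF True]
          by (subst AE_point_measure) (auto simp: zero_less_divide_iff)
      qed
      also have "\<dots> = h E + 2 * ennreal (g E)"
        by (subst nn_integral_add) (auto simp: h_def le F_def[abs_def] measurable_def sets_point_measure space_point_measure
           prob_space.emeasure_space_1[OF pd] pd1 pd2)
      finally show ?thesis .
    qed
    interpret T: prob_space "split_time A" unfolding split_time_def using c
      by (intro prob_space_exponential_density) (auto simp: c_def)
    have [measurable_cong]: "sets (split_time A) = sets borel" by (simp add: split_time_def)
    have gm[measurable]: "g \<in> borel_measurable borel" unfolding g_def by measurable
    have nz: "AE E in split_time A. E \<ge> 0"
      unfolding split_time_def by (subst AE_density) (auto simp: exponential_density_def)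
    have gi: "(\<integral>\<^sup>+E. 2 * ennreal (g E) \<partial>split_time A) \<le> ennreal ((1/2)^Suc n * exp (4 * D * (\<Lambda> - \<tau>)))"
    proof -
      define K where "K = (1/2)^n * exp (4 * D * (\<Lambda> - \<tau>))"
      define \<kappa> where "\<kappa> = c + 4 * D"
      have k: "\<kappa> > 0" using c by (simp add: \<kappa>_def)
      have "(\<integral>\<^sup>+E. 2 * ennreal (g E) \<partial>split_time A) = (\<integral>\<^sup>+E. ennreal (exponential_density c E) * (2 * ennreal (g E)) \<partial>lborel)"
        unfolding split_time_def c_def[symmetric] by (subst nn_integral_density) auto
      also have "\<dots> = (\<integral>\<^sup>+E. ennreal (2 * K * c / \<kappa>) * ennreal (exponential_density \<kappa> E) \<partial>lborel)"
      proof (rule nn_integral_cong)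
        fix E :: real
        have "exponential_density c E * (2 * g E) = (2 * K * c / \<kappa>) * exponential_density \<kappa> E"
        proof -
          have "g E = K * exp (- 4 * D * E)" by (simp add: g_def K_def algebra_simps flip: exp_add)
          moreover have "exp (- E * \<kappa>) = exp (- E * c) * exp (- 4 * D * E)" by (simp add: \<kappa>_def algebra_simps flip: exp_add)
          ultimately show ?thesis using k by (auto simp: exponential_density_def)
        qed
        moreover have "0 \<le> exponential_density c E" using c by (simp add: exponential_density_def)
        moreover have "0 \<le> exponential_density \<kappa> E" using k by (simp add: exponential_density_def)
        moreover have "0 \<le> 2 * K * c / \<kappa>" using k c by (simp add: K_def)
        ultimately show "ennreal (exponential_density c E) * (2 * ennreal (g E)) = ennreal (2 * K * c / \<kappa>) * ennreal (exponential_density \<kappa> E)"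
          using g0[of E] by (metis ennreal_mult ennreal_numeral mult_nonneg_nonneg zero_le_numeral)
      qed
      also have "\<dots> = ennreal (2 * K * c / \<kappa>)"
      proof -
        interpret Q: prob_space "density lborel (exponential_density \<kappa>)" by (rule prob_space_exponential_density[OF k])
        have "(\<integral>\<^sup>+E. ennreal (exponential_density \<kappa> E) \<partial>lborel) = 1"
          using Q.emeasure_space_1 by (simp add: emeasure_density)
        then show ?thesis by (subst nn_integral_cmult) auto
      qed
      also have "\<dots> \<le> ennreal ((1/2)^Suc n * exp (4 * D * (\<Lambda> - \<tau>)))"
      proof (rule ennreal_leI)
        have "c / \<kappa> \<le> 1/4" using c k by (simp add: field_simps \<kappa>_def)
        then have "2 * K * (c / \<kappa>) \<le> 2 * K * (1/4)" by (intro mult_left_mono) (auto simp: K_def)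
        then show "2 * K * c / \<kappa> \<le> (1/2)^Suc n * exp (4 * D * (\<Lambda> - \<tau>))" by (simp add: K_def)
      qed
      finally show ?thesis .
    qed
    have "1 = (\<integral>\<^sup>+E. 1 \<partial>split_time A)" by (simp add: T.emeasure_space_1)
    also have "\<dots> \<le> (\<integral>\<^sup>+E. h E + 2 * ennreal (g E) \<partial>split_time A)"
      using nz by (intro nn_integral_mono_AE) (auto elim!: eventually_mono dest!: key)
    also have "\<dots> \<le> (\<integral>\<^sup>+E. h E \<partial>split_time A) + (\<integral>\<^sup>+E. 2 * ennreal (g E) \<partial>split_time A)"
    proof (subst nn_integral_add)
      show "h \<in> borel_measurable (split_time A)"
        using emeasure_split_cell_Suc(2)[OF True UN, of \<tau> \<Lambda> n] unfolding h_def m_def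
        by (simp add: mult.commute cong: if_cong)
    qed auto
    also have "\<dots> \<le> emeasure (split_cell (Suc n) A \<tau> \<Lambda>) UNIV + ennreal ((1/2)^Suc n * exp (4 * D * (\<Lambda> - \<tau>)))"
      unfolding eq by (intro add_left_mono gi)
    finally show ?thesis .
  qed
qed

lemma mondrian_process_well_defined:
  fixes A :: "'d::finite box"
  assumes A: "fst A \<le> snd A" and L: "0 \<le> \<Lambda>"
  shows "sets (mondrian_process \<Lambda> A) = sets split_tree_space"
    and "X \<in> sets split_tree_space \<Longrightarrow> emeasure (mondrian_process \<Lambda> A) X = (SUP n. emeasure (split_cell n A 0 \<Lambda>) X)"
    and "prob_space (mondrian_process \<Lambda> A)"
proof -
  have UN: "UNIV \<in> sets (split_tree_space :: 'd split_tree measure)"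
      using sets.top[of "split_tree_space :: 'd split_tree measure"] by (simp add: space_tree_sigma space_pair_measure)
  show s: "sets (mondrian_process \<Lambda> A) = sets split_tree_space"
    unfolding mondrian_process_def by (rule sets_SUP) auto
  have inc: "incseq (\<lambda>n. split_cell n A 0 \<Lambda>)" by (rule incseq_SucI) (rule split_cell_mono)
  show e: "emeasure (mondrian_process \<Lambda> A) X = (SUP n. emeasure (split_cell n A 0 \<Lambda>) X)"
    if "X \<in> sets split_tree_space" for X
    unfolding mondrian_process_def using that
    apply (intro emeasure_SUP_chain)
    apply (auto simp: Complete_Partial_Order.chain_def)
    by (metis incseqD[OF inc] nle_le)
  define D where "D = max 1 (box_length A)"
  have "1 \<le> emeasure (mondrian_process \<Lambda> A) UNIV + ennreal ((1/2)^n * exp (4 * D * \<Lambda>))" for n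
  proof -
    have "1 \<le> emeasure (split_cell n A 0 \<Lambda>) UNIV + ennreal ((1/2)^n * exp (4 * D * (\<Lambda> - 0)))"
      by (rule split_cell_mass) (use A L in \<open>auto simp: D_def\<close>)
    also have "\<dots> \<le> emeasure (mondrian_process \<Lambda> A) UNIV + ennreal ((1/2)^n * exp (4 * D * \<Lambda>))"
      by (intro add_mono) (auto simp: e[OF UN] intro!: SUP_upper)
    finally show ?thesis .
  qed
  moreover have "(\<lambda>n. emeasure (mondrian_process \<Lambda> A) UNIV + ennreal ((1/2)^n * exp (4 * D * \<Lambda>))) \<longlonglongrightarrow> emeasure (mondrian_process \<Lambda> A) UNIV + ennreal (0 * exp (4 * D * \<Lambda>))"
    by (intro tendsto_add tendsto_const tendsto_ennrealI tendsto_mult LIMSEQ_power_zero) auto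
  ultimately have "1 \<le> emeasure (mondrian_process \<Lambda> A) UNIV + ennreal (0 * exp (4 * D * \<Lambda>))"
    by (intro LIMSEQ_le_const) auto
  moreover have "emeasure (mondrian_process \<Lambda> A) UNIV \<le> 1"
    unfolding e[OF UN] by (intro SUP_least subprob_space.subprob_emeasure_le_1[OF split_cell_subprob])
  ultimately show "prob_space (mondrian_process \<Lambda> A)"
    using sets_eq_imp_space_eq[OF s] by (intro prob_spaceI) (simp add: space_tree_sigma space_pair_measure)
qed

end

(*
  Writing the error of a single tree as a bias term plus a weighted sum of the independent noises,
  its mean square is at most
    L^2 * (squared distance from X to the farthest sample point in its cell)
      + F^2 * P(N = 0) + sigma^2 * E[1/N; N > 0],
  where N counts the sample points in the cell of X. The last two terms are at most
  (F^2 + 2 sigma^2) E[1/(N + 1)], and since X, X_1, ..., X_n are exchangeable, E[1/(N + 1)] is the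
  mean number of occupied cells divided by n + 1. Everything about the partition thus reduces to
  two functionals of the Mondrian process that solve explicit evolution equations: the mean number
  of leaves of a box with side lengths l_j at time u is at most prod_j (1 + u l_j), and two points
  x, y share a cell with probability at most exp (- u |x - y|_1). Integrating the latter along the
  coordinate axes bounds the mean squared distances to the faces of the cell. Finally, Jensen's
  inequality passes from trees to the forest.
*)

theory Submission
  imports Defs
begin

text \<open>The query point and the sample points are kept as coordinates 0, ..., n of one product
  space. This makes them exchangeable and turns every weight into a bounded function of all the
  points at once. The quantity 1/(N + 1) is chosen because it serves both remaining terms: it equals
  1 for an empty cell, and 1/N <= 2/(N + 1) otherwise. The added 1 is the query point counted in its
  own cell, so the quantity is one summand of a symmetric sum. The Mondrian process is available
  only as a limit of depth-bounded sub-probabilities. Both functionals are therefore bounded by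
  induction on the depth, where a solution of the one-step equation acts as an upper barrier, and
  the bounds are then passed to the limit. The argument yields 4 d L^2/\<Lambda>^2 + (F^2 + 2
  \<sigma>^2)(1 + \<Lambda>)^d/(n + 1) with F the supremum norm of f; the factors e^d and 9 enter
  only when this is weakened to the required form.\<close>

section \<open>Cells of a split tree\<close>

text \<open>Cells as sets of points are awkward for measurability. Following two points down the
  tree gives a relation that is jointly measurable in the tree and the points and that factors over
  a split: it survives only in the half that contains both points.\<close>

fun same_cell :: "'d::finite split_tree \<Rightarrow> real^'d \<Rightarrow> real^'d \<Rightarrow> bool" where
  "same_cell Leaf x y \<longleftrightarrow> True"
| "same_cell (Node l (j, \<nu>) r) x y \<longleftrightarrow>
     (if x $ j \<le> \<nu> then y $ j \<le> \<nu> \<and> same_cell l x y else \<nu> < y $ j \<and> same_cell r x y)"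

lemma same_cell_refl [simp]: "same_cell t x x"
  by (induction t) (auto simp: split_paired_all)

lemma ex_leaf_cell_iff_same_cell:
  "(\<exists>B\<in>leaf_cells t C. x \<in> B \<and> y \<in> B) \<longleftrightarrow> x \<in> C \<and> y \<in> C \<and> same_cell t x y"
  by (induction t C rule: leaf_cells.induct) (auto simp: bex_Un)

text \<open>Cells are boxes, so a cell contains the whole rectangle spanned by two of its points. It
  is applied with z moving away from x along a single axis.\<close>

lemma same_cell_between:
  assumes "same_cell t x y" "\<And>i. min (x $ i) (y $ i) \<le> z $ i" "\<And>i. z $ i \<le> max (x $ i) (y $ i)"
  shows "same_cell t x z"
  using assms
proof (induction t x y rule: same_cell.induct)
  case (2 l j \<nu> r x y)
  have z: "min (x $ j) (y $ j) \<le> z $ j" "z $ j \<le> max (x $ j) (y $ j)"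
    using "2.prems"(2,3) by blast+
  show ?case
  proof (cases "x $ j \<le> \<nu>")
    case True
    then have "y $ j \<le> \<nu>" "same_cell l x y" using "2.prems"(1) by auto
    moreover have "same_cell l x z" by (rule "2.IH"(1)[OF True calculation(2) "2.prems"(2,3)])
    ultimately show ?thesis using z True by simp
  next
    case False
    then have "\<nu> < y $ j" "same_cell r x y" using "2.prems"(1) by auto
    moreover have "same_cell r x z" by (rule "2.IH"(2)[OF False calculation(2) "2.prems"(2,3)])
    ultimately show ?thesis using z False by simp
  qed
qed auto

text \<open>Grouped by cell, the summands of one occupied cell add up to exactly 1, and there are at
  most \<open>size1 t\<close> cells. The root split divides the index set, and no group crosses
  it.\<close>

lemma sum_inverse_card_same_cell_le:
  assumes "finite I"
  shows "(\<Sum>i\<in>I. 1 / real (card {k\<in>I. same_cell t (x i) (x k)})) \<le> real (size1 t)"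
  using assms
proof (induction t arbitrary: I)
  case Leaf
  then show ?case by (cases "I = {}") auto
next
  case (Node l v r)
  obtain j \<nu> where v: "v = (j, \<nu>)" by (cases v)
  define I1 where "I1 = {i\<in>I. x i $ j \<le> \<nu>}"
  define I2 where "I2 = {i\<in>I. \<not> x i $ j \<le> \<nu>}"
  have I: "I = I1 \<union> I2" "I1 \<inter> I2 = {}" "finite I1" "finite I2"
    using Node.prems by (auto simp: I1_def I2_def)
  have 1: "{k\<in>I. same_cell (Node l v r) (x i) (x k)} = {k\<in>I1. same_cell l (x i) (x k)}" if "i \<in> I1" for i
    using that by (auto simp: I1_def v)
  have 2: "{k\<in>I. same_cell (Node l v r) (x i) (x k)} = {k\<in>I2. same_cell r (x i) (x k)}" if "i \<in> I2" for i
    using that by (auto simp: I2_def v)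
  have "(\<Sum>i\<in>I. 1 / real (card {k\<in>I. same_cell (Node l v r) (x i) (x k)})) =
    (\<Sum>i\<in>I1. 1 / real (card {k\<in>I. same_cell (Node l v r) (x i) (x k)})) +
    (\<Sum>i\<in>I2. 1 / real (card {k\<in>I. same_cell (Node l v r) (x i) (x k)}))"
    by (subst (1) I(1)) (intro sum.union_disjoint I)
  also have "\<dots> = (\<Sum>i\<in>I1. 1 / real (card {k\<in>I1. same_cell l (x i) (x k)})) +
    (\<Sum>i\<in>I2. 1 / real (card {k\<in>I2. same_cell r (x i) (x k)}))"
    using 1 2 by simp
  also have "\<dots> \<le> real (size1 l) + real (size1 r)"
    by (intro add_mono Node.IH I)
  finally show ?case by simp
qed

section \<open>Measurability of functionals of the tree\<close>

lemma measurable_vec_nth_index: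
  fixes x :: "'b \<Rightarrow> real^'d::finite"
  assumes [measurable]: "x \<in> borel_measurable N" and j: "j \<in> N \<rightarrow>\<^sub>M count_space UNIV"
  shows "(\<lambda>p. x p $ j p) \<in> borel_measurable N"
  by (rule measurable_compose_countable'[OF _ j]) (auto intro: countable_finite)

lemma measurable_same_cell [measurable (raw)]:
  fixes x :: "'b \<Rightarrow> real^'d::finite"
  assumes t: "t \<in> N \<rightarrow>\<^sub>M split_tree_space" and x: "x \<in> borel_measurable N" and y: "y \<in> borel_measurable N"
  shows "Measurable.pred N (\<lambda>p. same_cell (t p) (x p) (y p))"
proof -
  \<comment> \<open>The recursor evaluates both subtrees, even one that neither point enters. In
    this form the value at a node is a measurable function of the two values below it.\<close>
  have eq: "same_cell s a b = rec_tree True (\<lambda>l v r al ar.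
      if a $ fst v \<le> snd v then b $ fst v \<le> snd v \<and> al else snd v < b $ fst v \<and> ar) s" for s :: "'d split_tree" and a b
    by (induction s a b rule: same_cell.induct) auto
  let ?M = "N \<Otimes>\<^sub>M (split_tree_space :: 'd split_tree measure) \<Otimes>\<^sub>M (count_space UNIV \<Otimes>\<^sub>M borel) \<Otimes>\<^sub>M (split_tree_space :: 'd split_tree measure)
     \<Otimes>\<^sub>M count_space (UNIV::bool set) \<Otimes>\<^sub>M count_space (UNIV::bool set)"
  have j: "(\<lambda>p. fst (fst (snd (snd p)))) \<in> ?M \<rightarrow>\<^sub>M count_space UNIV" by measurable
  have X: "(\<lambda>p. x (fst p) $ fst (fst (snd (snd p)))) \<in> borel_measurable ?M"
    by (rule measurable_vec_nth_index[OF _ j]) (use x in measurable)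
  have Y: "(\<lambda>p. y (fst p) $ fst (fst (snd (snd p)))) \<in> borel_measurable ?M"
    by (rule measurable_vec_nth_index[OF _ j]) (use y in measurable)
  note [measurable] = X Y
  have "Measurable.pred ?M (\<lambda>p. if x (fst p) $ fst (fst (snd (snd p))) \<le> snd (fst (snd (snd p)))
     then y (fst p) $ fst (fst (snd (snd p))) \<le> snd (fst (snd (snd p))) \<and> fst (snd (snd (snd (snd p))))
     else snd (fst (snd (snd p))) < y (fst p) $ fst (fst (snd (snd p))) \<and> snd (snd (snd (snd (snd p)))))"
    by measurable
  then show ?thesis unfolding eq
    by (intro measurable_rec_tree[OF t]) (simp_all add: case_prod_beta')
qed

lemma measurable_size1 [measurable]:
  fixes M :: "'a measure"
  shows "size1 \<in> tree_sigma M \<rightarrow>\<^sub>M count_space UNIV"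
proof -
  have eq: "(size1 :: 'a tree \<Rightarrow> nat) = (\<lambda>t. rec_tree 1 (\<lambda>l v r al ar. al + ar) t)"
  proof
    fix t :: "'a tree" show "size1 t = rec_tree 1 (\<lambda>l v r al ar. al + ar) t" by (induction t) auto
  qed
  show ?thesis unfolding eq
    by (intro measurable_rec_tree) measurable
qed

section \<open>Recursive estimates for the Mondrian process\<close>

text \<open>Conditioning on the first split. The leaf count is not an indicator, so
  \<open>emeasure_split_cell_Suc\<close> is extended to nonnegative functions. Most of the proof is
  kernel measurability, which every use of \<open>nn_integral_bind\<close> demands.\<close>

lemma nn_integral_split_cell_Suc:
  fixes A :: "'d::finite box"
  assumes A: "fst A < snd A" and [measurable]: "h \<in> borel_measurable split_tree_space"
  shows "(\<integral>\<^sup>+t. h t \<partial>split_cell (Suc n) A \<tau> \<Lambda>) =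
   (\<integral>\<^sup>+E. (if \<tau> + E \<le> \<Lambda> then \<integral>\<^sup>+j. \<integral>\<^sup>+\<nu>. \<integral>\<^sup>+l. \<integral>\<^sup>+r. h (Node l (j, \<nu>) r)
        \<partial>split_cell n (upper_box j \<nu> A) (\<tau> + E) \<Lambda> \<partial>split_cell n (lower_box j \<nu> A) (\<tau> + E) \<Lambda>
        \<partial>split_threshold A j \<partial>split_dim A else h Leaf) \<partial>split_time A)"
proof -
  let ?T = "split_tree_space :: 'd split_tree measure"
  have AR: "A \<in> space proper_box_space" using A by (auto simp: space_restrict_space space_pair_measure)
  have [measurable_cong]: "sets (split_time A) = sets borel" "sets (split_dim A) = sets (count_space UNIV)"
      "\<And>j. sets (split_threshold A j) = sets borel"
    by (auto simp: split_time_def split_dim_def split_threshold_def sets_point_measure)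
  have sp: "space (split_time A) = UNIV" "space (split_dim A) = UNIV" "\<And>j. space (split_threshold A j) = UNIV"
    by (auto simp: split_time_def split_dim_def split_threshold_def space_point_measure)
  have thr: "(\<lambda>x. split_threshold A (j x)) \<in> M \<rightarrow>\<^sub>M subprob_algebra borel"
    if "j \<in> M \<rightarrow>\<^sub>M count_space UNIV" for M :: "'x measure" and j
  proof -
    have "(\<lambda>x. (A, j x)) \<in> M \<rightarrow>\<^sub>M box_space \<Otimes>\<^sub>M count_space UNIV"
      using that by (intro measurable_Pair measurable_const) (auto simp: space_pair_measure)
    from measurable_compose[OF this split_threshold_measurable] show ?thesis by simp
  qed
  have dim: "(\<lambda>x. split_dim A) \<in> M \<rightarrow>\<^sub>M subprob_algebra (count_space UNIV)" for M :: "'x measure"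
    using measurable_space[OF split_dim_measurable AR] by simp
  \<comment> \<open>In this chain of kernels all varying parameters are functions of a common x, so
    that each kernel can be used under the bind of the next one.\<close>
  have ret: "(\<lambda>x. return ?T (Node (l x) (j x, \<nu> x) (r x))) \<in> M \<rightarrow>\<^sub>M subprob_algebra ?T"
    if [measurable]: "l \<in> M \<rightarrow>\<^sub>M ?T" "r \<in> M \<rightarrow>\<^sub>M ?T" "j \<in> M \<rightarrow>\<^sub>M count_space UNIV" "\<nu> \<in> borel_measurable M"
    for M :: "'x measure" and l r j \<nu>
    by (rule measurable_compose[OF _ return_measurable]) (rule measurable_Node'; measurable)
  have right: "(\<lambda>x. split_cell n (upper_box (j x) (\<nu> x) A) (t x) \<Lambda> \<bind> (\<lambda>r. return ?T (Node (l x) (j x, \<nu> x) r))) \<in> M \<rightarrow>\<^sub>M subprob_algebra ?T"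
    if [measurable]: "l \<in> M \<rightarrow>\<^sub>M ?T" "t \<in> borel_measurable M" "j \<in> M \<rightarrow>\<^sub>M count_space UNIV" "\<nu> \<in> borel_measurable M"
    for M :: "'x measure" and l t j \<nu>
  proof (rule measurable_bind[where N="?T"])
    have [measurable]: "(\<lambda>x. A) \<in> M \<rightarrow>\<^sub>M box_space" by (simp add: space_pair_measure)
    show "(\<lambda>x. split_cell n (upper_box (j x) (\<nu> x) A) (t x) \<Lambda>) \<in> M \<rightarrow>\<^sub>M subprob_algebra ?T"
      by (rule split_cell_measurable; measurable)
    show "(\<lambda>p. return ?T (Node (l (fst p)) (j (fst p), \<nu> (fst p)) (snd p))) \<in> M \<Otimes>\<^sub>M ?T \<rightarrow>\<^sub>M subprob_algebra ?T"
      by (rule ret; measurable)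
  qed
  have left: "(\<lambda>x. split_cell n (lower_box (j x) (\<nu> x) A) (t x) \<Lambda> \<bind> (\<lambda>l. split_cell n (upper_box (j x) (\<nu> x) A) (t x) \<Lambda> \<bind> (\<lambda>r. return ?T (Node l (j x, \<nu> x) r)))) \<in> M \<rightarrow>\<^sub>M subprob_algebra ?T"
    if [measurable]: "t \<in> borel_measurable M" "j \<in> M \<rightarrow>\<^sub>M count_space UNIV" "\<nu> \<in> borel_measurable M"
    for M :: "'x measure" and t j \<nu>
  proof (rule measurable_bind[where N="?T"])
    have [measurable]: "(\<lambda>x. A) \<in> M \<rightarrow>\<^sub>M box_space" by (simp add: space_pair_measure)
    show "(\<lambda>x. split_cell n (lower_box (j x) (\<nu> x) A) (t x) \<Lambda>) \<in> M \<rightarrow>\<^sub>M subprob_algebra ?T"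
      by (rule split_cell_measurable; measurable)
    show "(\<lambda>p. split_cell n (upper_box (j (fst p)) (\<nu> (fst p)) A) (t (fst p)) \<Lambda> \<bind> (\<lambda>r. return ?T (Node (snd p) (j (fst p), \<nu> (fst p)) r))) \<in> M \<Otimes>\<^sub>M ?T \<rightarrow>\<^sub>M subprob_algebra ?T"
      by (rule right; measurable)
  qed
  have threshold: "(\<lambda>x. split_threshold A (j x) \<bind> (\<lambda>\<nu>. split_cell n (lower_box (j x) \<nu> A) (t x) \<Lambda> \<bind> (\<lambda>l. split_cell n (upper_box (j x) \<nu> A) (t x) \<Lambda> \<bind> (\<lambda>r. return ?T (Node l (j x, \<nu>) r))))) \<in> M \<rightarrow>\<^sub>M subprob_algebra ?T"
    if [measurable]: "t \<in> borel_measurable M" "j \<in> M \<rightarrow>\<^sub>M count_space UNIV" for M :: "'x measure" and t j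
    by (rule measurable_bind[where N=borel], rule thr, fact, rule left; measurable)
  have time: "(\<lambda>E. if \<tau> + E \<le> \<Lambda> then split_dim A \<bind> (\<lambda>j. split_threshold A j \<bind> (\<lambda>\<nu>. split_cell n (lower_box j \<nu> A) (\<tau> + E) \<Lambda> \<bind> (\<lambda>l. split_cell n (upper_box j \<nu> A) (\<tau> + E) \<Lambda> \<bind> (\<lambda>r. return ?T (Node l (j, \<nu>) r))))) else return ?T Leaf) \<in> split_time A \<rightarrow>\<^sub>M subprob_algebra ?T"
  proof (rule measurable_If)
    show "(\<lambda>E. split_dim A \<bind> (\<lambda>j. split_threshold A j \<bind> (\<lambda>\<nu>. split_cell n (lower_box j \<nu> A) (\<tau> + E) \<Lambda> \<bind> (\<lambda>l. split_cell n (upper_box j \<nu> A) (\<tau> + E) \<Lambda> \<bind> (\<lambda>r. return ?T (Node l (j, \<nu>) r)))))) \<in> split_time A \<rightarrow>\<^sub>M subprob_algebra ?T"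
      by (rule measurable_bind[where N="count_space UNIV"], rule dim, rule threshold; measurable)
  qed (auto simp: space_subprob_algebra intro!: subprob_space_return)
  have l5: "(\<integral>\<^sup>+t. h t \<partial>return ?T (Node l (j, \<nu>) r)) = h (Node l (j, \<nu>) r)" for l r j \<nu>
    by (rule nn_integral_return) (auto simp: space_tree_sigma space_pair_measure)
  have l4: "(\<integral>\<^sup>+t. h t \<partial>(split_cell n B s \<Lambda> \<bind> (\<lambda>r. return ?T (Node l (j, \<nu>) r)))) =
      (\<integral>\<^sup>+r. h (Node l (j, \<nu>) r) \<partial>split_cell n B s \<Lambda>)" for B s l j \<nu>
    by (subst nn_integral_bind[OF assms(2)]) (auto simp: l5 space_tree_sigma space_pair_measure cong: measurable_cong_sets intro!: ret)
  show ?thesis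
    apply (simp only: split_cell.simps A if_True)
    apply (subst nn_integral_bind[OF assms(2) time])
    apply (rule nn_integral_cong)
    apply (simp split: if_split, intro conjI impI)
     apply (subst nn_integral_bind[OF assms(2)])
      apply (rule threshold; measurable)
     apply (rule nn_integral_cong)
     apply (subst nn_integral_bind[OF assms(2)])
      apply (rule left; measurable)
     apply (rule nn_integral_cong)
     apply (subst nn_integral_bind[OF assms(2)])
      apply (simp cong: measurable_cong_sets)
      apply (rule right; (measurable | simp add: space_pair_measure))
     apply (rule nn_integral_cong)
     apply (rule l4)
    apply (rule nn_integral_return; simp)
    done
qed

text \<open>The density of the clock times V(s - E) + V'(s - E)/c is the derivative of -exp(-cE) V(s
  - E). Its integral over [0, s] is V(s) - exp(-cs) V(0). A clock that does not ring in time
  contributes exp(-cs), which cancels the last term because V(0) = 1.\<close>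

lemma nn_integral_split_time:
  fixes V V' :: "real \<Rightarrow> real" and A :: "'d::finite box"
  defines "c \<equiv> box_length A"
  assumes c: "0 < c" and le: "\<tau> \<le> \<Lambda>"
    and V: "\<And>u. (V has_real_derivative V' u) (at u)" and V0: "V 0 = 1"
    and [measurable]: "V' \<in> borel_measurable borel"
    and nonneg: "\<And>u. 0 \<le> u \<Longrightarrow> 0 \<le> V u + V' u / c"
  shows "(\<integral>\<^sup>+E. (if \<tau> + E \<le> \<Lambda> then ennreal (V (\<Lambda> - (\<tau> + E)) + V' (\<Lambda> - (\<tau> + E)) / c) else 1) \<partial>split_time A)
    = ennreal (V (\<Lambda> - \<tau>))" (is "?I = _")
proof -
  define s where "s = \<Lambda> - \<tau>"
  have s: "0 \<le> s" using le by (simp add: s_def)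
  have [measurable]: "V \<in> borel_measurable borel"
    by (intro borel_measurable_continuous_onI continuous_at_imp_continuous_on ballI DERIV_isCont[OF V])
  let ?g = "\<lambda>E. c * exp (- E * c) * (V (s - E) + V' (s - E) / c)"
  let ?F = "\<lambda>E. - exp (- E * c) * V (s - E)"
  have F: "(?F has_real_derivative ?g E) (at E)" for E
    using c by (auto intro!: derivative_eq_intros DERIV_chain2[OF V] simp: field_simps)
  have 1: "(\<integral>\<^sup>+E. ennreal (?g E) * indicator {0..s} E \<partial>lborel) = ennreal (?F s - ?F 0)"
    by (rule nn_integral_FTC_Icc) (use F nonneg s c in \<open>auto\<close>)
  have "((\<lambda>E. - exp (- (E * c))) \<longlongrightarrow> - 0) at_top"
  proof (intro tendsto_minus filterlim_compose[OF exp_at_bot] filterlim_compose[OF filterlim_uminus_at_bot_at_top])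
    show "filterlim (\<lambda>E. E * c) at_top at_top"
      by (rule filterlim_at_top_mult_tendsto_pos[OF tendsto_const c filterlim_ident])
  qed
  then have 2: "(\<integral>\<^sup>+E. ennreal (c * exp (- E * c)) * indicator {s..} E \<partial>lborel) = ennreal (0 - (- exp (- s * c)))"
    using c by (intro nn_integral_FTC_atLeast) (auto intro!: derivative_eq_intros)
  have "?I = (\<integral>\<^sup>+E. ennreal (exponential_density c E) *
      (if E \<le> s then ennreal (V (s - E) + V' (s - E) / c) else 1) \<partial>lborel)"
    unfolding split_time_def c_def[symmetric]
    by (subst nn_integral_density) (auto intro!: nn_integral_cong arg_cong2[of _ _ _ _ "(*)"] simp: s_def algebra_simps)
  \<comment> \<open>Both indicators are 1 at E = s, so the equality holds only off that null
    set.\<close>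
  also have "\<dots> = (\<integral>\<^sup>+E. ennreal (?g E) * indicator {0..s} E + ennreal (c * exp (- E * c)) * indicator {s..} E \<partial>lborel)"
    using AE_lborel_singleton[of s]
  proof (intro nn_integral_cong_AE, eventually_elim)
    case (elim E)
    consider "E < 0" | "0 \<le> E" "E < s" | "s < E" using elim by linarith
    then show ?case
      using nonneg[of "s - E"] c s
      by cases (auto simp: exponential_density_def algebra_simps simp flip: ennreal_mult)
  qed
  also have "\<dots> = ennreal (?F s - ?F 0) + ennreal (exp (- s * c))"
    using 1 2 by (subst nn_integral_add) auto
  also have "\<dots> = ennreal (V s)"
  proof (subst ennreal_plus[symmetric])
    have "?F 0 \<le> ?F s"
    proof (rule DERIV_nonneg_imp_nondecreasing[OF s])
      fix E assume "0 \<le> E" "E \<le> s"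
      then have "0 \<le> ?g E" using nonneg[of "s - E"] c by simp
      then show "\<exists>y. (?F has_real_derivative y) (at E) \<and> 0 \<le> y" using F by blast
    qed
    then show "0 \<le> ?F s - ?F 0" by simp
  qed (auto simp: V0)
  finally show ?thesis by (simp add: s_def)
qed

lemma nn_integral_split_dim:
  "(\<integral>\<^sup>+j. g j \<partial>split_dim A) = (\<Sum>j\<in>UNIV. ennreal ((snd A $ j - fst A $ j) / box_length A) * g j)"
  unfolding split_dim_def by (rule nn_integral_point_measure_finite) simp

lemma AE_split_threshold: "AE \<nu> in split_threshold A j. fst A $ j \<le> \<nu> \<and> \<nu> \<le> snd A $ j"
  unfolding split_threshold_def by (rule AE_uniform_measureI) auto

text \<open>
  The hypotheses on \<open>V\<close> are the backward equation of the process: \<open>V u\<close> is the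
  expected value of a functional when time \<open>u\<close> remains, \<open>q j u\<close> its value just
  after a split in dimension \<open>j\<close>.
\<close>

lemma nn_integral_split_le:
  fixes V V' :: "real \<Rightarrow> real" and A :: "'d::finite box"
  defines "c \<equiv> box_length A"
  assumes A: "fst A < snd A" and le: "\<tau> \<le> \<Lambda>"
    and V: "\<And>u. (V has_real_derivative V' u) (at u)" and V0: "V 0 = 1"
    and [measurable]: "V' \<in> borel_measurable borel"
    and q0: "\<And>j u. 0 \<le> u \<Longrightarrow> 0 \<le> q j u"
    and q: "\<And>j u. 0 \<le> u \<Longrightarrow> fst A $ j < snd A $ j \<Longrightarrow> (\<integral>\<^sup>+\<nu>. G j \<nu> u \<partial>split_threshold A j) \<le> ennreal (q j u)"
    and sum: "\<And>u. 0 \<le> u \<Longrightarrow> (\<Sum>j\<in>UNIV. (snd A $ j - fst A $ j) * q j u) = c * V u + V' u"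
  shows "(\<integral>\<^sup>+E. (if \<tau> + E \<le> \<Lambda> then \<integral>\<^sup>+j. \<integral>\<^sup>+\<nu>. G j \<nu> (\<Lambda> - (\<tau> + E)) \<partial>split_threshold A j \<partial>split_dim A else 1)
      \<partial>split_time A) \<le> ennreal (V (\<Lambda> - \<tau>))" (is "?I \<le> _")
proof -
  have c: "0 < c" using box_length_pos[OF A] by (simp add: c_def)
  have sum': "(\<Sum>j\<in>UNIV. (snd A $ j - fst A $ j) / c * q j u) = V u + V' u / c" if "0 \<le> u" for u
    using sum[OF that] c by (simp flip: sum_divide_distrib add: field_simps)
  have "(\<integral>\<^sup>+j. \<integral>\<^sup>+\<nu>. G j \<nu> u \<partial>split_threshold A j \<partial>split_dim A) \<le> ennreal (V u + V' u / c)" if u: "0 \<le> u" for u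
  proof -
    have "(\<integral>\<^sup>+j. \<integral>\<^sup>+\<nu>. G j \<nu> u \<partial>split_threshold A j \<partial>split_dim A)
      \<le> (\<Sum>j\<in>UNIV. ennreal ((snd A $ j - fst A $ j) / c * q j u))"
      unfolding nn_integral_split_dim c_def[symmetric]
    proof (rule sum_mono)
      fix j
      show "ennreal ((snd A $ j - fst A $ j) / c) * (\<integral>\<^sup>+\<nu>. G j \<nu> u \<partial>split_threshold A j)
        \<le> ennreal ((snd A $ j - fst A $ j) / c * q j u)"
      proof (cases "fst A $ j < snd A $ j")
        case True
        then show ?thesis using c q0[OF u, of j]
          by (subst ennreal_mult) (auto intro!: mult_left_mono q u)
      next
        \<comment> \<open>A side of length zero is chosen with probability zero; this is why the
          bound by \<open>q\<close> is assumed for proper sides only.\<close>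
        case False
        then show ?thesis using box_side_le[OF A, of j] by simp
      qed
    qed
    also have "\<dots> = ennreal (V u + V' u / c)"
      unfolding sum'[OF u, symmetric] using c u q0 box_side_le[OF A] by (intro sum_ennreal) simp
    finally show ?thesis .
  qed
  then have "?I \<le> (\<integral>\<^sup>+E. (if \<tau> + E \<le> \<Lambda> then ennreal (V (\<Lambda> - (\<tau> + E)) + V' (\<Lambda> - (\<tau> + E)) / c) else 1) \<partial>split_time A)"
    by (intro nn_integral_mono) auto
  also have "\<dots> = ennreal (V (\<Lambda> - \<tau>))"
    unfolding c_def
  proof (rule nn_integral_split_time[OF _ le V V0])
    show "0 \<le> V u + V' u / box_length A" if "0 \<le> u" for u
      unfolding c_def[symmetric] sum'[OF that, symmetric]
      using c q0[OF that] box_side_le[OF A] by (intro sum_nonneg) simp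
  qed (use c in \<open>auto simp: c_def\<close>)
  finally show ?thesis .
qed

text \<open>Here the measure grows with the depth, not the integrand, so monotone convergence of
  functions does not apply. A simple function below h integrates to a finite combination of measures
  of sets, and each of those converges by the definition of the process.\<close>

lemma nn_integral_mondrian_process_le:
  fixes A :: "'d::finite box"
  assumes A: "fst A \<le> snd A" and L: "0 \<le> \<Lambda>"
    and le: "\<And>n. (\<integral>\<^sup>+t. h t \<partial>split_cell n A 0 \<Lambda>) \<le> B"
  shows "(\<integral>\<^sup>+t. h t \<partial>mondrian_process \<Lambda> A) \<le> B"
  unfolding nn_integral_def_finite
proof (safe intro!: SUP_least)
  let ?M = "mondrian_process \<Lambda> A"
  note sets = mondrian_process_well_defined(1)[OF A L]
  have sp: "space ?M = UNIV" using sets_eq_imp_space_eq[OF sets] by (simp add: space_tree_sigma space_pair_measure)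
  fix g assume g: "simple_function ?M g" "g \<le> h" "\<forall>x. g x < top"
  have gn: "simple_function (split_cell n A 0 \<Lambda>) g" for n
    using g(1) sets by (simp add: simple_function_def sp)
  have inc: "incseq (\<lambda>n. emeasure (split_cell n A 0 \<Lambda>) X)" for X
  proof (rule incseq_SucI)
    fix n show "emeasure (split_cell n A 0 \<Lambda>) X \<le> emeasure (split_cell (Suc n) A 0 \<Lambda>) X"
      using split_cell_mono[of n A 0 \<Lambda>] by (subst (asm) le_measure) (auto simp del: split_cell.simps, metis emeasure_notin_sets sets_split_cell zero_le)
  qed
  have lim: "(\<lambda>n. emeasure (split_cell n A 0 \<Lambda>) X) \<longlonglongrightarrow> emeasure ?M X" if "X \<in> sets ?M" for X
    using LIMSEQ_SUP[OF inc, of X] mondrian_process_well_defined(2)[OF A L, of X] that sets by simp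
  have "(\<lambda>n. integral\<^sup>S (split_cell n A 0 \<Lambda>) g) \<longlonglongrightarrow> integral\<^sup>S ?M g"
    unfolding simple_integral_def sp space_split_cell
  \<comment> \<open>Multiplication by a constant preserves limits in \<open>ennreal\<close> when the
    constant is finite, hence the restriction to finite-valued simple functions.\<close>
  proof (intro tendsto_sum ennreal_tendsto_cmult)
    fix y assume "y \<in> range g"
    then show "y < top" using g(3) by auto
    show "(\<lambda>n. emeasure (split_cell n A 0 \<Lambda>) (g -` {y} \<inter> UNIV)) \<longlonglongrightarrow> emeasure ?M (g -` {y} \<inter> UNIV)"
      using simple_functionD(2)[OF g(1), of "{y}"] by (intro lim) (simp add: sp)
  qed
  moreover have "integral\<^sup>S (split_cell n A 0 \<Lambda>) g \<le> B" for n
  proof -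
    have "integral\<^sup>S (split_cell n A 0 \<Lambda>) g = integral\<^sup>N (split_cell n A 0 \<Lambda>) g"
      using nn_integral_eq_simple_integral[OF gn] by simp
    also have "\<dots> \<le> integral\<^sup>N (split_cell n A 0 \<Lambda>) h"
      using g(2) by (intro nn_integral_mono) (auto simp: le_fun_def)
    also have "\<dots> \<le> B" by (rule le)
    finally show ?thesis .
  qed
  ultimately show "integral\<^sup>S ?M g \<le> B"
    by (intro LIMSEQ_le_const2) auto
qed

text \<open>The induction on depth shared by both functionals. The coefficients are 1 and 1 for the
  leaf count, and indicators of the half containing both points for the cell relation. P is the
  invariant of the boxes visited. It suffices that W dominates its own one-step average: depth 0 has
  no mass and contributes 0.\<close>

lemma nn_integral_split_cell_le:
  fixes \<Phi> :: "'d::finite split_tree \<Rightarrow> ennreal" and P :: "'d box \<Rightarrow> bool"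
  assumes [measurable]: "\<Phi> \<in> borel_measurable split_tree_space"
    and Leaf: "\<Phi> Leaf = 1"
    and Node: "\<And>l j \<nu> r. \<Phi> (Node l (j, \<nu>) r) = \<alpha> j \<nu> * \<Phi> l + \<beta> j \<nu> * \<Phi> r"
    and lower: "\<And>A j \<nu>. P A \<Longrightarrow> fst A $ j \<le> \<nu> \<Longrightarrow> \<nu> \<le> snd A $ j \<Longrightarrow> \<alpha> j \<nu> \<noteq> 0 \<Longrightarrow> P (lower_box j \<nu> A)"
    and upper: "\<And>A j \<nu>. P A \<Longrightarrow> fst A $ j \<le> \<nu> \<Longrightarrow> \<nu> \<le> snd A $ j \<Longrightarrow> \<beta> j \<nu> \<noteq> 0 \<Longrightarrow> P (upper_box j \<nu> A)"
    and degenerate: "\<And>A u. P A \<Longrightarrow> \<not> fst A < snd A \<Longrightarrow> 0 \<le> u \<Longrightarrow> 1 \<le> W A u"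
    and step: "\<And>A \<tau>. P A \<Longrightarrow> fst A < snd A \<Longrightarrow> \<tau> \<le> \<Lambda> \<Longrightarrow>
      (\<integral>\<^sup>+E. (if \<tau> + E \<le> \<Lambda> then \<integral>\<^sup>+j. \<integral>\<^sup>+\<nu>. \<alpha> j \<nu> * W (lower_box j \<nu> A) (\<Lambda> - (\<tau> + E))
          + \<beta> j \<nu> * W (upper_box j \<nu> A) (\<Lambda> - (\<tau> + E)) \<partial>split_threshold A j \<partial>split_dim A else 1)
        \<partial>split_time A) \<le> W A (\<Lambda> - \<tau>)"
    and A: "P A" and le: "\<tau> \<le> \<Lambda>"
  shows "(\<integral>\<^sup>+t. \<Phi> t \<partial>split_cell n A \<tau> \<Lambda>) \<le> W A (\<Lambda> - \<tau>)"
  using A le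
proof (induction n arbitrary: A \<tau>)
  case 0
  then show ?case by simp
next
  case (Suc n)
  have ret: "(\<integral>\<^sup>+t. \<Phi> t \<partial>return split_tree_space Leaf) = 1"
    using Leaf by (subst nn_integral_return) auto
  show ?case
  proof (cases "fst A < snd A")
    case False
    then show ?thesis using degenerate[OF Suc.prems(1) False] Suc.prems(2) ret by simp
  next
    case True
    have inner: "(\<integral>\<^sup>+l. \<integral>\<^sup>+r. \<Phi> (Node l (j, \<nu>) r) \<partial>split_cell n (upper_box j \<nu> A) s \<Lambda> \<partial>split_cell n (lower_box j \<nu> A) s \<Lambda>)
      \<le> \<alpha> j \<nu> * W (lower_box j \<nu> A) (\<Lambda> - s) + \<beta> j \<nu> * W (upper_box j \<nu> A) (\<Lambda> - s)"
      if \<nu>: "fst A $ j \<le> \<nu>" "\<nu> \<le> snd A $ j" and s: "s \<le> \<Lambda>" for j \<nu> s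
    proof -
      let ?L = "split_cell n (lower_box j \<nu> A) s \<Lambda>" and ?U = "split_cell n (upper_box j \<nu> A) s \<Lambda>"
      have mass: "emeasure ?L UNIV \<le> 1" "emeasure ?U UNIV \<le> 1"
        by (intro subprob_space.subprob_emeasure_le_1 split_cell_subprob)+
      have "(\<integral>\<^sup>+l. \<integral>\<^sup>+r. \<Phi> (Node l (j, \<nu>) r) \<partial>?U \<partial>?L)
        = (\<alpha> j \<nu> * (\<integral>\<^sup>+t. \<Phi> t \<partial>?L)) * emeasure ?U UNIV + (\<beta> j \<nu> * (\<integral>\<^sup>+t. \<Phi> t \<partial>?U)) * emeasure ?L UNIV"
      proof -
        have [measurable]: "\<Phi> \<in> borel_measurable (split_cell n B s \<Lambda>)" for B
          using assms(1) by (simp cong: measurable_cong_sets)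
        show ?thesis
          by (simp add: Node nn_integral_add nn_integral_cmult nn_integral_multc mult.assoc)
      qed
      \<comment> \<open>Each summand depends on one child only; the other child contributes its
        total mass, which may be below 1 because deep runs are discarded.\<close>
      also have "\<dots> \<le> (\<alpha> j \<nu> * (\<integral>\<^sup>+t. \<Phi> t \<partial>?L)) * 1 + (\<beta> j \<nu> * (\<integral>\<^sup>+t. \<Phi> t \<partial>?U)) * 1"
        by (intro add_mono mult_left_mono mass) auto
      also have "\<dots> \<le> \<alpha> j \<nu> * W (lower_box j \<nu> A) (\<Lambda> - s) + \<beta> j \<nu> * W (upper_box j \<nu> A) (\<Lambda> - s)"
        unfolding mult_1_right
      proof (rule add_mono)
        show "\<alpha> j \<nu> * (\<integral>\<^sup>+t. \<Phi> t \<partial>?L) \<le> \<alpha> j \<nu> * W (lower_box j \<nu> A) (\<Lambda> - s)"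
          using Suc.IH[OF lower[OF Suc.prems(1) \<nu>] s] by (cases "\<alpha> j \<nu> = 0") (auto intro: mult_left_mono)
        show "\<beta> j \<nu> * (\<integral>\<^sup>+t. \<Phi> t \<partial>?U) \<le> \<beta> j \<nu> * W (upper_box j \<nu> A) (\<Lambda> - s)"
          using Suc.IH[OF upper[OF Suc.prems(1) \<nu>] s] by (cases "\<beta> j \<nu> = 0") (auto intro: mult_left_mono)
      qed
      finally show ?thesis .
    qed
    have "(\<integral>\<^sup>+t. \<Phi> t \<partial>split_cell (Suc n) A \<tau> \<Lambda>) \<le>
      (\<integral>\<^sup>+E. (if \<tau> + E \<le> \<Lambda> then \<integral>\<^sup>+j. \<integral>\<^sup>+\<nu>. \<alpha> j \<nu> * W (lower_box j \<nu> A) (\<Lambda> - (\<tau> + E))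
          + \<beta> j \<nu> * W (upper_box j \<nu> A) (\<Lambda> - (\<tau> + E)) \<partial>split_threshold A j \<partial>split_dim A else 1)
        \<partial>split_time A)"
      unfolding nn_integral_split_cell_Suc[OF True assms(1)]
    proof (rule nn_integral_mono)
      fix E
      show "(if \<tau> + E \<le> \<Lambda> then \<integral>\<^sup>+j. \<integral>\<^sup>+\<nu>. \<integral>\<^sup>+l. \<integral>\<^sup>+r. \<Phi> (Node l (j, \<nu>) r) \<partial>split_cell n (upper_box j \<nu> A) (\<tau> + E) \<Lambda>
          \<partial>split_cell n (lower_box j \<nu> A) (\<tau> + E) \<Lambda> \<partial>split_threshold A j \<partial>split_dim A else \<Phi> Leaf)
        \<le> (if \<tau> + E \<le> \<Lambda> then \<integral>\<^sup>+j. \<integral>\<^sup>+\<nu>. \<alpha> j \<nu> * W (lower_box j \<nu> A) (\<Lambda> - (\<tau> + E))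
          + \<beta> j \<nu> * W (upper_box j \<nu> A) (\<Lambda> - (\<tau> + E)) \<partial>split_threshold A j \<partial>split_dim A else 1)"
      proof (cases "\<tau> + E \<le> \<Lambda>")
        case E: True
        then show ?thesis unfolding if_P[OF E] using inner
          by (intro nn_integral_mono nn_integral_mono_AE eventually_mono[OF AE_split_threshold]) auto
      qed (simp add: Leaf)
    qed
    also have "\<dots> \<le> W A (\<Lambda> - \<tau>)" by (rule step[OF Suc.prems(1) True Suc.prems(2)])
    finally show ?thesis .
  qed
qed

text \<open>The product V(u) solves the backward equation exactly. Let R_j be V without its factor
  j. Cutting side j yields two products with sum (2 + u l_j) R_j = V + R_j. Weighting by l_j and
  summing over j gives c V + V', since V' is the sum of the l_j R_j.\<close>

lemma nn_integral_size1_mondrian_process_le: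
  fixes A :: "'d::finite box"
  assumes A: "fst A \<le> snd A" and \<Lambda>: "0 \<le> \<Lambda>"
  shows "(\<integral>\<^sup>+t. of_nat (size1 t) \<partial>mondrian_process \<Lambda> A)
    \<le> ennreal (\<Prod>j\<in>UNIV. 1 + \<Lambda> * (snd A $ j - fst A $ j))"
proof (rule nn_integral_mondrian_process_le[OF A \<Lambda>])
  fix n
  let ?V = "\<lambda>(A :: 'd box) u. \<Prod>j\<in>UNIV. 1 + u * (snd A $ j - fst A $ j)"
  have "(\<integral>\<^sup>+t. of_nat (size1 t) \<partial>split_cell n A 0 \<Lambda>) \<le> ennreal (?V A (\<Lambda> - 0))"
  proof (rule nn_integral_split_cell_le[where \<Phi>="\<lambda>t. of_nat (size1 t)" and W="\<lambda>A u. ennreal (?V A u)" and P="\<lambda>A. fst A \<le> snd A" and \<alpha>="\<lambda>_ _. 1" and \<beta>="\<lambda>_ _. 1"])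
    show "(\<lambda>t. of_nat (size1 t) :: ennreal) \<in> borel_measurable (split_tree_space :: 'd split_tree measure)"
      by measurable
  next
    fix A :: "'d box" and u :: real assume "fst A \<le> snd A" "0 \<le> u"
    then show "1 \<le> ennreal (?V A u)"
      unfolding ennreal_1[symmetric] by (intro ennreal_leI prod_ge_1) (auto simp: less_eq_vec_def)
  next
    fix A :: "'d box" and \<tau> assume A: "fst A < snd A" and \<tau>: "\<tau> \<le> \<Lambda>"
    define len where "len j = snd A $ j - fst A $ j" for j
    have len: "0 \<le> len j" for j using box_side_le[OF A] by (simp add: len_def)
    define R where "R j u = (\<Prod>i\<in>UNIV - {j}. 1 + u * len i)" for j u
    have R0: "0 \<le> R j u" if "0 \<le> u" for j u
      unfolding R_def using len that by (intro prod_nonneg) auto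
    have VR: "?V A u = (1 + u * len j) * R j u" for j u
      unfolding R_def len_def by (rule prod.remove) auto
    have V': "(?V A has_real_derivative (\<Sum>j\<in>UNIV. len j * R j u)) (at u)" for u
      unfolding R_def len_def by (rule has_field_derivative_prod) (auto intro!: derivative_eq_intros)
    \<comment> \<open>The threshold cancels: only factor j changes, and its two new versions add up
      to 2 + u l_j wherever the cut falls.\<close>
    have cut: "1 * ennreal (?V (lower_box j \<nu> A) u) + 1 * ennreal (?V (upper_box j \<nu> A) u) = ennreal ((2 + u * len j) * R j u)"
      if "0 \<le> u" "fst A $ j \<le> \<nu>" "\<nu> \<le> snd A $ j" for u j \<nu>
    proof -
      have "?V (lower_box j \<nu> A) u = (1 + u * (\<nu> - fst A $ j)) * R j u"
        by (subst prod.remove[of _ j]) (auto simp: lower_box_def R_def len_def intro!: prod.cong)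
      moreover have "?V (upper_box j \<nu> A) u = (1 + u * (snd A $ j - \<nu>)) * R j u"
        by (subst prod.remove[of _ j]) (auto simp: upper_box_def R_def len_def intro!: prod.cong)
      ultimately show ?thesis using that R0[of u j]
        by (simp flip: ennreal_plus) (simp add: len_def algebra_simps)
    qed
    show "(\<integral>\<^sup>+E. (if \<tau> + E \<le> \<Lambda> then \<integral>\<^sup>+j. \<integral>\<^sup>+\<nu>. 1 * ennreal (?V (lower_box j \<nu> A) (\<Lambda> - (\<tau> + E)))
          + 1 * ennreal (?V (upper_box j \<nu> A) (\<Lambda> - (\<tau> + E))) \<partial>split_threshold A j \<partial>split_dim A else 1)
        \<partial>split_time A) \<le> ennreal (?V A (\<Lambda> - \<tau>))"
    proof (rule nn_integral_split_le[OF A \<tau> V', where q="\<lambda>j u. (2 + u * len j) * R j u" and G="\<lambda>j \<nu> u. 1 * ennreal (?V (lower_box j \<nu> A) u) + 1 * ennreal (?V (upper_box j \<nu> A) u)"])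
      show "(\<lambda>u. \<Sum>j\<in>UNIV. len j * R j u) \<in> borel_measurable borel" unfolding R_def by measurable
      show "0 \<le> (2 + u * len j) * R j u" if "0 \<le> u" for j u using R0[OF that] len that by simp
      show "(\<Sum>j\<in>UNIV. (snd A $ j - fst A $ j) * ((2 + u * len j) * R j u)) = box_length A * ?V A u + (\<Sum>j\<in>UNIV. len j * R j u)" for u
      proof -
        have "(2 + u * len j) * R j u = ?V A u + R j u" for j by (simp only: VR[of u j]) (simp add: algebra_simps)
        then have "(\<Sum>j\<in>UNIV. (snd A $ j - fst A $ j) * ((2 + u * len j) * R j u)) = (\<Sum>j\<in>UNIV. len j * (?V A u + R j u))"
          by (simp add: len_def)
        also have "\<dots> = (\<Sum>j\<in>UNIV. len j) * ?V A u + (\<Sum>j\<in>UNIV. len j * R j u)"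
          by (simp only: distrib_left sum.distrib sum_distrib_right)
        finally show ?thesis by (simp add: len_def box_length_def)
      qed
      fix j and u :: real assume u: "0 \<le> u" and j: "fst A $ j < snd A $ j"
      interpret prob_space "split_threshold A j" unfolding split_threshold_def using j
        by (intro prob_space_uniform_measure) auto
      have "(\<integral>\<^sup>+\<nu>. 1 * ennreal (?V (lower_box j \<nu> A) u) + 1 * ennreal (?V (upper_box j \<nu> A) u) \<partial>split_threshold A j)
        = (\<integral>\<^sup>+\<nu>. ennreal ((2 + u * len j) * R j u) \<partial>split_threshold A j)"
        using cut[OF u] by (intro nn_integral_cong_AE eventually_mono[OF AE_split_threshold]) auto
      then show "(\<integral>\<^sup>+\<nu>. 1 * ennreal (?V (lower_box j \<nu> A) u) + 1 * ennreal (?V (upper_box j \<nu> A) u) \<partial>split_threshold A j)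
        \<le> ennreal ((2 + u * len j) * R j u)" by (simp add: emeasure_space_1)
    qed auto
  qed (use A \<Lambda> in \<open>auto simp: less_eq_vec_def lower_box_def upper_box_def\<close>)
  then show "(\<integral>\<^sup>+t. of_nat (size1 t) \<partial>split_cell n A 0 \<Lambda>) \<le> ennreal (?V A \<Lambda>)" by simp
qed

text \<open>A uniform cut of side j separates the points with probability |x_j - y_j|/l_j, and side
  j is cut at rate l_j. The total separation rate is thus the l1 distance \<delta>, whatever box
  currently holds the two points, so exp(-u \<delta>) solves the backward equation without reference
  to the box.\<close>

lemma emeasure_same_cell_mondrian_process_le:
  fixes A :: "'d::finite box"
  assumes \<Lambda>: "0 \<le> \<Lambda>" and x: "x \<in> cbox (fst A) (snd A)" and y: "y \<in> cbox (fst A) (snd A)"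
  shows "emeasure (mondrian_process \<Lambda> A) {t. same_cell t x y} \<le> ennreal (exp (- \<Lambda> * (\<Sum>j\<in>UNIV. \<bar>x $ j - y $ j\<bar>)))"
proof -
  have A: "fst A \<le> snd A" using x by (auto simp: mem_box_cart less_eq_vec_def intro: order_trans)
  define \<delta> where "\<delta> = (\<Sum>j\<in>UNIV. \<bar>x $ j - y $ j\<bar>)"
  let ?P = "\<lambda>A :: 'd box. fst A \<le> snd A \<and> x \<in> cbox (fst A) (snd A) \<and> y \<in> cbox (fst A) (snd A)"
  \<comment> \<open>A separating threshold makes both coefficients 0; otherwise exactly the one for
    the half containing both points is 1.\<close>
  let ?\<alpha> = "\<lambda>j \<nu>. of_bool (x $ j \<le> \<nu> \<and> y $ j \<le> \<nu>) :: ennreal"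
  let ?\<beta> = "\<lambda>j \<nu>. of_bool (\<nu> < x $ j \<and> \<nu> < y $ j) :: ennreal"
  have m[measurable]: "Measurable.pred split_tree_space (\<lambda>t. same_cell t x y)"
    by measurable
  have "(\<integral>\<^sup>+t. of_bool (same_cell t x y) \<partial>mondrian_process \<Lambda> A) \<le> ennreal (exp (- \<Lambda> * \<delta>))"
  proof (rule nn_integral_mondrian_process_le[OF A \<Lambda>])
    fix n
    have "(\<integral>\<^sup>+t. of_bool (same_cell t x y) \<partial>split_cell n A 0 \<Lambda>) \<le> ennreal (exp (- (\<Lambda> - 0) * \<delta>))"
    proof (rule nn_integral_split_cell_le[where \<Phi>="\<lambda>t. of_bool (same_cell t x y)" and W="\<lambda>_ u. ennreal (exp (- u * \<delta>))" and P="?P" and \<alpha>="?\<alpha>" and \<beta>="?\<beta>"])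
      fix A :: "'d box" and u :: real assume P: "?P A" "\<not> fst A < snd A"
      \<comment> \<open>A box that cannot be split is a single point, so the two points coincide and
        the bound is exp 0.\<close>
      then have "fst A = snd A" by (auto simp: order_le_less)
      then have "x = y" using P by auto
      then show "1 \<le> ennreal (exp (- u * \<delta>))" by (simp add: \<delta>_def)
    next
      fix A :: "'d box" and \<tau> assume P: "?P A" and A: "fst A < snd A" and \<tau>: "\<tau> \<le> \<Lambda>"
      define len where "len j = snd A $ j - fst A $ j" for j
      have len: "\<bar>x $ j - y $ j\<bar> \<le> len j" for j
        using P by (auto simp: len_def mem_box_cart abs_le_iff) (smt (verit))+
      let ?q = "\<lambda>j u. (1 - \<bar>x $ j - y $ j\<bar> / len j) * exp (- u * \<delta>)"
      show "(\<integral>\<^sup>+E. (if \<tau> + E \<le> \<Lambda> then \<integral>\<^sup>+j. \<integral>\<^sup>+\<nu>. ?\<alpha> j \<nu> * ennreal (exp (- (\<Lambda> - (\<tau> + E)) * \<delta>))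
          + ?\<beta> j \<nu> * ennreal (exp (- (\<Lambda> - (\<tau> + E)) * \<delta>)) \<partial>split_threshold A j \<partial>split_dim A else 1)
        \<partial>split_time A) \<le> ennreal (exp (- (\<Lambda> - \<tau>) * \<delta>))"
      proof (rule nn_integral_split_le[OF A \<tau>, where V="\<lambda>u. exp (- u * \<delta>)" and V'="\<lambda>u. - \<delta> * exp (- u * \<delta>)" and q="?q" and G="\<lambda>j \<nu> u. ?\<alpha> j \<nu> * ennreal (exp (- u * \<delta>)) + ?\<beta> j \<nu> * ennreal (exp (- u * \<delta>))"])
        show "((\<lambda>u. exp (- u * \<delta>)) has_real_derivative - \<delta> * exp (- u * \<delta>)) (at u)" for u
          by (auto intro!: derivative_eq_intros)
        show "0 \<le> ?q j u" for j u
          using len[of j] by (cases "len j = 0") (auto simp: field_simps)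
        show "(\<Sum>j\<in>UNIV. (snd A $ j - fst A $ j) * ?q j u) = box_length A * exp (- u * \<delta>) + - \<delta> * exp (- u * \<delta>)" for u
        proof -
          have "(snd A $ j - fst A $ j) * ?q j u = (len j - \<bar>x $ j - y $ j\<bar>) * exp (- u * \<delta>)" for j
            using len[of j] by (cases "len j = 0") (auto simp: len_def[symmetric] field_simps)
          then have "(\<Sum>j\<in>UNIV. (snd A $ j - fst A $ j) * ?q j u) = (\<Sum>j\<in>UNIV. len j - \<bar>x $ j - y $ j\<bar>) * exp (- u * \<delta>)"
            by (simp only: sum_distrib_right)
          also have "(\<Sum>j\<in>UNIV. len j - \<bar>x $ j - y $ j\<bar>) = box_length A - \<delta>"
            by (simp add: sum_subtractf len_def box_length_def \<delta>_def)
          finally show ?thesis by (simp add: left_diff_distrib)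
        qed
        fix j and u :: real assume j: "fst A $ j < snd A $ j"
        have lenj: "0 < len j" using j by (simp add: len_def)
        \<comment> \<open>\<open>?D\<close> is the set of separating thresholds. It is half-open
          because a point lying on the threshold goes to the lower half.\<close>
        let ?S = "{fst A $ j..snd A $ j}" and ?D = "{min (x $ j) (y $ j)..<max (x $ j) (y $ j)}"
        have "fst A $ j \<le> x $ j" "x $ j \<le> snd A $ j" "fst A $ j \<le> y $ j" "y $ j \<le> snd A $ j"
          using P by (auto simp: mem_box_cart)
        then have sub: "?D \<subseteq> ?S" by auto
        have "(\<integral>\<^sup>+\<nu>. ?\<alpha> j \<nu> * ennreal (exp (- u * \<delta>)) + ?\<beta> j \<nu> * ennreal (exp (- u * \<delta>)) \<partial>split_threshold A j)
          = (\<integral>\<^sup>+\<nu>. ennreal (exp (- u * \<delta>)) * indicator (?S - ?D) \<nu> \<partial>split_threshold A j)"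
          by (intro nn_integral_cong_AE eventually_mono[OF AE_split_threshold]) (auto split: split_indicator)
        also have "\<dots> = ennreal (exp (- u * \<delta>)) * emeasure (split_threshold A j) (?S - ?D)"
          by (rule nn_integral_cmult_indicator) (simp add: split_threshold_def)
        also have "emeasure (split_threshold A j) (?S - ?D) = emeasure lborel (?S - ?D) / emeasure lborel ?S"
          unfolding split_threshold_def by (subst emeasure_uniform_measure) (auto intro!: arg_cong2[of _ _ _ _ "(/)"] arg_cong[of _ _ "emeasure lborel"])
        also have "emeasure lborel (?S - ?D) = ennreal (len j - \<bar>x $ j - y $ j\<bar>)"
          using sub j by (subst emeasure_Diff) (auto simp: len_def abs_real_def min_def max_def simp flip: ennreal_minus)
        also have "emeasure lborel ?S = ennreal (len j)" using j by (simp add: len_def)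
        also have "ennreal (exp (- u * \<delta>)) * (ennreal (len j - \<bar>x $ j - y $ j\<bar>) / ennreal (len j)) = ennreal (?q j u)"
          using len[of j] lenj by (simp add: divide_ennreal flip: ennreal_mult) (simp add: field_simps)
        finally show "(\<integral>\<^sup>+\<nu>. ?\<alpha> j \<nu> * ennreal (exp (- u * \<delta>)) + ?\<beta> j \<nu> * ennreal (exp (- u * \<delta>)) \<partial>split_threshold A j)
          \<le> ennreal (?q j u)" by simp
      qed auto
    qed (use A x y \<Lambda> in \<open>auto simp: less_eq_vec_def lower_box_def upper_box_def mem_box_cart\<close>)
    then show "(\<integral>\<^sup>+t. of_bool (same_cell t x y) \<partial>split_cell n A 0 \<Lambda>) \<le> ennreal (exp (- \<Lambda> * \<delta>))" by simp
  qed
  moreover have "(\<integral>\<^sup>+t. of_bool (same_cell t x y) \<partial>mondrian_process \<Lambda> A) = emeasure (mondrian_process \<Lambda> A) {t. same_cell t x y}"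
  proof (subst nn_integral_indicator[symmetric])
    have "{t \<in> space split_tree_space. same_cell t x y} \<in> sets split_tree_space" using m by measurable
    then show "{t. same_cell t x y} \<in> sets (mondrian_process \<Lambda> A)"
      using mondrian_process_well_defined(1)[OF A \<Lambda>] by (simp add: space_tree_sigma space_pair_measure)
  qed (auto intro!: nn_integral_cong split: split_indicator)
  ultimately show ?thesis by (simp add: \<delta>_def)
qed

section \<open>Cell sizes\<close>

text \<open>
  An upper bound for the squared distance from \<open>x\<close> to any point of its cell within the unit cube:
  each integral is the squared distance from \<open>x\<close> to a face of the cell, in layer-cake form.
\<close>

definition cell_spread :: "'d::finite split_tree \<Rightarrow> real^'d \<Rightarrow> ennreal" where
  "cell_spread t x = (\<Sum>j\<in>UNIV. \<Sum>s\<in>{-1, 1}. \<integral>\<^sup>+u. ennreal (2 * u) *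
     of_bool (x + axis j (s * u) \<in> cbox 0 1 \<and> same_cell t x (x + axis j (s * u))) \<partial>lborel)"

lemma measurable_axis [measurable (raw)]:
  assumes [measurable]: "u \<in> borel_measurable N"
  shows "(\<lambda>p. axis j (u p) :: real^'d::finite) \<in> borel_measurable N"
  unfolding axis_def by measurable

lemma measurable_cell_spread [measurable (raw)]:
  fixes x :: "'b \<Rightarrow> real^'d::finite"
  assumes [measurable]: "t \<in> N \<rightarrow>\<^sub>M split_tree_space" "x \<in> borel_measurable N"
  shows "(\<lambda>p. cell_spread (t p) (x p)) \<in> borel_measurable N"
  unfolding cell_spread_def by measurable

text \<open>The squared distance splits over coordinates. In coordinate j, moving from x towards y
  for a length up to w = |y_j - x_j| stays in the rectangle spanned by x and y, hence in the cell
  and the cube. The integral of 2u over [0, w] is w^2, and the sign s selects the face on the side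
  of y.\<close>

lemma dist_same_cell_le_cell_spread:
  fixes x y :: "real^'d::finite"
  assumes x: "x \<in> cbox 0 1" and y: "y \<in> cbox 0 1" and same: "same_cell t x y"
  shows "ennreal ((dist x y)\<^sup>2) \<le> cell_spread t x"
proof -
  have "ennreal ((dist x y)\<^sup>2) = (\<Sum>j\<in>UNIV. ennreal ((x $ j - y $ j)\<^sup>2))"
    by (simp add: dist_vec_def L2_set_def dist_real_def sum_nonneg)
  also have "\<dots> \<le> cell_spread t x"
    unfolding cell_spread_def
  proof (rule sum_mono)
    fix j
    define w where "w = \<bar>y $ j - x $ j\<bar>"
    define s where "s = (if x $ j \<le> y $ j then 1 else -1 :: real)"
    let ?I = "\<lambda>s. \<integral>\<^sup>+u. ennreal (2 * u) *
     of_bool (x + axis j (s * u) \<in> cbox 0 1 \<and> same_cell t x (x + axis j (s * u))) \<partial>lborel"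
    have "ennreal ((x $ j - y $ j)\<^sup>2) = ennreal (w\<^sup>2 - 0\<^sup>2)" by (simp add: w_def power2_commute)
    also have "\<dots> = (\<integral>\<^sup>+u. ennreal (2 * u) * indicator {0..w} u \<partial>lborel)"
      by (rule nn_integral_FTC_Icc[symmetric]) (auto simp: w_def intro!: derivative_eq_intros)
    also have "\<dots> \<le> ?I s"
    proof (intro nn_integral_mono mult_left_mono)
      fix u
      have "x + axis j (s * u) \<in> cbox 0 1 \<and> same_cell t x (x + axis j (s * u))" if u: "0 \<le> u" "u \<le> w"
      proof -
        have b: "min (x $ i) (y $ i) \<le> (x + axis j (s * u)) $ i" "(x + axis j (s * u)) $ i \<le> max (x $ i) (y $ i)" for i
          using u by (auto simp: axis_def s_def w_def split: if_splits)
        moreover have "(x + axis j (s * u)) $ i \<in> {0..1}" for i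
        proof -
          have "0 \<le> min (x $ i) (y $ i)" "max (x $ i) (y $ i) \<le> 1" using x y by (auto simp: mem_box_cart)
          then show ?thesis using b[of i] by auto
        qed
        ultimately show ?thesis using same_cell_between[OF same] by (auto simp: mem_box_cart)
      qed
      then show "indicator {0..w} u \<le> (of_bool (x + axis j (s * u) \<in> cbox 0 1 \<and> same_cell t x (x + axis j (s * u))) :: ennreal)"
        by (simp split: split_indicator)
    qed simp
    also have "\<dots> \<le> (\<Sum>s\<in>{-1, 1}. ?I s)" by (rule member_le_sum) (auto simp: s_def)
    finally show "ennreal ((x $ j - y $ j)\<^sup>2) \<le> (\<Sum>s\<in>{-1, 1}. ?I s)" .
  qed
  finally show ?thesis .
qed

text \<open>The integrand is 2/\<Lambda>^2 times the Gamma density of shape 2, which is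
  \<open>erlang_density 1\<close>. Negative u contributes nothing because \<open>ennreal\<close>
  truncates 2u to 0.\<close>

lemma nn_integral_twice_mult_exp:
  assumes "0 < \<Lambda>"
  shows "(\<integral>\<^sup>+u. ennreal (2 * u) * ennreal (exp (- \<Lambda> * u)) \<partial>lborel) = ennreal (2 / \<Lambda>\<^sup>2)"
proof -
  interpret prob_space "density lborel (erlang_density 1 \<Lambda>)"
    by (rule prob_space_erlang_density) (use assms in auto)
  have "(\<integral>\<^sup>+u. ennreal (2 * u) * ennreal (exp (- \<Lambda> * u)) \<partial>lborel)
    = (\<integral>\<^sup>+u. ennreal (2 / \<Lambda>\<^sup>2) * ennreal (erlang_density 1 \<Lambda> u) \<partial>lborel)"
    using assms by (intro nn_integral_cong)
      (auto simp: erlang_density_def ennreal_neg power2_eq_square field_simps simp flip: ennreal_mult)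
  also have "\<dots> = ennreal (2 / \<Lambda>\<^sup>2)"
    using emeasure_space_1 by (simp add: nn_integral_cmult emeasure_density)
  finally show ?thesis .
qed


text \<open>The distance from x to a face, cut off at the cube, has tails no heavier than an
  exponential variable of rate \<Lambda>, whose second moment is 2/\<Lambda>^2. A cell has two faces
  in each of the d coordinates, hence the constant 4 d.\<close>

lemma nn_integral_cell_spread_le:
  fixes x :: "real^'d::finite"
  assumes \<Lambda>: "0 < \<Lambda>" and x: "x \<in> cbox 0 1"
  shows "(\<integral>\<^sup>+t. cell_spread t x \<partial>mondrian_process \<Lambda> (0, 1)) \<le> ennreal (4 * CARD('d) / \<Lambda>\<^sup>2)"
proof -
  let ?M = "mondrian_process \<Lambda> (0, 1) :: 'd split_tree measure"
  have [measurable_cong]: "sets ?M = sets split_tree_space"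
    by (rule mondrian_process_well_defined) (use \<Lambda> in \<open>auto simp: less_eq_vec_def\<close>)
  have sp: "space ?M = UNIV"
    using sets_eq_imp_space_eq[OF \<open>sets ?M = sets split_tree_space\<close>] by (simp add: space_tree_sigma space_pair_measure)
  interpret M: prob_space ?M
    by (rule mondrian_process_well_defined) (use \<Lambda> in \<open>auto simp: less_eq_vec_def\<close>)
  interpret pair_sigma_finite ?M lborel ..
  let ?B = "\<lambda>t j s u. of_bool (x + axis j (s * u) \<in> cbox 0 1 \<and> same_cell t x (x + axis j (s * u))) :: ennreal"
  have face: "(\<integral>\<^sup>+t. \<integral>\<^sup>+u. ennreal (2 * u) * ?B t j s u \<partial>lborel \<partial>?M) \<le> ennreal (2 / \<Lambda>\<^sup>2)"
    if s: "s \<in> {-1, 1}" for j s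
  proof -
    \<comment> \<open>Once u is fixed, the tree matters only through whether two given points at l1
      distance u share a cell.\<close>
    have "(\<integral>\<^sup>+t. \<integral>\<^sup>+u. ennreal (2 * u) * ?B t j s u \<partial>lborel \<partial>?M) = (\<integral>\<^sup>+u. \<integral>\<^sup>+t. ennreal (2 * u) * ?B t j s u \<partial>?M \<partial>lborel)"
      by (rule Fubini'[symmetric]) measurable
    also have "\<dots> \<le> (\<integral>\<^sup>+u. ennreal (2 * u) * ennreal (exp (- \<Lambda> * u)) \<partial>lborel)"
    proof (rule nn_integral_mono)
      fix u :: real
      let ?y = "x + axis j (s * u)"
      show "(\<integral>\<^sup>+t. ennreal (2 * u) * ?B t j s u \<partial>?M) \<le> ennreal (2 * u) * ennreal (exp (- \<Lambda> * u))"
      proof (cases "0 \<le> u \<and> ?y \<in> cbox 0 1")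
        case True
        have "(\<Sum>i\<in>UNIV. \<bar>x $ i - ?y $ i\<bar>) = u"
          using s True by (auto simp: axis_def if_distrib[of abs] abs_mult cong: if_cong)
        then have "emeasure ?M {t. same_cell t x ?y} \<le> ennreal (exp (- \<Lambda> * u))"
          using emeasure_same_cell_mondrian_process_le[of \<Lambda> x "(0, 1)" ?y] x True \<Lambda> by simp
        moreover have "(\<integral>\<^sup>+t. ennreal (2 * u) * ?B t j s u \<partial>?M) = (\<integral>\<^sup>+t. ennreal (2 * u) * indicator {t\<in>space ?M. same_cell t x ?y} t \<partial>?M)"
          using True by (intro nn_integral_cong) (auto simp: sp split: split_indicator)
        moreover have "\<dots> = ennreal (2 * u) * emeasure ?M {t\<in>space ?M. same_cell t x ?y}"
          by (rule nn_integral_cmult_indicator) measurable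
        ultimately show ?thesis by (simp add: sp mult_left_mono)
      qed (auto simp: ennreal_neg)
    qed
    also have "\<dots> = ennreal (2 / \<Lambda>\<^sup>2)" by (rule nn_integral_twice_mult_exp[OF \<Lambda>])
    finally show ?thesis .
  qed
  have "(\<integral>\<^sup>+t. cell_spread t x \<partial>?M) = (\<Sum>j\<in>UNIV. \<Sum>s\<in>{-1, 1}. \<integral>\<^sup>+t. \<integral>\<^sup>+u. ennreal (2 * u) * ?B t j s u \<partial>lborel \<partial>?M)"
    unfolding cell_spread_def by (subst nn_integral_sum, measurable)+
  also have "\<dots> \<le> (\<Sum>j\<in>(UNIV::'d set). \<Sum>s\<in>{-1, 1::real}. ennreal (2 / \<Lambda>\<^sup>2))"
    by (intro sum_mono face)
  also have "\<dots> = ennreal (\<Sum>j\<in>(UNIV::'d set). \<Sum>s\<in>{-1, 1::real}. 2 / \<Lambda>\<^sup>2)"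
    by (simp only: sum_ennreal sum_nonneg zero_le_divide_iff zero_le_power2 zero_le_numeral simp_thms)
  also have "\<dots> = ennreal (4 * CARD('d) / \<Lambda>\<^sup>2)" by simp
  finally show ?thesis .
qed

section \<open>Averaging the noise\<close>

text \<open>One noise variable against functions of its own point: the square is expanded, the cross
  term vanishes by \<open>mean\<close>, and \<open>var\<close> bounds the last term. Boundedness of
  a and w supplies the integrability that the expansion needs.\<close>

lemma nn_integral_square_add_noise_le:
  fixes \<nu> :: "('a \<times> real) measure" and g :: "'a \<Rightarrow> real"
  assumes "prob_space \<nu>" and sets[measurable_cong]: "sets \<nu> = sets (N \<Otimes>\<^sub>M borel)"
    and [measurable]: "g \<in> borel_measurable N"
    and mean: "\<And>h C. h \<in> borel_measurable N \<Longrightarrow> (\<And>x. \<bar>h x\<bar> \<le> C) \<Longrightarrow>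
      integrable \<nu> (\<lambda>z. h (fst z) * (snd z - g (fst z))) \<and> (\<integral>z. h (fst z) * (snd z - g (fst z)) \<partial>\<nu>) = 0"
    and var: "\<And>h. h \<in> borel_measurable N \<Longrightarrow>
      (\<integral>\<^sup>+z. ennreal ((h (fst z) * (snd z - g (fst z)))\<^sup>2) \<partial>\<nu>) \<le> ennreal (\<sigma>\<^sup>2) * (\<integral>\<^sup>+z. ennreal ((h (fst z))\<^sup>2) \<partial>\<nu>)"
    and a[measurable]: "a \<in> borel_measurable N" and aC: "\<And>x. \<bar>a x\<bar> \<le> C"
    and w[measurable]: "w \<in> borel_measurable N" and wC: "\<And>x. \<bar>w x\<bar> \<le> C'"
  shows "(\<integral>\<^sup>+z. ennreal ((a (fst z) + w (fst z) * (snd z - g (fst z)))\<^sup>2) \<partial>\<nu>)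
    \<le> (\<integral>\<^sup>+z. ennreal ((a (fst z))\<^sup>2) + ennreal (\<sigma>\<^sup>2 * (w (fst z))\<^sup>2) \<partial>\<nu>)"
proof -
  interpret prob_space \<nu> by fact
  let ?e = "\<lambda>z. snd z - g (fst z)"
  have bound: "integrable \<nu> (\<lambda>z. (h (fst z))\<^sup>2)" if [measurable]: "h \<in> borel_measurable N" and "\<And>x. \<bar>h x\<bar> \<le> B" for h and B :: real
    by (rule integrable_const_bound[of _ "B\<^sup>2"]) (auto simp: abs_le_square_iff[symmetric] intro!: AE_I2 order_trans[OF that(2)])
  have nn: "(\<integral>\<^sup>+z. ennreal ((h (fst z))\<^sup>2) \<partial>\<nu>) = ennreal (\<integral>z. (h (fst z))\<^sup>2 \<partial>\<nu>)"
    if "h \<in> borel_measurable N" "\<And>x. \<bar>h x\<bar> \<le> B" for h and B :: real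
    by (rule nn_integral_eq_integral[OF bound]) (use that in auto)
  have I2: "integrable \<nu> (\<lambda>z. (w (fst z) * ?e z)\<^sup>2)"
  proof (rule integrableI_nonneg)
    have "(\<integral>\<^sup>+z. ennreal ((w (fst z) * ?e z)\<^sup>2) \<partial>\<nu>) \<le> ennreal (\<sigma>\<^sup>2) * ennreal (\<integral>z. (w (fst z))\<^sup>2 \<partial>\<nu>)"
      using var[OF w] nn[OF w wC] by simp
    then show "(\<integral>\<^sup>+z. ennreal ((w (fst z) * ?e z)\<^sup>2) \<partial>\<nu>) < \<infinity>"
      by (rule le_less_trans) (simp add: ennreal_mult_less_top)
  qed auto
  \<comment> \<open>The coefficient of the cross term is again a bounded function of the point
    alone, so \<open>mean\<close> applies with h = a w.\<close>
  have "\<bar>a x * w x\<bar> \<le> C * C'" for x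
    unfolding abs_mult using aC[of x] wC[of x] by (intro mult_mono) auto
  then have I1: "integrable \<nu> (\<lambda>z. a (fst z) * w (fst z) * ?e z)" "(\<integral>z. a (fst z) * w (fst z) * ?e z \<partial>\<nu>) = 0"
    using mean[of "\<lambda>x. a x * w x" "C * C'"] by auto
  have eq: "(a (fst z) + w (fst z) * ?e z)\<^sup>2 = (a (fst z))\<^sup>2 + 2 * (a (fst z) * w (fst z) * ?e z) + (w (fst z) * ?e z)\<^sup>2" for z
    by (simp add: power2_eq_square algebra_simps)
  have I: "integrable \<nu> (\<lambda>z. (a (fst z) + w (fst z) * ?e z)\<^sup>2)"
    unfolding eq by (intro Bochner_Integration.integrable_add integrable_mult_right bound[OF a aC] I1 I2)
  have "(\<integral>\<^sup>+z. ennreal ((a (fst z) + w (fst z) * ?e z)\<^sup>2) \<partial>\<nu>) = ennreal (\<integral>z. (a (fst z) + w (fst z) * ?e z)\<^sup>2 \<partial>\<nu>)"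
    by (rule nn_integral_eq_integral[OF I]) auto
  also have "(\<integral>z. (a (fst z) + w (fst z) * ?e z)\<^sup>2 \<partial>\<nu>) = (\<integral>z. (a (fst z))\<^sup>2 \<partial>\<nu>) + (\<integral>z. (w (fst z) * ?e z)\<^sup>2 \<partial>\<nu>)"
    unfolding eq using bound[OF a aC] I1 I2 by simp
  also have "ennreal \<dots> = (\<integral>\<^sup>+z. ennreal ((a (fst z))\<^sup>2) \<partial>\<nu>) + (\<integral>\<^sup>+z. ennreal ((w (fst z) * ?e z)\<^sup>2) \<partial>\<nu>)"
    using nn[OF a aC] nn_integral_eq_integral[OF I2] by (simp add: ennreal_plus)
  also have "\<dots> \<le> (\<integral>\<^sup>+z. ennreal ((a (fst z))\<^sup>2) \<partial>\<nu>) + ennreal (\<sigma>\<^sup>2) * (\<integral>\<^sup>+z. ennreal ((w (fst z))\<^sup>2) \<partial>\<nu>)"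
    by (intro add_left_mono var w)
  also have "\<dots> = (\<integral>\<^sup>+z. ennreal ((a (fst z))\<^sup>2) + ennreal (\<sigma>\<^sup>2 * (w (fst z))\<^sup>2) \<partial>\<nu>)"
    by (simp add: nn_integral_add nn_integral_cmult ennreal_mult)
  finally show ?thesis .
qed

text \<open>
  The noise coordinates are integrated out one at a time, so that no mixed products of noises have
  to be shown integrable.
\<close>

lemma nn_integral_PiM_square_add_noise_le:
  fixes \<nu> :: "('a \<times> real) measure" and g :: "'a \<Rightarrow> real" and w :: "'i \<Rightarrow> ('i \<Rightarrow> 'a) \<Rightarrow> real"
  assumes "prob_space \<nu>" and sets[measurable_cong]: "sets \<nu> = sets (N \<Otimes>\<^sub>M borel)"
    and [measurable]: "g \<in> borel_measurable N"
    and mean: "\<And>h C. h \<in> borel_measurable N \<Longrightarrow> (\<And>x. \<bar>h x\<bar> \<le> C) \<Longrightarrow>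
      integrable \<nu> (\<lambda>z. h (fst z) * (snd z - g (fst z))) \<and> (\<integral>z. h (fst z) * (snd z - g (fst z)) \<partial>\<nu>) = 0"
    and var: "\<And>h. h \<in> borel_measurable N \<Longrightarrow>
      (\<integral>\<^sup>+z. ennreal ((h (fst z) * (snd z - g (fst z)))\<^sup>2) \<partial>\<nu>) \<le> ennreal (\<sigma>\<^sup>2) * (\<integral>\<^sup>+z. ennreal ((h (fst z))\<^sup>2) \<partial>\<nu>)"
    and I: "finite I" and J: "J \<subseteq> I"
    and b[measurable]: "b \<in> borel_measurable (\<Pi>\<^sub>M i\<in>I. N)" and bC: "\<And>\<xi>. \<bar>b \<xi>\<bar> \<le> C"
    and w: "\<And>i. i \<in> I \<Longrightarrow> w i \<in> borel_measurable (\<Pi>\<^sub>M i\<in>I. N)" and wC: "\<And>i \<xi>. \<bar>w i \<xi>\<bar> \<le> C'"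
  shows "(\<integral>\<^sup>+z. ennreal ((b (\<lambda>k\<in>I. fst (z k)) + (\<Sum>i\<in>J. w i (\<lambda>k\<in>I. fst (z k)) * (snd (z i) - g (fst (z i)))))\<^sup>2) \<partial>(\<Pi>\<^sub>M i\<in>I. \<nu>))
    \<le> (\<integral>\<^sup>+z. ennreal ((b (\<lambda>k\<in>I. fst (z k)))\<^sup>2 + \<sigma>\<^sup>2 * (\<Sum>i\<in>J. (w i (\<lambda>k\<in>I. fst (z k)))\<^sup>2)) \<partial>(\<Pi>\<^sub>M i\<in>I. \<nu>))"
proof -
  interpret \<nu>: prob_space \<nu> by fact
  interpret product_sigma_finite "\<lambda>_::'i. \<nu>" by standard
  let ?X = "\<lambda>z. \<lambda>k\<in>I. fst (z k)" and ?e = "\<lambda>z i. snd (z i) - g (fst (z i))"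
  have sp: "space \<nu> = space N \<times> UNIV" using sets_eq_imp_space_eq[OF sets] by (simp add: space_pair_measure)
  have proj[measurable]: "(\<lambda>z. z i) \<in> (\<Pi>\<^sub>M i\<in>I. \<nu>) \<rightarrow>\<^sub>M N \<Otimes>\<^sub>M borel" if "i \<in> I" for i
    using measurable_component_singleton[OF that, of "\<lambda>_. \<nu>"] sets by (simp cong: measurable_cong_sets)
  have X[measurable]: "?X \<in> (\<Pi>\<^sub>M i\<in>I. \<nu>) \<rightarrow>\<^sub>M (\<Pi>\<^sub>M i\<in>I. N)"
    by (rule measurable_restrict) measurable
  have e[measurable]: "(\<lambda>z. ?e z i) \<in> borel_measurable (\<Pi>\<^sub>M i\<in>I. \<nu>)" if "i \<in> I" for i
    using proj[OF that] by measurable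
  have "finite J" using I J by (rule finite_subset[rotated])
  then show ?thesis using J
  proof induction
    case empty
    then show ?case by simp
  next
    case (insert i J)
    let ?Q = "\<lambda>z. b (?X z) + (\<Sum>k\<in>J. w k (?X z) * ?e z k)"
    have i: "i \<in> I" and J: "J \<subseteq> I" "finite J" and II: "insert i (I - {i}) = I" using insert by auto
    have wi[measurable]: "(\<lambda>z. w k (?X z)) \<in> borel_measurable (\<Pi>\<^sub>M i\<in>I. \<nu>)" if "k \<in> I" for k
      by (rule measurable_compose[OF X w[OF that]])
    have Q[measurable]: "?Q \<in> borel_measurable (\<Pi>\<^sub>M i\<in>I. \<nu>)"
      by (intro borel_measurable_add borel_measurable_sum borel_measurable_times e wi measurable_compose[OF X b]) (use J in auto)
    have "(\<integral>\<^sup>+z. ennreal ((b (?X z) + (\<Sum>k\<in>insert i J. w k (?X z) * ?e z k))\<^sup>2) \<partial>(\<Pi>\<^sub>M i\<in>I. \<nu>))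
      = (\<integral>\<^sup>+z. ennreal ((?Q z + w i (?X z) * ?e z i)\<^sup>2) \<partial>(\<Pi>\<^sub>M i\<in>I. \<nu>))"
      using insert.hyps by (simp add: algebra_simps)
    \<comment> \<open>The pair with index i is integrated innermost. \<open>?Q\<close> contains no
      noise of index i, so it depends on this pair only through its point.\<close>
    also have "\<dots> = (\<integral>\<^sup>+x. \<integral>\<^sup>+y. ennreal ((?Q (x(i:=y)) + w i (?X (x(i:=y))) * ?e (x(i:=y)) i)\<^sup>2) \<partial>\<nu> \<partial>(\<Pi>\<^sub>M i\<in>I-{i}. \<nu>))"
      by (subst product_nn_integral_insert[of "I - {i}" i, unfolded II]) (use I i in \<open>auto\<close>)
    also have "\<dots> \<le> (\<integral>\<^sup>+x. \<integral>\<^sup>+y. ennreal ((?Q (x(i:=y)))\<^sup>2) + ennreal (\<sigma>\<^sup>2 * (w i (?X (x(i:=y))))\<^sup>2) \<partial>\<nu> \<partial>(\<Pi>\<^sub>M i\<in>I-{i}. \<nu>))"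
    proof (rule nn_integral_mono)
      fix x assume x: "x \<in> space (\<Pi>\<^sub>M i\<in>I-{i}. \<nu>)"
      let ?\<xi> = "\<lambda>y. (\<lambda>k\<in>I. fst (x k))(i := y)"
      have \<xi>: "?X (x(i:=y)) = ?\<xi> (fst y)" for y using i by (auto simp: fun_eq_iff)
      have \<xi>m[measurable]: "?\<xi> \<in> N \<rightarrow>\<^sub>M (\<Pi>\<^sub>M i\<in>I. N)"
      proof (rule measurable_PiM_single')
        show "(\<lambda>y. ?\<xi> y k) \<in> N \<rightarrow>\<^sub>M N" if "k \<in> I" for k
          using x that by (cases "k = i") (auto simp: space_PiM PiE_iff sp mem_Times_iff)
        show "?\<xi> \<in> space N \<rightarrow> (\<Pi>\<^sub>E i\<in>I. space N)"
          using x i by (auto simp: space_PiM PiE_iff sp extensional_def mem_Times_iff)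
      qed
      let ?a = "\<lambda>y. b (?\<xi> y) + (\<Sum>k\<in>J. w k (?\<xi> y) * ?e x k)"
      have a: "b (?\<xi> (fst y)) + (\<Sum>k\<in>J. w k (?\<xi> (fst y)) * ?e (x(i:=y)) k) = ?a (fst y)" for y
        using insert.hyps by (intro arg_cong2[of _ _ _ _ "(+)"] sum.cong) auto
      have am: "?a \<in> borel_measurable N"
        by (intro borel_measurable_add borel_measurable_sum borel_measurable_times borel_measurable_const
            measurable_compose[OF \<xi>m b] measurable_compose[OF \<xi>m w]) (use J in auto)
      have aC: "\<bar>?a y\<bar> \<le> C + (\<Sum>k\<in>J. C' * \<bar>?e x k\<bar>)" for y
        using bC wC by (intro order_trans[OF abs_triangle_ineq] add_mono order_trans[OF sum_abs] sum_mono)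
          (auto simp: abs_mult intro!: mult_right_mono)
      show "(\<integral>\<^sup>+y. ennreal ((?Q (x(i:=y)) + w i (?X (x(i:=y))) * ?e (x(i:=y)) i)\<^sup>2) \<partial>\<nu>)
        \<le> (\<integral>\<^sup>+y. ennreal ((?Q (x(i:=y)))\<^sup>2) + ennreal (\<sigma>\<^sup>2 * (w i (?X (x(i:=y))))\<^sup>2) \<partial>\<nu>)"
        unfolding \<xi> a fun_upd_same
        by (rule nn_integral_square_add_noise_le[OF \<open>prob_space \<nu>\<close> sets assms(3) mean var am aC measurable_compose[OF \<xi>m w[OF i]] wC])
    qed
    also have "\<dots> = (\<integral>\<^sup>+z. ennreal ((?Q z)\<^sup>2) + ennreal (\<sigma>\<^sup>2 * (w i (?X z))\<^sup>2) \<partial>(\<Pi>\<^sub>M i\<in>I. \<nu>))"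
      by (subst product_nn_integral_insert[of "I - {i}" i, unfolded II]) (use I i in \<open>auto\<close>)
    also have "\<dots> = (\<integral>\<^sup>+z. ennreal ((?Q z)\<^sup>2) \<partial>(\<Pi>\<^sub>M i\<in>I. \<nu>)) + (\<integral>\<^sup>+z. ennreal (\<sigma>\<^sup>2 * (w i (?X z))\<^sup>2) \<partial>(\<Pi>\<^sub>M i\<in>I. \<nu>))"
      by (rule nn_integral_add) (use Q wi[OF i] in measurable)
    also have "\<dots> \<le> (\<integral>\<^sup>+z. ennreal ((b (?X z))\<^sup>2 + \<sigma>\<^sup>2 * (\<Sum>k\<in>J. (w k (?X z))\<^sup>2)) \<partial>(\<Pi>\<^sub>M i\<in>I. \<nu>))
        + (\<integral>\<^sup>+z. ennreal (\<sigma>\<^sup>2 * (w i (?X z))\<^sup>2) \<partial>(\<Pi>\<^sub>M i\<in>I. \<nu>))"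
      by (intro add_right_mono insert.IH J)
    also have "\<dots> = (\<integral>\<^sup>+z. ennreal ((b (?X z))\<^sup>2 + \<sigma>\<^sup>2 * (\<Sum>k\<in>J. (w k (?X z))\<^sup>2)) + ennreal (\<sigma>\<^sup>2 * (w i (?X z))\<^sup>2) \<partial>(\<Pi>\<^sub>M i\<in>I. \<nu>))"
    proof (rule nn_integral_add[symmetric])
      have [measurable]: "(\<lambda>z. w k (?X z)) \<in> borel_measurable (\<Pi>\<^sub>M i\<in>I. \<nu>)" if "k \<in> J" for k
        using that J by (intro wi) auto
      have [measurable]: "(\<lambda>z. b (?X z)) \<in> borel_measurable (\<Pi>\<^sub>M i\<in>I. \<nu>)"
        by (rule measurable_compose[OF X b])
      show "(\<lambda>z. ennreal ((b (?X z))\<^sup>2 + \<sigma>\<^sup>2 * (\<Sum>k\<in>J. (w k (?X z))\<^sup>2))) \<in> borel_measurable (\<Pi>\<^sub>M i\<in>I. \<nu>)"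
        by (intro measurable_compose[OF _ measurable_ennreal] borel_measurable_add borel_measurable_power borel_measurable_times
          borel_measurable_sum borel_measurable_const) fact+
      show "(\<lambda>z. ennreal (\<sigma>\<^sup>2 * (w i (?X z))\<^sup>2)) \<in> borel_measurable (\<Pi>\<^sub>M i\<in>I. \<nu>)"
        using wi[OF i] by measurable
    qed
    also have "\<dots> = (\<integral>\<^sup>+z. ennreal ((b (?X z))\<^sup>2 + \<sigma>\<^sup>2 * (\<Sum>k\<in>insert i J. (w k (?X z))\<^sup>2)) \<partial>(\<Pi>\<^sub>M i\<in>I. \<nu>))"
      using insert.hyps by (intro nn_integral_cong) (simp add: ennreal_plus[symmetric] sum_nonneg algebra_simps del: ennreal_plus)
    finally show ?case .
  qed
qed

section \<open>Exchangeability and the number of occupied cells\<close>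

lemma card_Collect_eq_sum_of_bool:
  "finite A \<Longrightarrow> card {k\<in>A. Q k} = (\<Sum>k\<in>A. of_bool (Q k))"
  by (auto intro!: arg_cong[of _ _ card])

lemma nn_integral_inverse_card_same_cell_le:
  fixes \<nu> :: "((real^'d::finite) \<times> real) measure" and n :: nat
  assumes \<nu>: "prob_space \<nu>" and sets: "sets \<nu> = sets (borel \<Otimes>\<^sub>M borel)"
  shows "(\<integral>\<^sup>+z. ennreal (1 / card {k\<in>{..n}. same_cell t (fst (z 0)) (fst (z k))}) \<partial>(\<Pi>\<^sub>M i\<in>{..n}. \<nu>))
    \<le> ennreal (size1 t / (n + 1))"
proof -
  interpret \<nu>: prob_space \<nu> by fact
  let ?P = "\<Pi>\<^sub>M i\<in>{..n}. \<nu>"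
  interpret P: prob_space ?P by (intro prob_space_PiM \<nu>)
  have proj[measurable]: "(\<lambda>z. fst (z i)) \<in> ?P \<rightarrow>\<^sub>M borel" if "i \<le> n" for i
    using measurable_component_singleton[of i "{..n}" "\<lambda>_. \<nu>"] that sets by (auto cong: measurable_cong_sets)
  let ?h = "\<lambda>i z. 1 / real (card {k\<in>{..n}. same_cell t (fst (z i)) (fst (z k))})"
  have tree: "(\<lambda>z. t) \<in> ?P \<rightarrow>\<^sub>M split_tree_space" by (simp add: space_tree_sigma space_pair_measure)
  have h[measurable]: "?h i \<in> borel_measurable ?P" if "i \<le> n" for i
  proof -
    have [measurable]: "Measurable.pred ?P (\<lambda>z. same_cell t (fst (z i)) (fst (z k)))" if "k \<le> n" for k
      by (rule measurable_same_cell[OF tree proj[OF \<open>i \<le> n\<close>] proj[OF that]])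
    show ?thesis unfolding card_Collect_eq_sum_of_bool[OF finite_atMost] of_nat_sum by measurable
  qed
  have exch: "(\<integral>\<^sup>+z. ennreal (?h i z) \<partial>?P) = (\<integral>\<^sup>+z. ennreal (?h 0 z) \<partial>?P)" if i: "i \<le> n" for i
  proof -
    \<comment> \<open>The transposition of 0 and i. Being its own inverse, it both preserves the
      product measure under reindexing and matches the two groups being counted.\<close>
    define f where "f k = (if k = 0 then i else if k = i then 0 else k)" for k
    have f0: "f 0 = i" and ff: "f (f k) = k" and fn: "k \<le> n \<Longrightarrow> f k \<le> n" for k
      using i by (auto simp: f_def)
    let ?R = "\<lambda>z. \<lambda>k\<in>{..n}. z (f k)"
    have inj: "inj f" using ff by (metis injI)
    have R: "distr ?P ?P ?R = ?P"
      by (intro distr_PiM_reindex[of "{..n}" "\<lambda>_. \<nu>" f "{..n}"] \<nu> inj_on_subset[OF inj]) (auto simp: fn)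
    have hR: "?h 0 (?R z) = ?h i z" for z
    proof -
      have "card {k\<in>{..n}. same_cell t (fst (z i)) (fst (z (f k)))} = card {k\<in>{..n}. same_cell t (fst (z i)) (fst (z k))}"
        by (rule bij_betw_same_card[of f], rule bij_betw_byWitness[of _ f]) (auto simp: ff fn)
      then show ?thesis by (simp add: f0 cong: conj_cong)
    qed
    have Rm: "?R \<in> ?P \<rightarrow>\<^sub>M ?P"
      by (intro measurable_restrict measurable_component_singleton) (simp add: fn)
    have "(\<integral>\<^sup>+z. ennreal (?h 0 z) \<partial>?P) = (\<integral>\<^sup>+z. ennreal (?h 0 z) \<partial>distr ?P ?P ?R)" by (simp only: R)
    also have "\<dots> = (\<integral>\<^sup>+z. ennreal (?h i z) \<partial>?P)"
    proof (subst nn_integral_distr[OF Rm])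
      show "(\<lambda>z. ennreal (?h 0 z)) \<in> borel_measurable (distr ?P ?P ?R)"
        unfolding measurable_distr_eq1 by (rule measurable_compose[OF h measurable_ennreal]) simp
    qed (simp only: hR)
    finally show ?thesis by simp
  qed
  \<comment> \<open>All n + 1 indices have the same expectation, so it can be computed from their
    sum, which the leaf count bounds pointwise.\<close>
  have "ennreal (n + 1) * (\<integral>\<^sup>+z. ennreal (?h 0 z) \<partial>?P) = (\<Sum>i\<le>n. \<integral>\<^sup>+z. ennreal (?h 0 z) \<partial>?P)"
    by (simp only: sum_constant card_atMost ennreal_of_nat_eq_real_of_nat Suc_eq_plus1)
  also have "\<dots> = (\<Sum>i\<le>n. \<integral>\<^sup>+z. ennreal (?h i z) \<partial>?P)"
    by (intro sum.cong exch[symmetric]) auto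
  also have "\<dots> = (\<integral>\<^sup>+z. (\<Sum>i\<le>n. ennreal (?h i z)) \<partial>?P)"
  proof (rule nn_integral_sum[symmetric])
    show "(\<lambda>z. ennreal (?h i z)) \<in> borel_measurable ?P" if "i \<in> {..n}" for i
      using that by (intro measurable_compose[OF h measurable_ennreal]) simp
  qed
  also have "\<dots> \<le> (\<integral>\<^sup>+z. ennreal (size1 t) \<partial>?P)"
  proof (rule nn_integral_mono)
    fix z
    show "(\<Sum>i\<le>n. ennreal (?h i z)) \<le> ennreal (size1 t)"
      using sum_inverse_card_same_cell_le[of "{..n}" t "\<lambda>k. fst (z k)"]
      by (subst sum_ennreal) (auto simp del: sum_of_bool_eq intro!: ennreal_leI)
  qed
  also have "\<dots> = ennreal (size1 t)" by (simp add: P.emeasure_space_1)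
  finally have *: "ennreal (n + 1) * (\<integral>\<^sup>+z. ennreal (?h 0 z) \<partial>?P) \<le> ennreal (size1 t)" .
  have "(\<integral>\<^sup>+z. ennreal (?h 0 z) \<partial>?P) = ennreal (1 / (n + 1)) * (ennreal (n + 1) * (\<integral>\<^sup>+z. ennreal (?h 0 z) \<partial>?P))"
    by (simp add: mult.assoc[symmetric] ennreal_mult[symmetric] del: of_nat_Suc of_nat_add)
  also have "\<dots> \<le> ennreal (1 / (n + 1)) * ennreal (size1 t)" by (intro mult_left_mono *) auto
  also have "\<dots> = ennreal (size1 t / (n + 1))" by (subst ennreal_mult[symmetric]) auto
  finally show ?thesis .
qed

section \<open>Risk of a single tree\<close>

text \<open>The weight of observation i in the average at the query point \<open>\<xi> 0\<close>. If
  no observation shares the cell, division by zero makes every weight 0, in agreement with the value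
  0 of the estimate.\<close>

definition cell_weight :: "nat \<Rightarrow> 'd::finite split_tree \<Rightarrow> (nat \<Rightarrow> real^'d) \<Rightarrow> nat \<Rightarrow> real" where
  "cell_weight n t \<xi> i = of_bool (same_cell t (\<xi> 0) (\<xi> i)) / card {k\<in>{1..n}. same_cell t (\<xi> 0) (\<xi> k)}"

lemma abs_cell_weight_le_1: "\<bar>cell_weight n t \<xi> i\<bar> \<le> 1"
proof (cases "card {k\<in>{1..n}. same_cell t (\<xi> 0) (\<xi> k)} = 0")
  case True
  then show ?thesis by (simp only: cell_weight_def of_nat_0 div_by_0 abs_zero zero_le_one)
next
  case False
  then have "1 \<le> real (card {k\<in>{1..n}. same_cell t (\<xi> 0) (\<xi> k)})" by linarith
  then show ?thesis by (simp add: cell_weight_def)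
qed

lemma measurable_cell_weight [measurable (raw)]:
  fixes \<xi> :: "'b \<Rightarrow> nat \<Rightarrow> real^'d::finite"
  assumes t: "t \<in> N \<rightarrow>\<^sub>M split_tree_space" and \<xi>: "\<And>k. k \<le> n \<Longrightarrow> (\<lambda>p. \<xi> p k) \<in> borel_measurable N" and i: "i \<le> n"
  shows "(\<lambda>p. cell_weight n (t p) (\<xi> p) i) \<in> borel_measurable N"
proof -
  have [measurable]: "Measurable.pred N (\<lambda>p. same_cell (t p) (\<xi> p 0) (\<xi> p k))" if "k \<le> n" for k
    using that by (intro measurable_same_cell t \<xi>) auto
  show ?thesis using i unfolding cell_weight_def card_Collect_eq_sum_of_bool[OF finite_atLeastAtMost] of_nat_sum by measurable
qed

text \<open>Pointwise in the points and the tree, with m observations in the cell. If m = 0, the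
  error is -g at the query point, at most F in size, and 1/(m + 1) = 1. If m > 0, the weights sum to
  1, so the bias is at most L times the largest distance, while the squared weights sum to 1/m <=
  2/(m + 1); this is the origin of the factor 2 of \<sigma>^2.\<close>

lemma cell_weight_error_le:
  fixes \<xi> :: "nat \<Rightarrow> real^'d::finite" and g :: "real^'d \<Rightarrow> real"
  assumes \<xi>: "\<And>k. k \<le> n \<Longrightarrow> \<xi> k \<in> cbox 0 1" and F: "\<And>x. \<bar>g x\<bar> \<le> F"
    and L: "L-lipschitz_on (cbox 0 1) g"
  shows "ennreal (((\<Sum>i\<in>{1..n}. cell_weight n t \<xi> i * g (\<xi> i)) - g (\<xi> 0))\<^sup>2 + \<sigma>\<^sup>2 * (\<Sum>i\<in>{1..n}. (cell_weight n t \<xi> i)\<^sup>2))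
    \<le> ennreal (L\<^sup>2) * cell_spread t (\<xi> 0) + ennreal (F\<^sup>2 + 2 * \<sigma>\<^sup>2) * ennreal (1 / card {k\<in>{..n}. same_cell t (\<xi> 0) (\<xi> k)})"
proof -
  define S where "S = {k\<in>{1..n}. same_cell t (\<xi> 0) (\<xi> k)}"
  define m where "m = card S"
  have S: "finite S" by (simp add: S_def)
  \<comment> \<open>The query point lies in its own cell, which accounts for m + 1.\<close>
  have "{k\<in>{..n}. same_cell t (\<xi> 0) (\<xi> k)} = insert 0 S"
    by (auto simp: S_def Suc_le_eq)
  then have card: "card {k\<in>{..n}. same_cell t (\<xi> 0) (\<xi> k)} = m + 1"
    using S by (simp add: m_def) (simp add: S_def)
  have sum: "(\<Sum>i\<in>{1..n}. cell_weight n t \<xi> i * a i) = (\<Sum>i\<in>S. a i) / m" for a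
  proof -
    have "(\<Sum>i\<in>{1..n}. cell_weight n t \<xi> i * a i) = (\<Sum>i\<in>{1..n}. if i \<in> S then a i / m else 0)"
      by (intro sum.cong) (auto simp: cell_weight_def S_def m_def)
    also have "\<dots> = (\<Sum>i\<in>{1..n} \<inter> S. a i / m)" by (rule sum.inter_restrict[symmetric]) simp
    also have "{1..n} \<inter> S = S" by (auto simp: S_def)
    finally show ?thesis by (simp add: sum_divide_distrib)
  qed
  have "(\<Sum>i\<in>{1..n}. (cell_weight n t \<xi> i)\<^sup>2) = (\<Sum>i\<in>S. cell_weight n t \<xi> i) / m"
    unfolding power2_eq_square by (rule sum)
  also have "(\<Sum>i\<in>S. cell_weight n t \<xi> i) = (\<Sum>i\<in>S. 1 / real m)"
    by (intro sum.cong) (auto simp: cell_weight_def S_def m_def)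
  \<comment> \<open>For m = 0 both sides are 0 by the convention for division.\<close>
  finally have sq: "(\<Sum>i\<in>{1..n}. (cell_weight n t \<xi> i)\<^sup>2) = 1 / m"
    by (cases "m = 0") (auto simp: m_def)
  define B where "B = (\<Sum>i\<in>S. g (\<xi> i)) / m - g (\<xi> 0)"
  have L0: "0 \<le> L" using L by (rule lipschitz_on_nonneg)
  have F0: "0 \<le> F" using F[of 0] by linarith
  show ?thesis
    unfolding sq sum card B_def[symmetric]
  proof (cases "m = 0")
    case True
    then have "B\<^sup>2 \<le> F\<^sup>2" using F[of "\<xi> 0"] F0 by (simp add: B_def flip: abs_le_square_iff)
    then have "ennreal (B\<^sup>2 + \<sigma>\<^sup>2 * (1 / m)) \<le> ennreal (F\<^sup>2 + 2 * \<sigma>\<^sup>2) * ennreal (1 / real (m + 1))"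
      using True by (simp add: ennreal_leI add_increasing2)
    then show "ennreal (B\<^sup>2 + \<sigma>\<^sup>2 * (1 / m)) \<le> ennreal (L\<^sup>2) * cell_spread t (\<xi> 0) + ennreal (F\<^sup>2 + 2 * \<sigma>\<^sup>2) * ennreal (1 / real (m + 1))"
      by (rule add_increasing[rotated]) simp
  next
    case False
    then have "S \<noteq> {}" by (auto simp: m_def)
    \<comment> \<open>The largest distance is attained at a sample point of the same cell, so
      \<open>cell_spread\<close> bounds its square.\<close>
    then have "Max ((\<lambda>i. dist (\<xi> 0) (\<xi> i)) ` S) \<in> (\<lambda>i. dist (\<xi> 0) (\<xi> i)) ` S"
      using S by (intro Max_in) auto
    then obtain k where k: "k \<in> S" "dist (\<xi> 0) (\<xi> k) = Max ((\<lambda>i. dist (\<xi> 0) (\<xi> i)) ` S)"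
      by auto
    then have max: "dist (\<xi> 0) (\<xi> i) \<le> dist (\<xi> 0) (\<xi> k)" if "i \<in> S" for i
      using S that by simp
    define D where "D = dist (\<xi> 0) (\<xi> k)"
    have dev: "\<bar>g (\<xi> i) - g (\<xi> 0)\<bar> \<le> L * D" if i: "i \<in> S" for i
    proof -
      have "\<bar>g (\<xi> 0) - g (\<xi> i)\<bar> \<le> L * dist (\<xi> 0) (\<xi> i)"
        using lipschitz_onD[OF L \<xi>[of 0] \<xi>[of i]] i by (auto simp: S_def dist_real_def)
      also have "\<dots> \<le> L * D" unfolding D_def by (intro mult_left_mono max i L0)
      finally show ?thesis by (simp add: abs_minus_commute)
    qed
    have "B = (\<Sum>i\<in>S. g (\<xi> i) - g (\<xi> 0)) / m"
      using False by (simp add: B_def sum_subtractf m_def[symmetric] field_simps)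
    also have "\<bar>\<dots>\<bar> \<le> (\<Sum>i\<in>S. L * D) / m"
      unfolding abs_divide by (intro divide_mono order_trans[OF sum_abs] sum_mono dev sum_nonneg mult_nonneg_nonneg L0) (use False in \<open>auto simp: D_def\<close>)
    also have "\<dots> = L * D" using False by (simp add: m_def)
    finally have "B\<^sup>2 \<le> (L * D)\<^sup>2" by (intro iffD1[OF abs_le_square_iff]) linarith
    moreover have "\<sigma>\<^sup>2 * (1 / m) \<le> (F\<^sup>2 + 2 * \<sigma>\<^sup>2) * (1 / real (m + 1))"
    proof -
      have "1 / real m \<le> 2 / real (m + 1)" using False by (simp add: field_simps)
      then have "\<sigma>\<^sup>2 * (1 / m) \<le> \<sigma>\<^sup>2 * (2 / real (m + 1))" by (rule mult_left_mono) simp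
      also have "\<dots> \<le> (F\<^sup>2 + 2 * \<sigma>\<^sup>2) * (1 / real (m + 1))" by (simp add: divide_right_mono)
      finally show ?thesis .
    qed
    ultimately have "ennreal (B\<^sup>2 + \<sigma>\<^sup>2 * (1 / m)) \<le> ennreal (L\<^sup>2 * D\<^sup>2 + (F\<^sup>2 + 2 * \<sigma>\<^sup>2) * (1 / real (m + 1)))"
      by (intro ennreal_leI add_mono) (simp_all add: power_mult_distrib)
    also have "\<dots> = ennreal (L\<^sup>2) * ennreal (D\<^sup>2) + ennreal (F\<^sup>2 + 2 * \<sigma>\<^sup>2) * ennreal (1 / real (m + 1))"
    proof -
      have c: "0 \<le> F\<^sup>2 + 2 * \<sigma>\<^sup>2" and d: "0 \<le> 1 / real (m + 1)" by auto
      show ?thesis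
        by (simp only: ennreal_plus[OF mult_nonneg_nonneg[OF zero_le_power2 zero_le_power2] mult_nonneg_nonneg[OF c d]]
            ennreal_mult[OF zero_le_power2 zero_le_power2] ennreal_mult[OF c d])
    qed
    also have "\<dots> \<le> ennreal (L\<^sup>2) * cell_spread t (\<xi> 0) + ennreal (F\<^sup>2 + 2 * \<sigma>\<^sup>2) * ennreal (1 / real (m + 1))"
      unfolding D_def using k(1) \<xi>
      by (intro add_right_mono mult_left_mono dist_same_cell_le_cell_spread) (auto simp: S_def)
    finally show "ennreal (B\<^sup>2 + \<sigma>\<^sup>2 * (1 / m)) \<le> ennreal (L\<^sup>2) * cell_spread t (\<xi> 0) + ennreal (F\<^sup>2 + 2 * \<sigma>\<^sup>2) * ennreal (1 / real (m + 1))" .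
  qed
qed

text \<open>The tree is fixed here and only the data are random. The term with
  \<open>cell_spread\<close> is left as an integral because its estimate needs the average over
  trees.\<close>

lemma nn_integral_weighted_error_le:
  fixes \<nu> :: "((real^'d::finite) \<times> real) measure" and g :: "real^'d \<Rightarrow> real" and n :: nat
  assumes \<nu>: "prob_space \<nu>" and sets[measurable_cong]: "sets \<nu> = sets (borel \<Otimes>\<^sub>M borel)"
    and g[measurable]: "g \<in> borel_measurable borel"
    and mean: "\<And>h C. h \<in> borel_measurable borel \<Longrightarrow> (\<And>x. \<bar>h x\<bar> \<le> C) \<Longrightarrow>
      integrable \<nu> (\<lambda>z. h (fst z) * (snd z - g (fst z))) \<and> (\<integral>z. h (fst z) * (snd z - g (fst z)) \<partial>\<nu>) = 0"
    and var: "\<And>h. h \<in> borel_measurable borel \<Longrightarrow>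
      (\<integral>\<^sup>+z. ennreal ((h (fst z) * (snd z - g (fst z)))\<^sup>2) \<partial>\<nu>) \<le> ennreal (\<sigma>\<^sup>2) * (\<integral>\<^sup>+z. ennreal ((h (fst z))\<^sup>2) \<partial>\<nu>)"
    and supp: "AE z in \<nu>. fst z \<in> cbox 0 1"
    and F: "\<And>x. \<bar>g x\<bar> \<le> F" and L: "L-lipschitz_on (cbox 0 1) g"
  shows "(\<integral>\<^sup>+z. ennreal (((\<Sum>i\<in>{1..n}. cell_weight n t (\<lambda>k. fst (z k)) i * snd (z i)) - g (fst (z 0)))\<^sup>2) \<partial>(\<Pi>\<^sub>M i\<in>{..n}. \<nu>))
    \<le> ennreal (L\<^sup>2) * (\<integral>\<^sup>+z. cell_spread t (fst (z 0)) \<partial>(\<Pi>\<^sub>M i\<in>{..n}. \<nu>)) + ennreal (F\<^sup>2 + 2 * \<sigma>\<^sup>2) * ennreal (size1 t / (n + 1))"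
proof -
  let ?P = "\<Pi>\<^sub>M i\<in>{..n}. \<nu>" and ?N = "\<Pi>\<^sub>M i\<in>{..n}. (borel :: (real^'d) measure)"
  let ?X = "\<lambda>z. \<lambda>k\<in>{..n}. fst (z k)"
  let ?b = "\<lambda>\<xi>. (\<Sum>i\<in>{1..n}. cell_weight n t \<xi> i * g (\<xi> i)) - g (\<xi> 0)"
  let ?w = "\<lambda>i \<xi>. cell_weight n t \<xi> i"
  \<comment> \<open>Elements of a product space are extensional, hence the restriction of the points
    to {..n}; the weights read no other index.\<close>
  have w_cong: "cell_weight n t (\<lambda>k\<in>{..n}. x k) i = cell_weight n t x i" if "i \<le> n" for x i
    using that by (simp add: cell_weight_def cong: conj_cong)
  have tree: "(\<lambda>\<xi>. t) \<in> M \<rightarrow>\<^sub>M split_tree_space" for M :: "'x measure" by (simp add: space_tree_sigma space_pair_measure)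
  have proj: "(\<lambda>\<xi>. \<xi> k) \<in> borel_measurable ?N" if "k \<le> n" for k
    using measurable_component_singleton[of k "{..n}" "\<lambda>_. borel"] that by simp
  have projP[measurable]: "(\<lambda>z. fst (z i)) \<in> ?P \<rightarrow>\<^sub>M borel" if "i \<le> n" for i
    using measurable_component_singleton[of i "{..n}" "\<lambda>_. \<nu>"] that sets by (auto cong: measurable_cong_sets)
  have w: "?w i \<in> borel_measurable ?N" if "i \<in> {..n}" for i
    using that by (intro measurable_cell_weight[OF tree] proj) auto
  have b: "?b \<in> borel_measurable ?N"
    by (intro borel_measurable_diff borel_measurable_sum borel_measurable_times measurable_compose[OF proj g] w) auto
  have bC: "\<bar>?b \<xi>\<bar> \<le> (\<Sum>i\<in>{1..n}. 1 * F) + F" for \<xi>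
    by (intro order_trans[OF abs_triangle_ineq4] add_mono order_trans[OF sum_abs] sum_mono F)
      (unfold abs_mult, intro mult_mono abs_cell_weight_le_1 F, auto)
  have "(\<integral>\<^sup>+z. ennreal (((\<Sum>i\<in>{1..n}. ?w i (\<lambda>k. fst (z k)) * snd (z i)) - g (fst (z 0)))\<^sup>2) \<partial>?P)
    = (\<integral>\<^sup>+z. ennreal ((?b (?X z) + (\<Sum>i\<in>{1..n}. ?w i (?X z) * (snd (z i) - g (fst (z i)))))\<^sup>2) \<partial>?P)"
  proof (intro nn_integral_cong arg_cong[of _ _ ennreal] arg_cong[of _ _ "\<lambda>x. x\<^sup>2"])
    fix z :: "nat \<Rightarrow> (real^'d) \<times> real"
    have "(\<Sum>i\<in>{1..n}. ?w i (?X z) * g (?X z i)) + (\<Sum>i\<in>{1..n}. ?w i (?X z) * (snd (z i) - g (fst (z i))))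
      = (\<Sum>i\<in>{1..n}. ?w i (\<lambda>k. fst (z k)) * snd (z i))"
      unfolding sum.distrib[symmetric] by (intro sum.cong) (auto simp: w_cong algebra_simps)
    then show "(\<Sum>i\<in>{1..n}. ?w i (\<lambda>k. fst (z k)) * snd (z i)) - g (fst (z 0)) =
      ?b (?X z) + (\<Sum>i\<in>{1..n}. ?w i (?X z) * (snd (z i) - g (fst (z i))))" by simp
  qed
  also have "\<dots> \<le> (\<integral>\<^sup>+z. ennreal ((?b (?X z))\<^sup>2 + \<sigma>\<^sup>2 * (\<Sum>i\<in>{1..n}. (?w i (?X z))\<^sup>2)) \<partial>?P)"
    by (rule nn_integral_PiM_square_add_noise_le[OF \<nu> sets g mean var _ _ b bC w abs_cell_weight_le_1]) auto
  also have "\<dots> \<le> (\<integral>\<^sup>+z. ennreal (L\<^sup>2) * cell_spread t (fst (z 0)) +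
      ennreal (F\<^sup>2 + 2 * \<sigma>\<^sup>2) * ennreal (1 / card {k\<in>{..n}. same_cell t (fst (z 0)) (fst (z k))}) \<partial>?P)"
  proof (rule nn_integral_mono_AE)
    have "AE z in ?P. \<forall>k\<in>{..n}. fst (z k) \<in> cbox 0 1"
      by (intro AE_finite_allI AE_PiM_component \<nu> supp) auto
    then show "AE z in ?P. ennreal ((?b (?X z))\<^sup>2 + \<sigma>\<^sup>2 * (\<Sum>i\<in>{1..n}. (?w i (?X z))\<^sup>2)) \<le>
       ennreal (L\<^sup>2) * cell_spread t (fst (z 0)) +
      ennreal (F\<^sup>2 + 2 * \<sigma>\<^sup>2) * ennreal (1 / card {k\<in>{..n}. same_cell t (fst (z 0)) (fst (z k))})"
    proof eventually_elim
      case (elim z)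
      then show ?case
        using cell_weight_error_le[where n=n and \<xi>="?X z" and t=t and \<sigma>=\<sigma>, OF _ F L] by (simp cong: conj_cong)
    qed
  qed
  also have "\<dots> = ennreal (L\<^sup>2) * (\<integral>\<^sup>+z. cell_spread t (fst (z 0)) \<partial>?P) +
      ennreal (F\<^sup>2 + 2 * \<sigma>\<^sup>2) * (\<integral>\<^sup>+z. ennreal (1 / card {k\<in>{..n}. same_cell t (fst (z 0)) (fst (z k))}) \<partial>?P)"
  proof -
    have m1: "(\<lambda>z. cell_spread t (fst (z 0))) \<in> borel_measurable ?P"
      by (intro measurable_cell_spread tree projP) simp
    have m2: "(\<lambda>z. ennreal (1 / card {k\<in>{..n}. same_cell t (fst (z 0)) (fst (z k))})) \<in> borel_measurable ?P"
    proof -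
      have [measurable]: "Measurable.pred ?P (\<lambda>z. same_cell t (fst (z 0)) (fst (z k)))" if "k \<le> n" for k
        by (intro measurable_same_cell[OF tree projP projP] that) simp
      show ?thesis unfolding card_Collect_eq_sum_of_bool[OF finite_atMost] of_nat_sum by measurable
    qed
    show ?thesis
      by (subst nn_integral_add[OF borel_measurable_times_ennreal[OF borel_measurable_const m1]
            borel_measurable_times_ennreal[OF borel_measurable_const m2]])
        (simp only: nn_integral_cmult[OF m1] nn_integral_cmult[OF m2])
  qed
  also have "\<dots> \<le> ennreal (L\<^sup>2) * (\<integral>\<^sup>+z. cell_spread t (fst (z 0)) \<partial>?P) + ennreal (F\<^sup>2 + 2 * \<sigma>\<^sup>2) * ennreal (size1 t / (n + 1))"
    by (intro add_left_mono mult_left_mono nn_integral_inverse_card_same_cell_le \<nu> sets zero_le)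
  finally show ?thesis .
qed

text \<open>h(X) is measurable for the algebra generated by X and can be moved through the
  conditional expectation. This turns the conditional moments into the integral identities, under
  the law of one pair (X, Y), on which the averaging of the noise rests.\<close>

lemma
  fixes \<Omega> :: "'w measure" and X :: "'w \<Rightarrow> 'a::{second_countable_topology, t2_space}" and Y \<epsilon> :: "'w \<Rightarrow> real"
  assumes "prob_space \<Omega>"
    and X[measurable]: "X \<in> borel_measurable \<Omega>" and Y[measurable]: "Y \<in> borel_measurable \<Omega>"
    and g[measurable]: "g \<in> borel_measurable borel"
    and Y_eq: "\<And>\<omega>. \<omega> \<in> space \<Omega> \<Longrightarrow> Y \<omega> = g (X \<omega>) + \<epsilon> \<omega>"
    and \<epsilon>: "integrable \<Omega> \<epsilon>"
    and mean: "AE \<omega> in \<Omega>. real_cond_exp \<Omega> (generated_algebra \<Omega> X) \<epsilon> \<omega> = 0"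
    and var: "AE \<omega> in \<Omega>. cond_variance \<Omega> (generated_algebra \<Omega> X) \<epsilon> \<omega> \<le> ennreal (\<sigma>\<^sup>2)"
    and h[measurable]: "h \<in> borel_measurable borel"
  shows regression_noise_orthogonal: "(\<And>x. \<bar>h x\<bar> \<le> C) \<Longrightarrow>
      integrable (distr \<Omega> (borel \<Otimes>\<^sub>M borel) (\<lambda>\<omega>. (X \<omega>, Y \<omega>))) (\<lambda>z. h (fst z) * (snd z - g (fst z))) \<and>
      (\<integral>z. h (fst z) * (snd z - g (fst z)) \<partial>distr \<Omega> (borel \<Otimes>\<^sub>M borel) (\<lambda>\<omega>. (X \<omega>, Y \<omega>))) = 0" (is "PROP _ \<Longrightarrow> ?orth")
    and regression_noise_variance_le:
      "(\<integral>\<^sup>+z. ennreal ((h (fst z) * (snd z - g (fst z)))\<^sup>2) \<partial>distr \<Omega> (borel \<Otimes>\<^sub>M borel) (\<lambda>\<omega>. (X \<omega>, Y \<omega>)))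
       \<le> ennreal (\<sigma>\<^sup>2) * (\<integral>\<^sup>+z. ennreal ((h (fst z))\<^sup>2) \<partial>distr \<Omega> (borel \<Otimes>\<^sub>M borel) (\<lambda>\<omega>. (X \<omega>, Y \<omega>)))" (is ?var)
proof -
  interpret prob_space \<Omega> by fact
  let ?G = "generated_algebra \<Omega> X"
  have sub: "subalgebra \<Omega> ?G"
    using measurable_sets[OF X] by (auto simp: subalgebra_def generated_algebra_def sets_vimage_algebra2)
  interpret G: finite_measure_subalgebra \<Omega> ?G
    by standard (rule sub)
  have hX: "(\<lambda>\<omega>. h (X \<omega>)) \<in> borel_measurable ?G"
    unfolding generated_algebra_def by (rule measurable_compose[OF measurable_vimage_algebra1 h]) auto
  have [measurable]: "\<epsilon> \<in> borel_measurable \<Omega>" using \<epsilon> by auto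
  show ?orth if C: "\<And>x. \<bar>h x\<bar> \<le> C"
  proof -
    have int: "integrable \<Omega> (\<lambda>\<omega>. h (X \<omega>) * \<epsilon> \<omega>)"
    proof (rule Bochner_Integration.integrable_bound)
      show "integrable \<Omega> (\<lambda>\<omega>. C * \<epsilon> \<omega>)" using \<epsilon> by simp
      show "AE \<omega> in \<Omega>. norm (h (X \<omega>) * \<epsilon> \<omega>) \<le> norm (C * \<epsilon> \<omega>)"
        using C by (auto simp: abs_mult intro!: mult_right_mono order_trans[OF C abs_ge_self])
    qed measurable
    have "(\<integral>\<omega>. h (X \<omega>) * \<epsilon> \<omega> \<partial>\<Omega>) = (\<integral>\<omega>. h (X \<omega>) * real_cond_exp \<Omega> ?G \<epsilon> \<omega> \<partial>\<Omega>)"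
      using G.real_cond_exp_intg(2)[OF int hX] by simp
    also have "\<dots> = (\<integral>\<omega>. 0 \<partial>\<Omega>)"
      by (rule integral_cong_AE) (use mean in \<open>auto intro: borel_measurable_cond_exp2 elim: eventually_mono\<close>)
    finally have "(\<integral>\<omega>. h (X \<omega>) * \<epsilon> \<omega> \<partial>\<Omega>) = 0" by simp
    with int show ?thesis
      by (simp add: integrable_distr_eq integral_distr Y_eq cong: Bochner_Integration.integrable_cong Bochner_Integration.integral_cong)
  qed
  \<comment> \<open>Since the conditional mean vanishes almost everywhere, the noise may be replaced
    by its centred version, which is what \<open>cond_variance\<close> is built from.\<close>
  have "(\<integral>\<^sup>+\<omega>. ennreal ((h (X \<omega>) * \<epsilon> \<omega>)\<^sup>2) \<partial>\<Omega>)
    = (\<integral>\<^sup>+\<omega>. ennreal ((h (X \<omega>))\<^sup>2) * ennreal ((\<epsilon> \<omega> - real_cond_exp \<Omega> ?G \<epsilon> \<omega>)\<^sup>2) \<partial>\<Omega>)"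
    using mean by (intro nn_integral_cong_AE, eventually_elim) (simp add: power_mult_distrib ennreal_mult)
  also have "\<dots> = (\<integral>\<^sup>+\<omega>. ennreal ((h (X \<omega>))\<^sup>2) * cond_variance \<Omega> ?G \<epsilon> \<omega> \<partial>\<Omega>)"
    unfolding cond_variance_def
  proof (rule G.nn_cond_exp_intg[symmetric])
    show "(\<lambda>\<omega>. ennreal ((h (X \<omega>))\<^sup>2)) \<in> borel_measurable ?G"
      using hX by measurable
    show "(\<lambda>\<omega>. ennreal ((\<epsilon> \<omega> - real_cond_exp \<Omega> ?G \<epsilon> \<omega>)\<^sup>2)) \<in> borel_measurable \<Omega>"
      using borel_measurable_cond_exp2 by measurable
  qed
  also have "\<dots> \<le> (\<integral>\<^sup>+\<omega>. ennreal ((h (X \<omega>))\<^sup>2) * ennreal (\<sigma>\<^sup>2) \<partial>\<Omega>)"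
    using var by (intro nn_integral_mono_AE, eventually_elim) (rule mult_left_mono, auto)
  also have "\<dots> = ennreal (\<sigma>\<^sup>2) * (\<integral>\<^sup>+\<omega>. ennreal ((h (X \<omega>))\<^sup>2) \<partial>\<Omega>)"
    by (subst nn_integral_multc) (auto simp: mult.commute)
  finally show ?var
    by (simp add: nn_integral_distr Y_eq cong: nn_integral_cong)
qed

text \<open>A quotient of finite sums is visibly measurable, and 0/0 = 0 absorbs the case of an
  empty cell.\<close>

lemma tree_estimate_eq:
  "tree_estimate n D t x =
    (\<Sum>i<n. of_bool (x \<in> cbox 0 1 \<and> fst (D i) \<in> cbox 0 1 \<and> same_cell t x (fst (D i))) * snd (D i)) /
    (\<Sum>i<n. of_bool (x \<in> cbox 0 1 \<and> fst (D i) \<in> cbox 0 1 \<and> same_cell t x (fst (D i))))"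
proof -
  let ?Q = "\<lambda>i. x \<in> cbox 0 1 \<and> fst (D i) \<in> cbox 0 1 \<and> same_cell t x (fst (D i))"
  have I: "{i. i < n \<and> ?Q i} = {..<n} \<inter> {i. ?Q i}" by auto
  show ?thesis
    unfolding tree_estimate_def ex_leaf_cell_iff_same_cell I Let_def
    by (cases "{..<n} \<inter> {i. ?Q i} = {}") (simp_all add: sum.inter_restrict mult.commute if_distrib cong: if_cong)
qed

lemma measurable_tree_estimate [measurable (raw)]:
  fixes X :: "'b \<Rightarrow> real^'d::finite"
  assumes [measurable]: "\<And>i. i < n \<Longrightarrow> D i \<in> N \<rightarrow>\<^sub>M borel \<Otimes>\<^sub>M borel" "t \<in> N \<rightarrow>\<^sub>M split_tree_space" "X \<in> borel_measurable N"
  shows "(\<lambda>p. tree_estimate n (\<lambda>i. D i p) (t p) (X p)) \<in> borel_measurable N"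
  unfolding tree_estimate_eq by measurable

text \<open>A single tree suffices because the forest error is bounded by an average of tree errors.
  Independence inside the data gives the product over {..n}; independence of the two families gives
  the outer product.\<close>

lemma joint_distr_tree_sample:
  fixes Z :: "'w \<Rightarrow> (real^'d::finite) \<times> real"
  assumes "prob_space \<Omega>" and sample: "mondrian_forest_sample \<Omega> Z n K \<Lambda> D M" and k: "k < K"
  shows "distr \<Omega> ((\<Pi>\<^sub>M i\<in>{..n}. borel \<Otimes>\<^sub>M borel) \<Otimes>\<^sub>M split_tree_space) (\<lambda>\<omega>. (\<lambda>i\<in>{..n}. case_nat Z D i \<omega>, M k \<omega>))
    = (\<Pi>\<^sub>M i\<in>{..n}. distr \<Omega> (borel \<Otimes>\<^sub>M borel) Z) \<Otimes>\<^sub>M mondrian_process \<Lambda> (0, 1)"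
    and "(\<lambda>\<omega>. \<lambda>i\<in>{..n}. case_nat Z D i \<omega>) \<in> \<Omega> \<rightarrow>\<^sub>M (\<Pi>\<^sub>M i\<in>{..n}. borel \<Otimes>\<^sub>M borel)"
    and "M k \<in> \<Omega> \<rightarrow>\<^sub>M split_tree_space"
proof -
  interpret prob_space \<Omega> by fact
  let ?B = "borel \<Otimes>\<^sub>M borel :: ((real^'d) \<times> real) measure" and ?T = "split_tree_space :: 'd split_tree measure"
  let ?U = "\<lambda>\<omega>. \<lambda>i\<in>{..n}. case_nat Z D i \<omega>" and ?V = "\<lambda>\<omega>. \<lambda>k\<in>{..<K}. M k \<omega>"
  have iU: "indep_vars (\<lambda>_. ?B) (case_nat Z D) {..n}"
    and D: "\<And>i. i < n \<Longrightarrow> distr \<Omega> ?B (D i) = distr \<Omega> ?B Z"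
    and iM: "indep_vars (\<lambda>_. ?T) M {..<K}"
    and MP: "distr \<Omega> ?T (M k) = mondrian_process \<Lambda> (0, 1)"
    and ind: "indep_set (sets (vimage_algebra (space \<Omega>) ?U (\<Pi>\<^sub>M i\<in>{..n}. ?B)))
      (sets (vimage_algebra (space \<Omega>) ?V (\<Pi>\<^sub>M k\<in>{..<K}. ?T)))"
    using sample k by (auto simp: mondrian_forest_sample_def)
  have rv: "random_variable ?B (case_nat Z D i)" if "i \<in> {..n}" for i
    using iU that unfolding indep_vars_def2 by blast
  have rM: "random_variable ?T (M k)" if "k < K" for k
    using iM that unfolding indep_vars_def2 by blast
  show U: "?U \<in> \<Omega> \<rightarrow>\<^sub>M (\<Pi>\<^sub>M i\<in>{..n}. ?B)" by (intro measurable_restrict rv)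
  show Mk: "M k \<in> \<Omega> \<rightarrow>\<^sub>M ?T" by (rule rM[OF k])
  have V: "?V \<in> \<Omega> \<rightarrow>\<^sub>M (\<Pi>\<^sub>M k\<in>{..<K}. ?T)" by (intro measurable_restrict rM) simp
  have "distr \<Omega> (\<Pi>\<^sub>M i\<in>{..n}. ?B) ?U = (\<Pi>\<^sub>M i\<in>{..n}. distr \<Omega> ?B (case_nat Z D i))"
    using indep_vars_iff_distr_eq_PiM'[where I="{..n}" and M'="\<lambda>_. ?B" and X="case_nat Z D"] iU rv by simp
  also have "\<dots> = (\<Pi>\<^sub>M i\<in>{..n}. distr \<Omega> ?B Z)"
    by (intro PiM_cong) (auto split: nat.split simp: D)
  finally have dU: "distr \<Omega> (\<Pi>\<^sub>M i\<in>{..n}. ?B) ?U = (\<Pi>\<^sub>M i\<in>{..n}. distr \<Omega> ?B Z)" .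
  \<comment> \<open>The events of one tree are events of the whole forest, so independence from the
    data is inherited.\<close>
  have "sigma_sets (space \<Omega>) {M k -` A \<inter> space \<Omega> |A. A \<in> sets ?T}
    \<subseteq> sets (vimage_algebra (space \<Omega>) ?V (\<Pi>\<^sub>M k\<in>{..<K}. ?T))"
  proof -
    let ?A = "vimage_algebra (space \<Omega>) ?V (\<Pi>\<^sub>M k\<in>{..<K}. ?T)"
    have "(\<lambda>\<omega>. ?V \<omega> k) \<in> ?A \<rightarrow>\<^sub>M ?T"
    proof (rule measurable_compose[OF measurable_vimage_algebra1 measurable_component_singleton])
      show "?V \<in> space \<Omega> \<rightarrow> space (\<Pi>\<^sub>M k\<in>{..<K}. ?T)" using measurable_space[OF V] by blast
    qed (use k in simp)
    then have "M k \<in> ?A \<rightarrow>\<^sub>M ?T" using k by simp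
    from measurable_sets[OF this] have "{M k -` A \<inter> space \<Omega> |A. A \<in> sets ?T} \<subseteq> sets ?A" by auto
    then show ?thesis using sets.sigma_sets_subset[of _ ?A] by simp
  qed
  then have "indep_set (sigma_sets (space \<Omega>) {?U -` A \<inter> space \<Omega> |A. A \<in> sets (\<Pi>\<^sub>M i\<in>{..n}. ?B)})
      (sigma_sets (space \<Omega>) {M k -` A \<inter> space \<Omega> |A. A \<in> sets ?T})"
    using ind unfolding indep_sets2_eq sets_vimage_algebra[of _ ?U] by blast
  then have mult: "prob ((?U -` A \<inter> space \<Omega>) \<inter> (M k -` B \<inter> space \<Omega>)) = prob (?U -` A \<inter> space \<Omega>) * prob (M k -` B \<inter> space \<Omega>)"
    if "A \<in> sets (\<Pi>\<^sub>M i\<in>{..n}. ?B)" "B \<in> sets ?T" for A B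
    using that unfolding indep_sets2_eq by blast
  show "distr \<Omega> ((\<Pi>\<^sub>M i\<in>{..n}. ?B) \<Otimes>\<^sub>M ?T) (\<lambda>\<omega>. (?U \<omega>, M k \<omega>))
    = (\<Pi>\<^sub>M i\<in>{..n}. distr \<Omega> ?B Z) \<Otimes>\<^sub>M mondrian_process \<Lambda> (0, 1)"
    unfolding dU[symmetric] MP[symmetric]
  proof (rule pair_measure_eqI[symmetric])
    show "sigma_finite_measure (distr \<Omega> (\<Pi>\<^sub>M i\<in>{..n}. ?B) ?U)" "sigma_finite_measure (distr \<Omega> ?T (M k))"
      using prob_space_distr[OF U] prob_space_distr[OF Mk]
      by (auto intro: prob_space_imp_sigma_finite)
    fix A B assume "A \<in> sets (distr \<Omega> (\<Pi>\<^sub>M i\<in>{..n}. ?B) ?U)" "B \<in> sets (distr \<Omega> ?T (M k))"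
    then have A: "A \<in> sets (\<Pi>\<^sub>M i\<in>{..n}. ?B)" and B: "B \<in> sets ?T" by auto
    have "emeasure (distr \<Omega> ((\<Pi>\<^sub>M i\<in>{..n}. ?B) \<Otimes>\<^sub>M ?T) (\<lambda>\<omega>. (?U \<omega>, M k \<omega>))) (A \<times> B)
      = emeasure \<Omega> ((?U -` A \<inter> space \<Omega>) \<inter> (M k -` B \<inter> space \<Omega>))"
      using A B by (subst emeasure_distr[OF measurable_Pair[OF U Mk]]) (auto intro!: arg_cong[of _ _ "emeasure \<Omega>"])
    also have "\<dots> = emeasure \<Omega> (?U -` A \<inter> space \<Omega>) * emeasure \<Omega> (M k -` B \<inter> space \<Omega>)"
      unfolding emeasure_eq_measure mult[OF A B] by (simp add: ennreal_mult)
    finally show "emeasure (distr \<Omega> (\<Pi>\<^sub>M i\<in>{..n}. ?B) ?U) A * emeasure (distr \<Omega> ?T (M k)) B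
      = emeasure (distr \<Omega> ((\<Pi>\<^sub>M i\<in>{..n}. ?B) \<Otimes>\<^sub>M ?T) (\<lambda>\<omega>. (?U \<omega>, M k \<omega>))) (A \<times> B)"
      using A B by (simp add: emeasure_distr[OF U] emeasure_distr[OF Mk])
  qed simp
qed

lemma measurable_mondrian_forest_sample:
  assumes "prob_space \<Omega>" "mondrian_forest_sample \<Omega> Z n K \<Lambda> D M" "i < n"
  shows "D i \<in> \<Omega> \<rightarrow>\<^sub>M borel \<Otimes>\<^sub>M borel"
proof -
  have "case_nat Z D (Suc i) \<in> \<Omega> \<rightarrow>\<^sub>M borel \<Otimes>\<^sub>M borel"
    using assms unfolding mondrian_forest_sample_def prob_space.indep_vars_def2[OF assms(1)]
    by (metis Suc_leI atMost_iff)
  then show ?thesis by simp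
qed

text \<open>The index shift: observation i becomes coordinate i + 1 and the query point coordinate
  0. As all points lie in the cube, the membership tests disappear.\<close>

lemma tree_estimate_eq_cell_weight:
  assumes x: "x \<in> cbox 0 1" and D: "\<And>i. i < n \<Longrightarrow> fst (D i) \<in> cbox 0 1"
    and U: "fst (U 0) = x" "\<And>i. i < n \<Longrightarrow> U (Suc i) = D i"
  shows "tree_estimate n D t x = (\<Sum>i\<in>{1..n}. cell_weight n t (\<lambda>k. fst (U k)) i * snd (U i))"
proof -
  let ?s = "\<lambda>i. of_bool (same_cell t x (fst (D i))) :: real"
  have "real (card {k\<in>{1..n}. same_cell t x (fst (U k))}) = (\<Sum>k\<in>{1..n}. of_bool (same_cell t x (fst (U k))))"
    by (simp only: card_Collect_eq_sum_of_bool[OF finite_atLeastAtMost] of_nat_sum of_nat_of_bool)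
  also have "\<dots> = (\<Sum>i<n. of_bool (same_cell t x (fst (U (Suc i)))))"
    unfolding One_nat_def by (rule sum.atLeast1_atMost_eq)
  also have "\<dots> = (\<Sum>i<n. ?s i)" using U(2) by (intro sum.cong) auto
  finally have card: "real (card {k\<in>{1..n}. same_cell t x (fst (U k))}) = (\<Sum>i<n. ?s i)" .
  have "(\<Sum>i\<in>{1..n}. cell_weight n t (\<lambda>k. fst (U k)) i * snd (U i))
    = (\<Sum>i<n. cell_weight n t (\<lambda>k. fst (U k)) (Suc i) * snd (U (Suc i)))"
    unfolding One_nat_def by (rule sum.atLeast1_atMost_eq)
  also have "\<dots> = (\<Sum>i<n. ?s i * snd (D i) / (\<Sum>i<n. ?s i))"
    unfolding cell_weight_def U(1) card using U(2) by (intro sum.cong) auto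
  also have "\<dots> = (\<Sum>i<n. ?s i * snd (D i)) / (\<Sum>i<n. ?s i)"
    by (rule sum_divide_distrib[symmetric])
  also have "\<dots> = tree_estimate n D t x"
    unfolding tree_estimate_eq using x D by (intro arg_cong2[of _ _ _ _ "(/)"] sum.cong) auto
  finally show ?thesis ..
qed

text \<open>Noise and exchangeability are treated with the tree fixed, the cell size with the query
  point fixed. The product law of data and tree allows either order of integration.\<close>

lemma nn_integral_tree_error_le:
  fixes \<Omega> :: "'w measure" and Z :: "'w \<Rightarrow> (real^'d::finite) \<times> real" and g :: "real^'d \<Rightarrow> real" and n :: nat
  defines "\<nu> \<equiv> distr \<Omega> (borel \<Otimes>\<^sub>M borel) Z"
  assumes \<Omega>: "prob_space \<Omega>" and sample: "mondrian_forest_sample \<Omega> Z n K \<Lambda> D M" and k: "k < K" and \<Lambda>: "0 < \<Lambda>"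
    and Z[measurable]: "Z \<in> \<Omega> \<rightarrow>\<^sub>M borel \<Otimes>\<^sub>M borel"
    and Z_box: "\<And>\<omega>. \<omega> \<in> space \<Omega> \<Longrightarrow> fst (Z \<omega>) \<in> cbox 0 1"
    and g[measurable]: "g \<in> borel_measurable borel"
    and mean: "\<And>h C. h \<in> borel_measurable borel \<Longrightarrow> (\<And>x. \<bar>h x\<bar> \<le> C) \<Longrightarrow>
      integrable \<nu> (\<lambda>z. h (fst z) * (snd z - g (fst z))) \<and> (\<integral>z. h (fst z) * (snd z - g (fst z)) \<partial>\<nu>) = 0"
    and var: "\<And>h. h \<in> borel_measurable borel \<Longrightarrow>
      (\<integral>\<^sup>+z. ennreal ((h (fst z) * (snd z - g (fst z)))\<^sup>2) \<partial>\<nu>) \<le> ennreal (\<sigma>\<^sup>2) * (\<integral>\<^sup>+z. ennreal ((h (fst z))\<^sup>2) \<partial>\<nu>)"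
    and F: "\<And>x. \<bar>g x\<bar> \<le> F" and L: "L-lipschitz_on (cbox 0 1) g"
  shows "(\<integral>\<^sup>+\<omega>. ennreal ((tree_estimate n (\<lambda>i. D i \<omega>) (M k \<omega>) (fst (Z \<omega>)) - g (fst (Z \<omega>)))\<^sup>2) \<partial>\<Omega>)
    \<le> ennreal (L\<^sup>2 * (4 * CARD('d) / \<Lambda>\<^sup>2) + (F\<^sup>2 + 2 * \<sigma>\<^sup>2) * ((1 + \<Lambda>) ^ CARD('d) / (n + 1)))"
proof -
  interpret \<Omega>: prob_space \<Omega> by fact
  let ?B = "borel \<Otimes>\<^sub>M borel :: ((real^'d) \<times> real) measure" and ?T = "split_tree_space :: 'd split_tree measure"
  let ?P = "\<Pi>\<^sub>M i\<in>{..n}. \<nu>" and ?M = "mondrian_process \<Lambda> (0, 1) :: 'd split_tree measure"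
  let ?U = "\<lambda>\<omega>. \<lambda>i\<in>{..n}. case_nat Z D i \<omega>"
  note joint = joint_distr_tree_sample[OF \<Omega> sample k]
  have sets\<nu>[measurable_cong]: "sets \<nu> = sets ?B" by (simp add: \<nu>_def)
  have \<nu>: "prob_space \<nu>" unfolding \<nu>_def by (rule \<Omega>.prob_space_distr) fact
  interpret Q: prob_space ?P by (intro prob_space_PiM \<nu>)
  have setsM[measurable_cong]: "sets ?M = sets ?T" and pM: "prob_space ?M"
    by (rule mondrian_process_well_defined; use \<Lambda> in \<open>auto simp: less_eq_vec_def\<close>)+
  interpret M: prob_space ?M by fact
  interpret pair_sigma_finite ?P ?M ..
  have setsP: "sets ?P = sets (\<Pi>\<^sub>M i\<in>{..n}. ?B)" by (intro sets_PiM_cong) (auto simp: sets\<nu>)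
  have supp: "AE z in \<nu>. fst z \<in> cbox 0 1"
    unfolding \<nu>_def by (subst AE_distr_iff) (use Z_box in \<open>auto intro!: AE_I2\<close>)
  let ?H = "\<lambda>p. ennreal (((\<Sum>i\<in>{1..n}. cell_weight n (snd p) (\<lambda>k. fst (fst p k)) i * snd (fst p i)) - g (fst (fst p 0)))\<^sup>2)"
  have H: "?H \<in> borel_measurable (?P \<Otimes>\<^sub>M ?M)"
  proof -
    have c[measurable]: "(\<lambda>p. fst p k) \<in> ?P \<Otimes>\<^sub>M ?M \<rightarrow>\<^sub>M ?B" if "k \<le> n" for k
      using measurable_compose[OF measurable_fst[of ?P ?M] measurable_component_singleton[of k "{..n}" "\<lambda>_. \<nu>"]] that
      by (simp cong: measurable_cong_sets add: sets\<nu>)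
    have [measurable]: "(\<lambda>p. cell_weight n (snd p) (\<lambda>k. fst (fst p k)) i) \<in> borel_measurable (?P \<Otimes>\<^sub>M ?M)" if "i \<le> n" for i
      using that by (intro measurable_cell_weight measurable_compose[OF c measurable_fst]) measurable
    show ?thesis by measurable
  qed
  have "(\<lambda>p. fst (fst p 0)) \<in> borel_measurable (?P \<Otimes>\<^sub>M ?M)"
    using measurable_compose[OF measurable_fst[of ?P ?M] measurable_component_singleton[of 0 "{..n}" "\<lambda>_. \<nu>"]]
    by (auto cong: measurable_cong_sets simp: sets\<nu>)
  then have cs: "(\<lambda>p. cell_spread (snd p) (fst (fst p 0))) \<in> borel_measurable (?P \<Otimes>\<^sub>M ?M)"
    by (rule measurable_cell_spread[rotated]) measurable
  have [measurable]: "(\<lambda>\<omega>. (?U \<omega>, M k \<omega>)) \<in> \<Omega> \<rightarrow>\<^sub>M (\<Pi>\<^sub>M i\<in>{..n}. ?B) \<Otimes>\<^sub>M ?T"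
    using joint(2,3) by (rule measurable_Pair)
  \<comment> \<open>Only the query point lies in the cube surely; the observations inherit this
    almost surely from their law.\<close>
  have box: "AE \<omega> in \<Omega>. \<forall>i\<in>{..<n}. fst (D i \<omega>) \<in> cbox 0 1"
  proof (rule AE_finite_allI)
    fix i assume i: "i \<in> {..<n}"
    have [measurable]: "D i \<in> \<Omega> \<rightarrow>\<^sub>M ?B"
      using measurable_mondrian_forest_sample[OF \<Omega> sample] i by simp
    have "AE z in distr \<Omega> ?B (D i). fst z \<in> cbox 0 1"
    proof -
      have "distr \<Omega> ?B (D i) = \<nu>" using sample i by (simp add: mondrian_forest_sample_def \<nu>_def)
      with supp show ?thesis by (simp only:)
    qed
    then show "AE \<omega> in \<Omega>. fst (D i \<omega>) \<in> cbox 0 1"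
      by (subst (asm) AE_distr_iff) auto
  qed simp
  have "(\<integral>\<^sup>+\<omega>. ennreal ((tree_estimate n (\<lambda>i. D i \<omega>) (M k \<omega>) (fst (Z \<omega>)) - g (fst (Z \<omega>)))\<^sup>2) \<partial>\<Omega>)
    = (\<integral>\<^sup>+\<omega>. ?H (?U \<omega>, M k \<omega>) \<partial>\<Omega>)"
  proof (rule nn_integral_cong_AE, use box AE_space in eventually_elim)
    fix \<omega> assume "\<forall>i\<in>{..<n}. fst (D i \<omega>) \<in> cbox 0 1" "\<omega> \<in> space \<Omega>"
    then have "tree_estimate n (\<lambda>i. D i \<omega>) (M k \<omega>) (fst (Z \<omega>)) =
      (\<Sum>i\<in>{1..n}. cell_weight n (M k \<omega>) (\<lambda>k. fst (?U \<omega> k)) i * snd (?U \<omega> i))"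
      using Z_box by (intro tree_estimate_eq_cell_weight) auto
    then show "ennreal ((tree_estimate n (\<lambda>i. D i \<omega>) (M k \<omega>) (fst (Z \<omega>)) - g (fst (Z \<omega>)))\<^sup>2) = ?H (?U \<omega>, M k \<omega>)"
      by simp
  qed
  also have "\<dots> = (\<integral>\<^sup>+p. ?H p \<partial>distr \<Omega> ((\<Pi>\<^sub>M i\<in>{..n}. ?B) \<Otimes>\<^sub>M ?T) (\<lambda>\<omega>. (?U \<omega>, M k \<omega>)))"
    using H by (subst nn_integral_distr) (auto cong: measurable_cong_sets sets_pair_measure_cong simp: setsP setsM)
  also have "\<dots> = (\<integral>\<^sup>+p. ?H p \<partial>(?P \<Otimes>\<^sub>M ?M))"
    unfolding joint(1) \<nu>_def[symmetric] ..
  also have "\<dots> = (\<integral>\<^sup>+t. \<integral>\<^sup>+z. ?H (z, t) \<partial>?P \<partial>?M)"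
    by (rule nn_integral_snd[symmetric, OF H])
  also have "\<dots> \<le> (\<integral>\<^sup>+t. ennreal (L\<^sup>2) * (\<integral>\<^sup>+z. cell_spread t (fst (z 0)) \<partial>?P)
      + ennreal (F\<^sup>2 + 2 * \<sigma>\<^sup>2) * ennreal (size1 t / (n + 1)) \<partial>?M)"
    unfolding fst_conv snd_conv
    by (intro nn_integral_mono nn_integral_weighted_error_le \<nu> sets\<nu> g mean var supp F L)
  also have "\<dots> = ennreal (L\<^sup>2) * (\<integral>\<^sup>+t. \<integral>\<^sup>+z. cell_spread t (fst (z 0)) \<partial>?P \<partial>?M)
      + ennreal (F\<^sup>2 + 2 * \<sigma>\<^sup>2) * (\<integral>\<^sup>+t. ennreal (size1 t / (n + 1)) \<partial>?M)"
  proof -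
    have m1: "(\<lambda>t. \<integral>\<^sup>+z. cell_spread t (fst (z 0)) \<partial>?P) \<in> borel_measurable ?M"
      using Q.borel_measurable_nn_integral_fst[OF measurable_pair_swap[OF cs]] by simp
    have m2: "(\<lambda>t. ennreal (size1 t / (n + 1))) \<in> borel_measurable ?M" by measurable
    show ?thesis
      by (subst nn_integral_add[OF borel_measurable_times_ennreal[OF borel_measurable_const m1]
            borel_measurable_times_ennreal[OF borel_measurable_const m2]])
        (simp only: nn_integral_cmult[OF m1] nn_integral_cmult[OF m2])
  qed
  also have "\<dots> \<le> ennreal (L\<^sup>2) * ennreal (4 * CARD('d) / \<Lambda>\<^sup>2)
      + ennreal (F\<^sup>2 + 2 * \<sigma>\<^sup>2) * ennreal ((1 + \<Lambda>) ^ CARD('d) / (n + 1))"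
  proof (intro add_mono mult_left_mono zero_le)
    \<comment> \<open>The order is swapped because the mean cell size is bounded for each fixed
      query point.\<close>
    have "(\<integral>\<^sup>+t. \<integral>\<^sup>+z. cell_spread t (fst (z 0)) \<partial>?P \<partial>?M) = (\<integral>\<^sup>+z. \<integral>\<^sup>+t. cell_spread t (fst (z 0)) \<partial>?M \<partial>?P)"
      using cs by (intro Fubini') (simp add: case_prod_beta')
    also have "\<dots> \<le> (\<integral>\<^sup>+z. ennreal (4 * CARD('d) / \<Lambda>\<^sup>2) \<partial>?P)"
    proof (rule nn_integral_mono_AE)
      have "AE z in ?P. fst (z 0) \<in> cbox 0 1" by (intro AE_PiM_component \<nu> supp) auto
      then show "AE z in ?P. (\<integral>\<^sup>+t. cell_spread t (fst (z 0)) \<partial>?M) \<le> ennreal (4 * CARD('d) / \<Lambda>\<^sup>2)"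
        by eventually_elim (rule nn_integral_cell_spread_le[OF \<Lambda>])
    qed
    also have "\<dots> = ennreal (4 * CARD('d) / \<Lambda>\<^sup>2)" by (simp add: Q.emeasure_space_1)
    finally show "(\<integral>\<^sup>+t. \<integral>\<^sup>+z. cell_spread t (fst (z 0)) \<partial>?P \<partial>?M) \<le> ennreal (4 * CARD('d) / \<Lambda>\<^sup>2)" .
    have "(\<integral>\<^sup>+t. ennreal (size1 t / (n + 1)) \<partial>?M) = (\<integral>\<^sup>+t. ennreal (1 / (n + 1)) * of_nat (size1 t) \<partial>?M)"
      by (intro nn_integral_cong) (simp add: ennreal_of_nat_eq_real_of_nat flip: ennreal_mult)
    also have "\<dots> = ennreal (1 / (n + 1)) * (\<integral>\<^sup>+t. of_nat (size1 t) \<partial>?M)"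
      by (rule nn_integral_cmult) measurable
    also have "\<dots> \<le> ennreal (1 / (n + 1)) * ennreal ((1 + \<Lambda>) ^ CARD('d))"
      using nn_integral_size1_mondrian_process_le[of "(0, 1) :: 'd box" \<Lambda>] \<Lambda>
      by (intro mult_left_mono) (auto simp: less_eq_vec_def)
    also have "\<dots> = ennreal ((1 + \<Lambda>) ^ CARD('d) / (n + 1))"
      using \<Lambda> by (subst ennreal_mult[symmetric]) auto
    finally show "(\<integral>\<^sup>+t. ennreal (size1 t / (n + 1)) \<partial>?M) \<le> ennreal ((1 + \<Lambda>) ^ CARD('d) / (n + 1))" .
  qed
  also have "\<dots> = ennreal (L\<^sup>2 * (4 * CARD('d) / \<Lambda>\<^sup>2) + (F\<^sup>2 + 2 * \<sigma>\<^sup>2) * ((1 + \<Lambda>) ^ CARD('d) / (n + 1)))"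
  proof -
    have "0 \<le> L\<^sup>2" "0 \<le> 4 * CARD('d) / \<Lambda>\<^sup>2" "0 \<le> F\<^sup>2 + 2 * \<sigma>\<^sup>2" "0 \<le> (1 + \<Lambda>) ^ CARD('d) / (n + 1)"
      using \<Lambda> by auto
    then show ?thesis by (metis ennreal_mult ennreal_plus mult_nonneg_nonneg)
  qed
  finally show ?thesis .
qed

section \<open>Risk of the forest\<close>

text \<open>The forest error is the mean of the K tree errors; Cauchy-Schwarz costs a factor K,
  which cancels one of the two in K^2.\<close>

lemma forest_error_le:
  assumes "1 \<le> K"
  shows "(forest_estimate n K D M x - y)\<^sup>2 \<le> (\<Sum>k<K. (tree_estimate n D (M k) x - y)\<^sup>2) / K"
proof -
  have "forest_estimate n K D M x - y = (\<Sum>k<K. tree_estimate n D (M k) x - y) / K"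
    using assms by (simp add: forest_estimate_def sum_subtractf field_simps)
  then have "(forest_estimate n K D M x - y)\<^sup>2 = (\<Sum>k<K. tree_estimate n D (M k) x - y)\<^sup>2 / (real K)\<^sup>2"
    by (simp add: power_divide)
  also have "\<dots> \<le> ((\<Sum>k<K. (tree_estimate n D (M k) x - y)\<^sup>2) * card {..<K}) / (real K)\<^sup>2"
    by (intro divide_right_mono sum_squared_le_sum_of_squares) simp
  also have "\<dots> = (\<Sum>k<K. (tree_estimate n D (M k) x - y)\<^sup>2) / K"
    using assms by (simp add: power2_eq_square)
  finally show ?thesis .
qed

lemma forest_risk_le:
  fixes \<Omega> :: "'w measure" and X :: "'w \<Rightarrow> real^'d::finite" and Y \<epsilon> :: "'w \<Rightarrow> real" and f :: "real^'d \<Rightarrow> real" and n K :: nat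
  assumes \<Omega>: "prob_space \<Omega>"
    and X[measurable]: "X \<in> borel_measurable \<Omega>"
    and X_box: "\<And>\<omega>. \<omega> \<in> space \<Omega> \<Longrightarrow> X \<omega> \<in> cbox 0 1"
    and L: "L-lipschitz_on (cbox 0 1) f"
    and Y: "\<And>\<omega>. \<omega> \<in> space \<Omega> \<Longrightarrow> Y \<omega> = f (X \<omega>) + \<epsilon> \<omega>"
    and \<epsilon>: "integrable \<Omega> \<epsilon>"
    and mean: "AE \<omega> in \<Omega>. real_cond_exp \<Omega> (generated_algebra \<Omega> X) \<epsilon> \<omega> = 0"
    and var: "AE \<omega> in \<Omega>. cond_variance \<Omega> (generated_algebra \<Omega> X) \<epsilon> \<omega> \<le> ennreal (\<sigma>\<^sup>2)"
    and K: "1 \<le> K" and \<Lambda>: "0 < \<Lambda>"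
    and sample: "mondrian_forest_sample \<Omega> (\<lambda>\<omega>. (X \<omega>, Y \<omega>)) n K \<Lambda> D M"
  defines "F \<equiv> SUP x\<in>cbox 0 1. \<bar>f x\<bar>"
  shows "integrable \<Omega> (squared_error n K D M X f)"
    and "quadratic_risk \<Omega> n K D M X f
      \<le> L\<^sup>2 * (4 * CARD('d) / \<Lambda>\<^sup>2) + (F\<^sup>2 + 2 * \<sigma>\<^sup>2) * ((1 + \<Lambda>) ^ CARD('d) / (n + 1))"
proof -
  interpret prob_space \<Omega> by fact
  define B where "B = L\<^sup>2 * (4 * CARD('d) / \<Lambda>\<^sup>2) + (F\<^sup>2 + 2 * \<sigma>\<^sup>2) * ((1 + \<Lambda>) ^ CARD('d) / (n + 1))"
  have B0: "0 \<le> B" unfolding B_def using \<Lambda> by (intro add_nonneg_nonneg mult_nonneg_nonneg) auto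
  \<comment> \<open>f is controlled only on the cube. Its extension by zero is Borel measurable and
    bounded by F on the whole space.\<close>
  define g where "g = (\<lambda>x. indicator (cbox 0 1) x *\<^sub>R f x)"
  have cont: "continuous_on (cbox 0 1) f" by (rule lipschitz_on_continuous_on[OF L])
  have g[measurable]: "g \<in> borel_measurable borel"
    unfolding g_def by (rule borel_measurable_continuous_on_indicator[OF _ cont]) simp
  have gf: "g x = f x" if "x \<in> cbox 0 1" for x using that by (simp add: g_def)
  \<comment> \<open>A real supremum bounds its family only if the family is bounded above;
    compactness of the cube ensures this.\<close>
  have bdd: "bdd_above ((\<lambda>x. \<bar>f x\<bar>) ` cbox 0 1)"
    by (intro compact_imp_bounded[THEN bounded_imp_bdd_above] compact_continuous_image continuous_intros cont compact_cbox)
  have f_le: "\<bar>f x\<bar> \<le> F" if "x \<in> cbox 0 1" for x unfolding F_def by (rule cSUP_upper[OF that bdd])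
  have "0 \<le> F" using f_le[of 0] by (force simp: mem_box_cart)
  then have gF: "\<bar>g x\<bar> \<le> F" for x using f_le by (simp add: g_def indicator_def)
  have gL: "L-lipschitz_on (cbox 0 1) g"
    using L by (rule lipschitz_on_transform) (simp add: gf)
  have Yg: "Y \<omega> = g (X \<omega>) + \<epsilon> \<omega>" if "\<omega> \<in> space \<Omega>" for \<omega>
    using Y[OF that] gf[OF X_box[OF that]] by simp
  have Ym[measurable]: "Y \<in> borel_measurable \<Omega>"
    using borel_measurable_integrable[OF \<epsilon>] by (subst measurable_cong[OF Yg]) measurable
  let ?e = "\<lambda>k \<omega>. (tree_estimate n (\<lambda>i. D i \<omega>) (M k \<omega>) (X \<omega>) - g (X \<omega>))\<^sup>2"
  have em: "?e k \<in> borel_measurable \<Omega>" if "k < K" for k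
  proof -
    note [measurable] = measurable_mondrian_forest_sample[OF \<Omega> sample] joint_distr_tree_sample(3)[OF \<Omega> sample that]
    show ?thesis by measurable
  qed
  have tree: "(\<integral>\<^sup>+\<omega>. ennreal (?e k \<omega>) \<partial>\<Omega>) \<le> ennreal B" if "k < K" for k
  proof -
    let ?\<nu> = "distr \<Omega> (borel \<Otimes>\<^sub>M borel) (\<lambda>\<omega>. (X \<omega>, Y \<omega>))"
    have orth: "integrable ?\<nu> (\<lambda>z. h (fst z) * (snd z - g (fst z))) \<and> (\<integral>z. h (fst z) * (snd z - g (fst z)) \<partial>?\<nu>) = 0"
      if "h \<in> borel_measurable borel" "\<And>x. \<bar>h x\<bar> \<le> C" for h C
      by (rule regression_noise_orthogonal[where \<epsilon>=\<epsilon>]; fact)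
    have noise_var: "(\<integral>\<^sup>+z. ennreal ((h (fst z) * (snd z - g (fst z)))\<^sup>2) \<partial>?\<nu>) \<le> ennreal (\<sigma>\<^sup>2) * (\<integral>\<^sup>+z. ennreal ((h (fst z))\<^sup>2) \<partial>?\<nu>)"
      if "h \<in> borel_measurable borel" for h
      by (rule regression_noise_variance_le[where \<epsilon>=\<epsilon>]; fact)
    have "(\<integral>\<^sup>+\<omega>. ennreal ((tree_estimate n (\<lambda>i. D i \<omega>) (M k \<omega>) (fst (X \<omega>, Y \<omega>)) - g (fst (X \<omega>, Y \<omega>)))\<^sup>2) \<partial>\<Omega>) \<le> ennreal B"
      unfolding B_def
    proof (rule nn_integral_tree_error_le[OF \<Omega> sample that \<Lambda>])
      show "(\<lambda>\<omega>. (X \<omega>, Y \<omega>)) \<in> \<Omega> \<rightarrow>\<^sub>M borel \<Otimes>\<^sub>M borel" by measurable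
      show "fst (X \<omega>, Y \<omega>) \<in> cbox 0 1" if "\<omega> \<in> space \<Omega>" for \<omega> using X_box[OF that] by simp
    qed (fact g orth noise_var gF gL)+
    then show ?thesis by simp
  qed
  have se: "squared_error n K D M X f \<omega> \<le> (\<Sum>k<K. ?e k \<omega>) / K" if "\<omega> \<in> space \<Omega>" for \<omega>
    unfolding squared_error_def using forest_error_le[OF K] gf[OF X_box[OF that]] by simp
  have m: "squared_error n K D M X f \<in> borel_measurable \<Omega>"
  proof -
    note [measurable] = measurable_mondrian_forest_sample[OF \<Omega> sample] joint_distr_tree_sample(3)[OF \<Omega> sample]
    have "(\<lambda>\<omega>. ((\<Sum>k<K. tree_estimate n (\<lambda>i. D i \<omega>) (M k \<omega>) (X \<omega>)) / K - g (X \<omega>))\<^sup>2) \<in> borel_measurable \<Omega>"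
      by measurable
    then show ?thesis
      by (rule measurable_cong[THEN iffD2, rotated])
        (simp add: squared_error_def forest_estimate_def gf[OF X_box])
  qed
  have "(\<integral>\<^sup>+\<omega>. ennreal (squared_error n K D M X f \<omega>) \<partial>\<Omega>) \<le> (\<integral>\<^sup>+\<omega>. ennreal (1 / K) * (\<Sum>k<K. ennreal (?e k \<omega>)) \<partial>\<Omega>)"
    using se by (intro nn_integral_mono) (simp add: sum_nonneg ennreal_leI flip: ennreal_mult)
  also have "\<dots> = ennreal (1 / K) * (\<Sum>k<K. \<integral>\<^sup>+\<omega>. ennreal (?e k \<omega>) \<partial>\<Omega>)"
  proof -
    have em': "(\<lambda>\<omega>. ennreal (?e k \<omega>)) \<in> borel_measurable \<Omega>" if "k \<in> {..<K}" for k
      using em that by (intro measurable_compose[OF _ measurable_ennreal]) simp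
    show ?thesis
      by (simp only: nn_integral_cmult[OF borel_measurable_sum[OF em']] nn_integral_sum[OF em'])
  qed
  also have "\<dots> \<le> ennreal (1 / K) * (\<Sum>k<K. ennreal B)"
    by (intro mult_left_mono sum_mono tree) auto
  also have "\<dots> = ennreal B"
    using K B0 by (simp add: ennreal_of_nat_eq_real_of_nat flip: ennreal_mult)
  finally have le: "(\<integral>\<^sup>+\<omega>. ennreal (squared_error n K D M X f \<omega>) \<partial>\<Omega>) \<le> ennreal B" .
  \<comment> \<open>Finiteness of the extended integral gives integrability, so the real-valued risk
    is a genuine expectation and not the default value 0.\<close>
  show int: "integrable \<Omega> (squared_error n K D M X f)"
    using le by (intro integrableI_nonneg m) (auto simp: squared_error_def intro: le_less_trans)
  have "ennreal (quadratic_risk \<Omega> n K D M X f) = (\<integral>\<^sup>+\<omega>. ennreal (squared_error n K D M X f \<omega>) \<partial>\<Omega>)"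
    unfolding quadratic_risk_def by (rule nn_integral_eq_integral[symmetric, OF int]) (simp add: squared_error_def)
  then have "ennreal (quadratic_risk \<Omega> n K D M X f) \<le> ennreal B" using le by simp
  then show "quadratic_risk \<Omega> n K D M X f
      \<le> L\<^sup>2 * (4 * CARD('d) / \<Lambda>\<^sup>2) + (F\<^sup>2 + 2 * \<sigma>\<^sup>2) * ((1 + \<Lambda>) ^ CARD('d) / (n + 1))"
    using B0 by (simp add: B_def)
qed

theorem proposition4:
  fixes \<Omega> :: "'w measure"
    and X :: "'w \<Rightarrow> real^'d::finite"
    and Y \<epsilon> :: "'w \<Rightarrow> real"
    and f :: "real^'d \<Rightarrow> real"
    and L \<sigma> :: real
  assumes "prob_space \<Omega>"
    and "0 \<le> L" and "0 \<le> \<sigma>"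
    and "X \<in> borel_measurable \<Omega>"
    and "\<And>\<omega>. \<omega> \<in> space \<Omega> \<Longrightarrow> X \<omega> \<in> cbox 0 1"
    and "L-lipschitz_on (cbox 0 1) f"
    and "\<And>\<omega>. \<omega> \<in> space \<Omega> \<Longrightarrow> Y \<omega> = f (X \<omega>) + \<epsilon> \<omega>"
    and "integrable \<Omega> \<epsilon>"
    and "AE \<omega> in \<Omega>. real_cond_exp \<Omega> (generated_algebra \<Omega> X) \<epsilon> \<omega> = 0"
    and "AE \<omega> in \<Omega>. cond_variance \<Omega> (generated_algebra \<Omega> X) \<epsilon> \<omega> \<le> ennreal (\<sigma>\<^sup>2)"
  shows "(\<forall>n K \<Lambda> D M.
            1 \<le> n \<longrightarrow> 1 \<le> K \<longrightarrow> 0 < \<Lambda> \<longrightarrow>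
            mondrian_forest_sample \<Omega> (\<lambda>\<omega>. (X \<omega>, Y \<omega>)) n K \<Lambda> D M \<longrightarrow>
            integrable \<Omega> (squared_error n K D M X f) \<and>
            quadratic_risk \<Omega> n K D M X f
              \<le> 4 * CARD('d) * L\<^sup>2 / \<Lambda>\<^sup>2
                + (1 + exp 1 ^ CARD('d) * (1 + \<Lambda>) ^ CARD('d)) / n
                  * (2 * \<sigma>\<^sup>2 + 9 * (SUP x\<in>cbox 0 1. \<bar>f x\<bar>)\<^sup>2)) \<and>
         (\<forall>K D M.
            (\<forall>n\<ge>1. 1 \<le> K n \<and>
               mondrian_forest_sample \<Omega> (\<lambda>\<omega>. (X \<omega>, Y \<omega>)) n (K n)
                 (real n powr (1 / (CARD('d) + 2))) (D n) (M n)) \<longrightarrow>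
            (\<lambda>n. quadratic_risk \<Omega> n (K n) (D n) (M n) X f)
              \<in> O(\<lambda>n. real n powr (- 2 / (CARD('d) + 2))))"
proof (intro conjI allI impI)
  define F where "F = (SUP x\<in>cbox 0 1. \<bar>f x\<bar>)"
  let ?d = "CARD('d)"
  show bound: "quadratic_risk \<Omega> n K D M X f
              \<le> 4 * CARD('d) * L\<^sup>2 / \<Lambda>\<^sup>2
                + (1 + exp 1 ^ CARD('d) * (1 + \<Lambda>) ^ CARD('d)) / n
                  * (2 * \<sigma>\<^sup>2 + 9 * (SUP x\<in>cbox 0 1. \<bar>f x\<bar>)\<^sup>2)"
    and "integrable \<Omega> (squared_error n K D M X f)"
    if n: "1 \<le> n" and K: "1 \<le> K" and \<Lambda>: "0 < \<Lambda>"
      and sample: "mondrian_forest_sample \<Omega> (\<lambda>\<omega>. (X \<omega>, Y \<omega>)) n K \<Lambda> D M" for n K :: nat and \<Lambda> D M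
  proof -
    show "integrable \<Omega> (squared_error n K D M X f)" by (rule forest_risk_le(1)[where Y=Y and \<epsilon>=\<epsilon>]; fact)
    have risk: "quadratic_risk \<Omega> n K D M X f
      \<le> L\<^sup>2 * (4 * CARD('d) / \<Lambda>\<^sup>2) + (F\<^sup>2 + 2 * \<sigma>\<^sup>2) * ((1 + \<Lambda>) ^ CARD('d) / (n + 1))"
      unfolding F_def by (rule forest_risk_le(2)[where Y=Y and \<epsilon>=\<epsilon>]; fact)
    \<comment> \<open>The passage to the required constants uses n + 1 >= n and e^d >= 1 here, and
      F^2 <= 9 F^2 below.\<close>
    have "(1 + \<Lambda>) ^ ?d / real (n + 1) \<le> (1 + exp 1 ^ ?d * (1 + \<Lambda>) ^ ?d) / real n"
    proof (rule frac_le)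
      have "1 * (1 + \<Lambda>) ^ ?d \<le> exp 1 ^ ?d * (1 + \<Lambda>) ^ ?d"
        using \<Lambda> by (intro mult_right_mono one_le_power) auto
      then show "(1 + \<Lambda>) ^ ?d \<le> 1 + exp 1 ^ ?d * (1 + \<Lambda>) ^ ?d" by simp
    qed (use n \<Lambda> in auto)
    then have "(F\<^sup>2 + 2 * \<sigma>\<^sup>2) * ((1 + \<Lambda>) ^ ?d / real (n + 1)) \<le> (2 * \<sigma>\<^sup>2 + 9 * F\<^sup>2) * ((1 + exp 1 ^ ?d * (1 + \<Lambda>) ^ ?d) / real n)"
      using \<Lambda> by (intro mult_mono) auto
    then show "quadratic_risk \<Omega> n K D M X f
              \<le> 4 * CARD('d) * L\<^sup>2 / \<Lambda>\<^sup>2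
                + (1 + exp 1 ^ CARD('d) * (1 + \<Lambda>) ^ CARD('d)) / n
                  * (2 * \<sigma>\<^sup>2 + 9 * (SUP x\<in>cbox 0 1. \<bar>f x\<bar>)\<^sup>2)"
      using risk by (simp add: F_def[symmetric] mult.commute)
  qed
  fix K :: "nat \<Rightarrow> nat" and D M
  assume sample: "\<forall>n\<ge>1. 1 \<le> K n \<and>
               mondrian_forest_sample \<Omega> (\<lambda>\<omega>. (X \<omega>, Y \<omega>)) n (K n)
                 (real n powr (1 / (CARD('d) + 2))) (D n) (M n)"
  \<comment> \<open>The required bound with 1/\<Lambda>^2 replaced by r and 1 + e^d (1 +
    \<Lambda>)^d over n by (1 + e^d 2^d) r.\<close>
  define c where "c = 4 * ?d * L\<^sup>2 + (1 + exp 1 ^ ?d * 2 ^ ?d) * (2 * \<sigma>\<^sup>2 + 9 * F\<^sup>2)"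
  show "(\<lambda>n. quadratic_risk \<Omega> n (K n) (D n) (M n) X f) \<in> O(\<lambda>n. real n powr (- 2 / (CARD('d) + 2)))"
  proof (rule bigoI, rule eventually_sequentiallyI)
    fix n :: nat assume n: "1 \<le> n"
    \<comment> \<open>This lifetime balances the two terms: 1/\<Lambda>^2 and \<Lambda>^d/n are both
      equal to r.\<close>
    define \<Lambda> where "\<Lambda> = real n powr (1 / (?d + 2))"
    define r where "r = real n powr (- 2 / (?d + 2))"
    have \<Lambda>: "1 \<le> \<Lambda>" unfolding \<Lambda>_def using n by (intro ge_one_powr_ge_zero) auto
    have "\<Lambda>\<^sup>2 = real n powr (2 / (?d + 2))"
      using n by (simp add: \<Lambda>_def powr_power)
    then have sq: "1 / \<Lambda>\<^sup>2 = r" by (simp add: r_def powr_minus_divide)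
    have "\<Lambda> ^ ?d / n = real n powr (?d / (?d + 2)) / real n powr 1"
      using n by (simp add: \<Lambda>_def powr_power)
    also have "\<dots> = real n powr (?d / (?d + 2) - 1)" by (simp add: powr_diff)
    also have "real ?d / real (?d + 2) - 1 = - 2 / real (?d + 2)" by (simp add: field_simps)
    finally have pw: "\<Lambda> ^ ?d / n = r" by (simp add: r_def)
    have "0 \<le> quadratic_risk \<Omega> n (K n) (D n) (M n) X f"
      unfolding quadratic_risk_def by (intro integral_nonneg_AE) (simp add: squared_error_def)
    moreover have "quadratic_risk \<Omega> n (K n) (D n) (M n) X f \<le>
        4 * ?d * L\<^sup>2 / \<Lambda>\<^sup>2 + (1 + exp 1 ^ ?d * (1 + \<Lambda>) ^ ?d) / n * (2 * \<sigma>\<^sup>2 + 9 * F\<^sup>2)"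
      unfolding F_def using bound[of n "K n" \<Lambda> "D n" "M n"] sample n \<Lambda> by (auto simp: \<Lambda>_def)
    moreover have "(1 + exp 1 ^ ?d * (1 + \<Lambda>) ^ ?d) / n \<le> (1 + exp 1 ^ ?d * 2 ^ ?d) * r"
    proof -
      \<comment> \<open>Since n >= 1 gives \<Lambda> >= 1, both 1 + \<Lambda> <= 2 \<Lambda> and 1
        <= \<Lambda>^d hold, and the whole numerator becomes a multiple of \<Lambda>^d.\<close>
      have "(1 + \<Lambda>) ^ ?d \<le> (2 * \<Lambda>) ^ ?d" using \<Lambda> by (intro power_mono) auto
      then have "exp 1 ^ ?d * (1 + \<Lambda>) ^ ?d \<le> exp 1 ^ ?d * 2 ^ ?d * \<Lambda> ^ ?d"
        by (simp add: power_mult_distrib mult.assoc)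
      moreover have "1 \<le> \<Lambda> ^ ?d" using \<Lambda> by (rule one_le_power)
      ultimately have "1 + exp 1 ^ ?d * (1 + \<Lambda>) ^ ?d \<le> (1 + exp 1 ^ ?d * 2 ^ ?d) * \<Lambda> ^ ?d"
        unfolding distrib_right by linarith
      then have "(1 + exp 1 ^ ?d * (1 + \<Lambda>) ^ ?d) / n \<le> (1 + exp 1 ^ ?d * 2 ^ ?d) * \<Lambda> ^ ?d / n"
        by (rule divide_right_mono) simp
      then show ?thesis by (simp flip: pw)
    qed
    then have "(1 + exp 1 ^ ?d * (1 + \<Lambda>) ^ ?d) / n * (2 * \<sigma>\<^sup>2 + 9 * F\<^sup>2) \<le> (1 + exp 1 ^ ?d * 2 ^ ?d) * r * (2 * \<sigma>\<^sup>2 + 9 * F\<^sup>2)"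
      by (rule mult_right_mono) simp
    moreover have "4 * ?d * L\<^sup>2 / \<Lambda>\<^sup>2 = 4 * ?d * L\<^sup>2 * r" by (simp flip: sq)
    ultimately have "\<bar>quadratic_risk \<Omega> n (K n) (D n) (M n) X f\<bar> \<le> c * r"
      by (simp add: c_def algebra_simps)
    then show "norm (quadratic_risk \<Omega> n (K n) (D n) (M n) X f) \<le> c * norm (real n powr (- 2 / (CARD('d) + 2)))"
      by (simp add: r_def)
  qed
qed

end
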